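(* Let $\mu$ be a probability measure on $\mathbb{Z}$ with $m_1(\mu)<\infty$ and bounded angular ratio, and suppose that for some $0<\alpha\leq 1$ one has $\sum_{|k|\leq n}k^2\mu(k)=O(n^{1-\alpha})$ as $n\to\infty$. Let $\theta$ be the Fourier transform of $\mu$. Suppose that for some $\delta>0$ the second derivative $\theta''(t)$ exists for all $0<|t|<\delta$ and that on this set $\mathrm{Re}(\theta''(t))<0$ and $\mathrm{Re}(\theta''(t))=p(t)+O(1)$ (i.e. $\mathrm{Re}(\theta'')-p$ is bounded there), where $p$ is a real function that is non-decreasing in $|t|$ on this set (i.e. $p(t)\le p(s)$ whenever $t,s$ have the same sign and $0<|t|\le|s|<\delta$). Then for every probability space $(X,\mathcal{B},\lambda)$, every invertible measure preserving transformation $T:X\to X$ and every $f\in L^1(X)$, the sequence $\{\mu^n f(x)\}_{n\ge1}$ converges for $\lambda$-a.e. $x\in X$.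
   Context: For a probability measure $\mu$ on $\mathbb{Z}$: $m_1(\mu)=\sum_{k}|k|\mu(k)$; the Fourier transform is $\theta(t)=\hat\mu(t)=\sum_{k\in\mathbb{Z}}\mu(k)e^{2\pi i kt}$, $t\in[-1/2,1/2)$ (1-periodic in $t$); $\mu^n$ is the $n$-fold convolution of $\mu$ with itself, $\mu^n(k)=\sum_j\mu(j)\mu^{n-1}(k-j)$, $\mu^1=\mu$. $\mu$ is strictly aperiodic if its support is not contained in a coset of a proper subgroup of $\mathbb{Z}$. $\mu$ has bounded angular ratio if it is strictly aperiodic and $1\le\sup_{t\neq0}\frac{|\hat\mu(t)-1|}{1-|\hat\mu(t)|}<\infty$ (supremum over $t\in[-1/2,1/2)$, $t\ne0$). For $f\in L^1(X)$, $\mu^n f(x)=\sum_{k\in\mathbb{Z}}\mu^n(k)f(T^kx)$. *)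

theory Defs
  imports
    "HOL-Probability.Probability"
    "HOL-Library.Landau_Symbols"
    "HOL-Algebra.Elementary_Groups"
begin

text \<open>Probability measures on the integers are represented by the type \<^typ>\<open>int pmf\<close>.\<close>

definition finite_first_moment :: "int pmf \<Rightarrow> bool" where
  "finite_first_moment \<mu> \<longleftrightarrow> (\<lambda>k. \<bar>real_of_int k\<bar> * pmf \<mu> k) summable_on UNIV"

text \<open>The Fourier transform is defined on all of the real line, where it is 1-periodic.\<close>

definition fourier :: "int pmf \<Rightarrow> real \<Rightarrow> complex" where
  "fourier \<mu> t = (\<Sum>\<^sub>\<infinity>k. of_real (pmf \<mu> k) * exp (2 * of_real pi * \<i> * of_int k * of_real t))"

definition strictly_aperiodic :: "int pmf \<Rightarrow> bool" where
  "strictly_aperiodic \<mu> \<longleftrightarrow>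
     \<not> (\<exists>H C. subgroup H integer_group \<and> H \<noteq> carrier integer_group \<and>
            C \<in> rcosets\<^bsub>integer_group\<^esub> H \<and> set_pmf \<mu> \<subseteq> C)"

text \<open>
  The supremum is taken in the extended reals, so that its finiteness is a genuine condition.
  Strict aperiodicity makes all the denominators positive.
\<close>

definition angular_ratio_sup :: "int pmf \<Rightarrow> ereal" where
  "angular_ratio_sup \<mu> =
     (SUP t \<in> {- 1/2 ..< 1/2} - {0}.
        ereal (cmod (fourier \<mu> t - 1) / (1 - cmod (fourier \<mu> t))))"

definition bounded_angular_ratio :: "int pmf \<Rightarrow> bool" where
  "bounded_angular_ratio \<mu> \<longleftrightarrow>
     strictly_aperiodic \<mu> \<and> 1 \<le> angular_ratio_sup \<mu> \<and> angular_ratio_sup \<mu> < \<infinity>"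

text \<open>Convolution powers; the value at exponent 0 is the unit mass at 0.\<close>

fun conv_power :: "int pmf \<Rightarrow> nat \<Rightarrow> int \<Rightarrow> real" where
  "conv_power \<mu> 0 k = of_bool (k = 0)"
| "conv_power \<mu> (Suc 0) k = pmf \<mu> k"
| "conv_power \<mu> (Suc (Suc n)) k = (\<Sum>\<^sub>\<infinity>j. pmf \<mu> j * conv_power \<mu> (Suc n) (k - j))"

definition invertible_measure_preserving :: "'a measure \<Rightarrow> ('a \<Rightarrow> 'a) \<Rightarrow> bool" where
  "invertible_measure_preserving M T \<longleftrightarrow>
     bij_betw T (space M) (space M) \<and>
     T \<in> measurable M M \<and>
     inv_into (space M) T \<in> measurable M M \<and>
     (\<forall>A \<in> sets M. emeasure M (T -` A \<inter> space M) = emeasure M A)"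

definition int_iterate :: "'a measure \<Rightarrow> ('a \<Rightarrow> 'a) \<Rightarrow> int \<Rightarrow> 'a \<Rightarrow> 'a" where
  "int_iterate M T k =
     (if 0 \<le> k then T ^^ nat k else inv_into (space M) T ^^ nat (- k))"

text \<open>
  For integrable \<open>f\<close> and measure preserving \<open>T\<close> the series below is
  absolutely convergent for almost every \<open>x\<close>, by Tonelli's theorem.
\<close>

definition conv_average ::
    "'a measure \<Rightarrow> ('a \<Rightarrow> 'a) \<Rightarrow> int pmf \<Rightarrow> nat \<Rightarrow> ('a \<Rightarrow> complex) \<Rightarrow> 'a \<Rightarrow> complex" where
  "conv_average M T \<mu> n f x =
     (\<Sum>\<^sub>\<infinity>k. of_real (conv_power \<mu> n k) * f (int_iterate M T k x))"

end

theory Submission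
  imports Defs
begin

text \<open>
  Let \<open>\<theta>\<close> be the Fourier transform of \<open>\<mu>\<close>, let \<open>u = 1 - Re \<theta>\<close> be its defect, let
  \<open>K n\<close> be the \<open>n\<close>-th convolution power and \<open>E n = K (n + 1) - K n\<close>.

  Almost everywhere convergence follows from two properties of the kernels \<open>K n\<close>: a weak type
  (1,1) inequality for the maximal operator, and asymptotic invariance, meaning that
  \<open>K n (x + 1) - K n x\<close> tends to 0 in \<open>l\<^sup>1\<close>.  Invariant functions are fixed by the averages, and
  asymptotic invariance makes the averages of \<open>g - g \<circ> T\<close> tend to 0 uniformly when \<open>g\<close> is bounded.
  By the mean ergodic theorem every integrable function is a sum of such functions up to an
  error of small \<open>L\<^sup>1\<close> norm (\<open>coboundary_decomposition\<close>), and the maximal inequality controls the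
  averages of that error.

  By transference (\<open>measure_exceeds\<close>) it is enough to prove the maximal inequality on the
  integers.  There it is a Calderon-Zygmund argument (\<open>weak_type_integers\<close>): the good part is
  harmless because the kernels are probabilities, and the bad part requires the Hormander
  condition that the sum of \<open>sup\<^sub>n \<bar>K n (x + y) - K n x\<bar>\<close> over \<open>\<bar>x\<bar> \<ge> 2 Y\<close> be bounded
  uniformly in \<open>\<bar>y\<bar> \<le> Y\<close>.

  The Hormander condition rests on two facts.  The angular ratio bound gives
  \<open>\<bar>\<theta> - 1\<bar> \<le> B u\<close> and \<open>\<bar>\<theta>\<bar> \<le> 1 - u / B\<close>.  The defect is convex to the right of 0, because
  \<open>Re \<theta>'' < 0\<close> there, and bounded below away from 0; so \<open>u(s) / s \<le> C u(t) / t\<close> for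
  \<open>0 < s \<le> t \<le> 1/2\<close>.  Moreover, the second difference of \<open>\<theta>\<close> with
  step \<open>h\<close> is at most \<open>2 u(h)\<close> at every point, so a dyadic recursion yields
  \<open>\<bar>\<theta>(t + h) - \<theta>(t)\<bar> \<le> A (h/t)\<^bsup>3/4\<^esup> u(t)\<close> (\<open>fourier_increment\<close>), for the real and the
  imaginary part alike.  The exponent exceeds 1/2, which is what an \<open>L\<^sup>2\<close> estimate requires: Bessel's
  inequality, applied to differences of the Fourier transform \<open>\<theta>\<^sup>n (\<theta> - 1)\<close> of \<open>E n\<close>, bounds the sum
  of \<open>\<bar>E n\<bar>\<close> over dyadic shells.  With \<open>\<tau> = n u(1/Y)\<close> the outcome is that the sum of
  \<open>\<bar>E n (x + y) - E n x\<bar>\<close> over \<open>\<bar>x\<bar> \<ge> 2 Y\<close> is at most a constant times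
  \<open>min \<tau>\<^sup>a \<tau>\<^bsup>-a\<^esup> / n\<close> with \<open>a = 1/128\<close>.  These bounds have a sum over \<open>n\<close> that does not depend on
  \<open>Y\<close>; so even the total variation in \<open>n\<close> of the kernels satisfies the Hormander condition.
\<close>

section \<open>Fourier series of probability measures on the integers\<close>

definition chi :: "int \<Rightarrow> real \<Rightarrow> complex" where
  "chi k t = cis (2 * pi * of_int k * t)"

lemma norm_chi [simp]: "cmod (chi k t) = 1"
  by (simp add: chi_def)

lemma chi_zero [simp]: "chi 0 t = 1" "chi k 0 = 1"
  by (simp_all add: chi_def)

lemma chi_add_freq: "chi (j + k) t = chi j t * chi k t"
  by (simp add: chi_def cis_mult algebra_simps)

lemma chi_add: "chi k (s + t) = chi k s * chi k t"
  by (simp add: chi_def cis_mult algebra_simps)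

lemma chi_uminus: "chi (- k) t = cnj (chi k t)" "chi k (- t) = cnj (chi k t)"
  by (simp_all add: chi_def cis_cnj)

lemma chi_of_int [simp]: "chi k (of_int m) = 1"
proof -
  have "chi k (of_int m) = cis (2 * pi * of_int (k * m))"
    by (simp add: chi_def mult.assoc)
  also have "\<dots> = 1"
    by (rule cis_multiple_2pi) simp
  finally show ?thesis .
qed

lemma continuous_chi [continuous_intros]: "continuous_on A (chi k)"
  unfolding chi_def by (intro continuous_intros)

lemma cmod_chi_diff_1: "cmod (chi k t - 1) ^ 2 = 2 * (1 - cos (2 * pi * of_int k * t))"
proof -
  have "cmod (chi k t - 1) ^ 2
      = (cos (2 * pi * of_int k * t) - 1)\<^sup>2 + (sin (2 * pi * of_int k * t))\<^sup>2"
    by (simp add: chi_def cmod_power2)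
  also have "\<dots> = 2 * (1 - cos (2 * pi * of_int k * t))"
    by (simp add: sin_squared_eq power2_eq_square algebra_simps)
  finally show ?thesis .
qed

lemma cmod_chi_diff_1_le: "cmod (chi k t - 1) \<le> 2 * pi * \<bar>of_int k\<bar> * \<bar>t\<bar>"
proof -
  define a where "a = pi * of_int k * t"
  have "1 - cos (2 * a) = 2 * (sin a)\<^sup>2"
    by (simp add: cos_double_sin)
  hence "cmod (chi k t - 1) ^ 2 = (2 * \<bar>sin a\<bar>)\<^sup>2"
    unfolding cmod_chi_diff_1 by (simp add: a_def mult.assoc power2_eq_square)
  hence "cmod (chi k t - 1) = 2 * \<bar>sin a\<bar>"
    by (metis abs_ge_zero norm_ge_zero power2_eq_iff_nonneg mult_nonneg_nonneg zero_le_numeral)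
  also have "\<bar>sin a\<bar> \<le> \<bar>a\<bar>"
    by (rule abs_sin_x_le_abs_x)
  finally show ?thesis
    by (simp add: a_def abs_mult)
qed

lemma pmf_has_sum_1: "(pmf p has_sum 1) UNIV"
proof -
  have "infsetsum (pmf p) UNIV = 1"
    by (rule infsetsum_pmf_eq_1) simp
  moreover have "Infinite_Set_Sum.abs_summable_on (pmf p) UNIV"
    by (rule pmf_abs_summable)
  ultimately have "infsum (pmf p) UNIV = 1" "pmf p summable_on UNIV"
    using infsetsum_infsum abs_summable_equivalent abs_summable_summable by metis+
  thus ?thesis
    by (simp add: has_sum_iff)
qed

lemma sum_pmf_le_1: "finite A \<Longrightarrow> sum (pmf p) A \<le> 1"
  by (metis measure_measure_pmf_finite measure_pmf.prob_le_1)

lemma expectation_eq_infsum: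
  fixes g :: "'a \<Rightarrow> complex"
  assumes "\<And>k. cmod (g k) \<le> b"
  shows "measure_pmf.expectation p g = (\<Sum>\<^sub>\<infinity>k. of_real (pmf p k) * g k)"
    and "Infinite_Sum.abs_summable_on (\<lambda>k. of_real (pmf p k) * g k) UNIV"
proof -
  have "norm (of_real (pmf p k) * g k) \<le> pmf p k * b" for k
    using assms[of k] by (simp add: norm_mult mult_left_mono)
  moreover have "(\<lambda>k. pmf p k * b) summable_on UNIV"
    using pmf_has_sum_1 has_sum_cmult_left summable_on_def by blast
  ultimately show *: "Infinite_Sum.abs_summable_on (\<lambda>k. of_real (pmf p k) * g k) UNIV"
    by (intro Infinite_Sum.abs_summable_on_comparison_test'[where g = "\<lambda>k. pmf p k * b"]) auto
  have "measure_pmf.expectation p g = (\<Sum>\<^sub>ak. of_real (pmf p k) * g k)"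
    unfolding infsetsum_def measure_pmf_eq_density
    by (subst integral_density) (simp_all add: scaleR_conv_of_real)
  also have "\<dots> = (\<Sum>\<^sub>\<infinity>k. of_real (pmf p k) * g k)"
    by (rule infsetsum_infsum) (use * abs_summable_equivalent in blast)
  finally show "measure_pmf.expectation p g = (\<Sum>\<^sub>\<infinity>k. of_real (pmf p k) * g k)" .
qed

lemma integrable_pmf_bounded:
  fixes g :: "'a \<Rightarrow> 'b::{banach, second_countable_topology}"
  assumes "\<And>k. norm (g k) \<le> b"
  shows "integrable (measure_pmf p) g"
  by (rule measure_pmf.integrable_const_bound[where B = b]) (use assms in auto)

lemma fourier_infsum: "fourier \<nu> t = (\<Sum>\<^sub>\<infinity>k. of_real (pmf \<nu> k) * chi k t)"
proof -
  have "exp (2 * of_real pi * \<i> * of_int k * of_real t) = chi k t" for k :: int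
    by (simp add: chi_def cis_conv_exp mult_ac)
  thus ?thesis
    by (simp add: fourier_def)
qed

lemma fourier_expectation: "fourier \<nu> t = measure_pmf.expectation \<nu> (\<lambda>k. chi k t)"
  unfolding fourier_infsum by (subst expectation_eq_infsum[where b = 1]) auto

lemma integrable_chi [simp]: "integrable (measure_pmf \<nu>) (\<lambda>k. chi k t)"
  by (rule integrable_pmf_bounded[where b = 1]) simp

lemma integrable_cos [simp]: "integrable (measure_pmf \<nu>) (\<lambda>k. cos (f k) :: real)"
  by (rule integrable_pmf_bounded[where b = 1]) simp

lemma fourier_zero [simp]: "fourier \<nu> 0 = 1"
  by (simp add: fourier_expectation)

lemma fourier_periodic: "fourier \<nu> (t + of_int m) = fourier \<nu> t"
  by (simp add: fourier_expectation chi_add)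

lemma fourier_uminus: "fourier \<nu> (- t) = cnj (fourier \<nu> t)"
  by (simp add: fourier_expectation chi_uminus)

lemma norm_fourier_le_1: "cmod (fourier \<nu> t) \<le> 1"
proof -
  have "cmod (fourier \<nu> t) \<le> measure_pmf.expectation \<nu> (\<lambda>k. cmod (chi k t))"
    unfolding fourier_expectation by (rule integral_norm_bound)
  thus ?thesis by simp
qed

lemma uniform_limit_fourier:
  fixes g :: "int \<Rightarrow> real \<Rightarrow> complex"
  assumes "\<And>k t. cmod (g k t) \<le> 1"
  shows "uniform_limit A (\<lambda>F t. \<Sum>k\<in>F. of_real (pmf \<nu> k) * g k t)
           (\<lambda>t. \<Sum>\<^sub>\<infinity>k. of_real (pmf \<nu> k) * g k t) (finite_subsets_at_top UNIV)"
proof (rule Weierstrass_m_test_general[where M = "pmf \<nu>"])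
  show "pmf \<nu> summable_on UNIV"
    using pmf_has_sum_1 summable_on_def by blast
  show "norm (of_real (pmf \<nu> k) * g k t) \<le> pmf \<nu> k" for k t
    using assms[of k t] mult_left_mono[of "cmod (g k t)" 1 "pmf \<nu> k"] by (simp add: norm_mult)
qed

lemma continuous_fourier: "continuous_on A (fourier \<nu>)"
proof -
  have "continuous_on A (\<lambda>t. \<Sum>\<^sub>\<infinity>k. of_real (pmf \<nu> k) * chi k t)"
    by (rule uniform_limit_theorem[OF _ uniform_limit_fourier])
       (auto intro!: always_eventually continuous_intros)
  thus ?thesis
    by (simp add: fourier_infsum[abs_def])
qed

lemma continuous_fourier' [continuous_intros]:
  "continuous_on A f \<Longrightarrow> continuous_on A (\<lambda>t. fourier \<nu> (f t))"
  using continuous_on_compose2[OF continuous_fourier[of UNIV \<nu>]] by auto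

lemma chi_has_integral:
  "((\<lambda>t. chi k t) has_integral (if k = 0 then 1 else 0)) {- 1/2..1/2}"
proof (cases "k = 0")
  case True
  thus ?thesis
    using has_integral_const_real[of "1::complex" "-1/2" "1/2"] by simp
next
  case False
  define a :: complex where "a = 2 * pi * of_int k * \<i>"
  have a: "a \<noteq> 0" using False by (simp add: a_def)
  have *: "chi k t = exp (a * of_real t)" for t
    by (simp add: chi_def cis_conv_exp a_def mult_ac)
  have "((\<lambda>t. chi k t) has_integral chi k (1/2) / a - chi k (- 1/2) / a) {- 1/2..1/2}"
  proof (rule fundamental_theorem_of_calculus)
    fix t :: real
    have "((\<lambda>z. exp (a * z) / a) has_field_derivative exp (a * of_real t)) (at (of_real t))"
      using a by (auto intro!: derivative_eq_intros)
    hence "((\<lambda>t. exp (a * of_real t) / a) has_vector_derivative exp (a * of_real t)) (at t)"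
      by (rule has_vector_derivative_real_field)
    thus "((\<lambda>t. chi k t / a) has_vector_derivative chi k t) (at t within {- 1/2..1/2})"
      unfolding * by (rule has_vector_derivative_at_within)
  qed simp
  moreover have "chi k (1/2) = chi k (- 1/2)"
    using chi_add[of k "- 1/2" 1] chi_of_int[of k 1] by (simp add: field_simps)
  ultimately show ?thesis
    using False by simp
qed

text \<open>
  The shift by \<open>h\<close> makes it possible to read off the coefficients of the increments of a
  Fourier series without shifting the domain of integration.
\<close>

lemma fourier_inversion:
  "((\<lambda>t. fourier \<nu> (t + h) * cnj (chi x t)) has_integral of_real (pmf \<nu> x) * chi x h) {- 1/2..1/2}"
proof -
  let ?I = "{- 1/2..1/2 :: real}" and ?g = "\<lambda>k t. chi k (t + h) * cnj (chi x t)"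
  have eq: "?g k t = chi k h * chi (k - x) t" for k t
    using chi_add_freq[of k "- x" t] by (simp add: chi_add chi_uminus)
  have lim: "uniform_limit ?I (\<lambda>F t. \<Sum>k\<in>F. of_real (pmf \<nu> k) * ?g k t)
      (\<lambda>t. \<Sum>\<^sub>\<infinity>k. of_real (pmf \<nu> k) * ?g k t) (finite_subsets_at_top UNIV)"
    by (rule uniform_limit_fourier) (simp add: norm_mult)
  have "continuous_on ?I (\<lambda>t. \<Sum>k\<in>F. of_real (pmf \<nu> k) * ?g k t)" for F
    unfolding eq by (intro continuous_intros)
  from uniform_limit_integral[OF lim this] obtain I J where
      I: "\<And>F. ((\<lambda>t. \<Sum>k\<in>F. of_real (pmf \<nu> k) * ?g k t) has_integral I F) ?I"
    and J: "((\<lambda>t. \<Sum>\<^sub>\<infinity>k. of_real (pmf \<nu> k) * ?g k t) has_integral J) ?I"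
    and IJ: "(I \<longlongrightarrow> J) (finite_subsets_at_top UNIV)"
    by auto
  have "I F = of_real (pmf \<nu> x) * chi x h" if "finite F" "{x} \<subseteq> F" for F
  proof (rule has_integral_unique[OF I])
    have "((\<lambda>t. \<Sum>k\<in>F. of_real (pmf \<nu> k) * ?g k t) has_integral
        (\<Sum>k\<in>F. of_real (pmf \<nu> k) * (chi k h * (if k - x = 0 then 1 else 0)))) ?I"
      unfolding eq by (intro has_integral_sum has_integral_mult_right chi_has_integral that)
    also have "(\<Sum>k\<in>F. of_real (pmf \<nu> k) * (chi k h * (if k - x = 0 then 1 else 0)))
        = (\<Sum>k\<in>F. if k = x then of_real (pmf \<nu> k) * chi k h else (0::complex))"
      by (intro sum.cong) auto
    also have "\<dots> = of_real (pmf \<nu> x) * chi x h"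
      using that by simp
    finally show "((\<lambda>t. \<Sum>k\<in>F. of_real (pmf \<nu> k) * ?g k t) has_integral
        of_real (pmf \<nu> x) * chi x h) ?I" .
  qed
  hence "\<forall>\<^sub>F F in finite_subsets_at_top UNIV. I F = of_real (pmf \<nu> x) * chi x h"
    unfolding eventually_finite_subsets_at_top by (intro exI[of _ "{x}"]) auto
  from tendsto_unique[OF _ IJ tendsto_eventually[OF this]]
  have "J = of_real (pmf \<nu> x) * chi x h" by simp
  moreover have "(\<Sum>\<^sub>\<infinity>k. of_real (pmf \<nu> k) * ?g k t) = fourier \<nu> (t + h) * cnj (chi x t)" for t
    unfolding fourier_infsum mult.assoc[symmetric] by (rule infsum_cmult_left')
  ultimately show ?thesis
    using J by simp
qed

lemma bessel_inequality:
  fixes F :: "real \<Rightarrow> complex" and c :: "int \<Rightarrow> complex"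
  assumes cont: "continuous_on {- 1/2..1/2} F" and X: "finite X"
    and c: "\<And>x. x \<in> X \<Longrightarrow> ((\<lambda>t. F t * cnj (chi x t)) has_integral c x) {- 1/2..1/2}"
    and I: "((\<lambda>t. cmod (F t) ^ 2) has_integral I) {- 1/2..1/2}"
  shows "(\<Sum>x\<in>X. cmod (c x) ^ 2) \<le> I"
proof -
  let ?I = "{- 1/2..1/2 :: real}"
  define S where "S t = (\<Sum>x\<in>X. c x * chi x t)" for t
  define N where "N = (\<Sum>x\<in>X. cmod (c x) ^ 2)"
  have FS: "((\<lambda>t. F t * cnj (S t)) has_integral of_real N) ?I"
  proof -
    have "((\<lambda>t. \<Sum>x\<in>X. cnj (c x) * (F t * cnj (chi x t))) has_integral (\<Sum>x\<in>X. cnj (c x) * c x)) ?I"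
      by (intro has_integral_sum X has_integral_mult_right c)
    moreover have "(\<Sum>x\<in>X. cnj (c x) * c x) = of_real N"
      unfolding N_def of_real_sum by (intro sum.cong refl) (simp add: complex_norm_square mult.commute del: of_real_power)
    moreover have "(\<Sum>x\<in>X. cnj (c x) * (F t * cnj (chi x t))) = F t * cnj (S t)" for t
      unfolding S_def by (simp add: sum_distrib_left mult_ac)
    ultimately show ?thesis by simp
  qed
  have SS: "((\<lambda>t. S t * cnj (S t)) has_integral of_real N) ?I"
  proof -
    have "((\<lambda>t. \<Sum>x\<in>X. \<Sum>y\<in>X. c x * cnj (c y) * chi (x - y) t) has_integral
        (\<Sum>x\<in>X. \<Sum>y\<in>X. c x * cnj (c y) * (if x - y = 0 then 1 else 0))) ?I"
      by (intro has_integral_sum X has_integral_mult_right chi_has_integral)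
    moreover have "(\<Sum>x\<in>X. \<Sum>y\<in>X. c x * cnj (c y) * (if x - y = 0 then 1 else 0)) = of_real N"
    proof -
      have "(\<Sum>y\<in>X. c x * cnj (c y) * (if x - y = 0 then 1 else 0)) = c x * cnj (c x)" if "x \<in> X" for x
      proof -
        have "(\<Sum>y\<in>X. c x * cnj (c y) * (if x - y = 0 then 1 else 0))
            = (\<Sum>y\<in>X. if y = x then c x * cnj (c y) else 0)"
          by (intro sum.cong) auto
        thus ?thesis using X that by simp
      qed
      thus ?thesis
        unfolding N_def of_real_sum
        by (intro sum.cong refl) (simp add: complex_norm_square del: of_real_power)
    qed
    moreover have "(\<Sum>x\<in>X. \<Sum>y\<in>X. c x * cnj (c y) * chi (x - y) t) = S t * cnj (S t)" for t
    proof -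
      have "chi (x - y) t = chi x t * cnj (chi y t)" for x y
        using chi_add_freq[of x "- y" t] by (simp add: chi_uminus)
      thus ?thesis
        unfolding S_def by (simp add: sum_product mult_ac)
    qed
    ultimately show ?thesis by simp
  qed
  have re: "((\<lambda>t. Re (g t)) has_integral Re r) ?I" if "(g has_integral r) ?I" for g r
    using has_integral_linear[OF that bounded_linear_Re] by (simp add: o_def)
  have "((\<lambda>t. cmod (F t) ^ 2 - 2 * Re (F t * cnj (S t)) + Re (S t * cnj (S t))) has_integral
      I - 2 * Re (of_real N) + Re (of_real N)) ?I"
    by (intro has_integral_add has_integral_diff has_integral_mult_right I re FS SS)
  moreover have "cmod (F t) ^ 2 - 2 * Re (F t * cnj (S t)) + Re (S t * cnj (S t)) = cmod (F t - S t) ^ 2" for t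
    unfolding cmod_power2 by (simp add: power2_eq_square algebra_simps)
  ultimately have "((\<lambda>t. cmod (F t - S t) ^ 2) has_integral I - N) ?I" by simp
  hence "0 \<le> I - N"
    by (rule has_integral_nonneg) simp
  thus ?thesis by (simp add: N_def)
qed

section \<open>Convolution powers\<close>

text \<open>
  Realising the convolution powers as probability mass functions supplies their nonnegativity and
  their total mass.
\<close>

primrec conv_pmf :: "int pmf \<Rightarrow> nat \<Rightarrow> int pmf" where
  "conv_pmf \<mu> 0 = return_pmf 0"
| "conv_pmf \<mu> (Suc n) = bind_pmf \<mu> (\<lambda>j. map_pmf ((+) j) (conv_pmf \<mu> n))"

lemma pmf_map_plus: "pmf (map_pmf ((+) j) \<nu>) k = pmf \<nu> (k - j)" for j :: int
  using pmf_map_inj'[of "(+) j" \<nu> "k - j"] by (simp add: inj_def)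

lemma conv_pmf_Suc: "pmf (conv_pmf \<mu> (Suc n)) k = (\<Sum>\<^sub>\<infinity>j. pmf \<mu> j * pmf (conv_pmf \<mu> n) (k - j))"
proof -
  let ?g = "\<lambda>j. pmf (conv_pmf \<mu> n) (k - j)"
  have "Infinite_Sum.abs_summable_on (\<lambda>j. pmf \<mu> j * ?g j) UNIV"
    by (rule Infinite_Sum.abs_summable_on_comparison_test'[where g = "pmf \<mu>"])
       (use pmf_has_sum_1 summable_on_def in \<open>auto intro!: mult_left_le pmf_le_1\<close>)
  hence "infsetsum (\<lambda>j. pmf \<mu> j * ?g j) UNIV = (\<Sum>\<^sub>\<infinity>j. pmf \<mu> j * ?g j)"
    using abs_summable_equivalent infsetsum_infsum by blast
  thus ?thesis
    by (simp add: pmf_bind pmf_map_plus pmf_expectation_eq_infsetsum)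
qed

lemma conv_power_eq_pmf: "conv_power \<mu> n = pmf (conv_pmf \<mu> n)"
proof (induction \<mu> n rule: conv_power.induct[where P = "\<lambda>\<mu> n k. conv_power \<mu> n = pmf (conv_pmf \<mu> n)"])
  case (1 \<mu> k)
  show ?case by (auto simp: fun_eq_iff indicator_def)
next
  case (2 \<mu> k)
  have "bind_pmf \<mu> (\<lambda>j. return_pmf (j + 0)) = \<mu>"
    by (simp add: bind_return_pmf')
  thus ?case by (auto simp: fun_eq_iff)
next
  case (3 \<mu> n k)
  show ?case
    unfolding fun_eq_iff conv_pmf_Suc[of \<mu> "Suc n"] using 3 by simp
qed

text \<open>
  The multiplicativity of the Fourier transform is Fubini's theorem for the double series that
  defines the convolution, absolutely summable because both factors are probabilities.
\<close>

lemma fourier_conv_pmf: "fourier (conv_pmf \<mu> n) t = fourier \<mu> t ^ n"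
proof (induction n)
  case 0
  have "fourier (conv_pmf \<mu> 0) t = 1"
    by (simp add: fourier_expectation)
  thus ?case by simp
next
  case (Suc n)
  let ?\<nu> = "conv_pmf \<mu> n"
  define f where "f j k = (of_real (pmf \<mu> j) * of_real (pmf ?\<nu> (k - j)) * chi k t :: complex)" for j k
  have shift: "((\<lambda>k. pmf ?\<nu> (k - j)) has_sum 1) UNIV" for j
  proof -
    have "bij_betw (\<lambda>k. k - j) UNIV (UNIV :: int set)"
      by (rule bij_betwI[where g = "\<lambda>k. k + j"]) auto
    from has_sum_reindex_bij_betw[OF this, of "pmf ?\<nu>" 1] show ?thesis
      using pmf_has_sum_1[of ?\<nu>] by simp
  qed
  have summ: "Infinite_Sum.abs_summable_on (\<lambda>(j, k). f j k) (UNIV \<times> UNIV)"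
  proof (subst Infinite_Sum.abs_summable_on_Sigma_iff, intro conjI ballI)
    have norm: "norm (f j k) = pmf \<mu> j * pmf ?\<nu> (k - j)" for j k
      by (simp add: f_def norm_mult)
    have *: "((\<lambda>k. pmf \<mu> j * pmf ?\<nu> (k - j)) has_sum pmf \<mu> j * 1) UNIV" for j
      by (intro has_sum_cmult_right shift)
    show "Infinite_Sum.abs_summable_on (\<lambda>k. case (j, k) of (j, k) \<Rightarrow> f j k) UNIV" for j
      using * by (auto simp: norm summable_on_def)
    have "(\<Sum>\<^sub>\<infinity>k. norm (f j k)) = pmf \<mu> j" for j
      using infsumI[OF *] by (simp add: norm)
    thus "Infinite_Sum.abs_summable_on (\<lambda>j. \<Sum>\<^sub>\<infinity>k. norm (case (j, k) of (j, k) \<Rightarrow> f j k)) UNIV"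
      using pmf_has_sum_1[of \<mu>] by (auto simp: summable_on_def)
  qed
  have "fourier (conv_pmf \<mu> (Suc n)) t = (\<Sum>\<^sub>\<infinity>k. \<Sum>\<^sub>\<infinity>j. f j k)"
    unfolding fourier_infsum
  proof (rule infsum_cong)
    fix k
    have "Infinite_Sum.abs_summable_on (\<lambda>j. pmf \<mu> j * pmf ?\<nu> (k - j)) UNIV"
      by (rule Infinite_Sum.abs_summable_on_comparison_test'[where g = "pmf \<mu>"])
         (use pmf_has_sum_1 summable_on_def in \<open>auto intro!: mult_left_le pmf_le_1\<close>)
    hence s: "(\<lambda>j. pmf \<mu> j * pmf ?\<nu> (k - j)) summable_on UNIV"
      by (rule abs_summable_summable)
    have "(of_real (pmf (conv_pmf \<mu> (Suc n)) k) :: complex)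
        = (\<Sum>\<^sub>\<infinity>j. of_real (pmf \<mu> j * pmf ?\<nu> (k - j)))"
      unfolding conv_pmf_Suc by (rule infsumI[symmetric]) (intro has_sum_of_real has_sum_infsum s)
    hence "of_real (pmf (conv_pmf \<mu> (Suc n)) k) * chi k t
        = (\<Sum>\<^sub>\<infinity>j. of_real (pmf \<mu> j * pmf ?\<nu> (k - j))) * chi k t" by simp
    also have "\<dots> = (\<Sum>\<^sub>\<infinity>j. of_real (pmf \<mu> j * pmf ?\<nu> (k - j)) * chi k t)"
      by (rule infsum_cmult_left'[symmetric])
    finally show "of_real (pmf (conv_pmf \<mu> (Suc n)) k) * chi k t = (\<Sum>\<^sub>\<infinity>j. f j k)"
      by (simp add: f_def)
  qed
  also have "\<dots> = (\<Sum>\<^sub>\<infinity>j. \<Sum>\<^sub>\<infinity>k. f j k)"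
    using infsum_swap_banach[OF abs_summable_summable[OF summ]] by simp
  also have "\<dots> = (\<Sum>\<^sub>\<infinity>j. of_real (pmf \<mu> j) * chi j t * fourier ?\<nu> t)"
  proof (rule infsum_cong)
    fix j
    have bij: "bij_betw (\<lambda>k. k + j) UNIV (UNIV :: int set)"
      by (rule bij_betwI[where g = "\<lambda>k. k - j"]) auto
    have "(\<Sum>\<^sub>\<infinity>k. f j k) = (\<Sum>\<^sub>\<infinity>k. f j (k + j))"
      by (rule infsum_reindex_bij_betw[OF bij, symmetric])
    also have "\<dots> = (\<Sum>\<^sub>\<infinity>k. of_real (pmf \<mu> j) * chi j t * (of_real (pmf ?\<nu> k) * chi k t))"
      by (simp add: f_def chi_add_freq mult_ac)
    also have "\<dots> = of_real (pmf \<mu> j) * chi j t * fourier ?\<nu> t"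
      unfolding fourier_infsum by (rule infsum_cmult_right')
    finally show "(\<Sum>\<^sub>\<infinity>k. f j k) = of_real (pmf \<mu> j) * chi j t * fourier ?\<nu> t" .
  qed
  also have "\<dots> = fourier \<mu> t * fourier ?\<nu> t"
    unfolding fourier_infsum[of \<mu>] by (rule infsum_cmult_left')
  finally show ?case
    using Suc.IH by simp
qed

section \<open>The defect of a Fourier transform\<close>

definition defect :: "int pmf \<Rightarrow> real \<Rightarrow> real" where
  "defect \<nu> t = 1 - Re (fourier \<nu> t)"

lemma Re_expectation:
  fixes g :: "'a \<Rightarrow> complex"
  assumes "integrable (measure_pmf \<nu>) g"
  shows "Re (measure_pmf.expectation \<nu> g) = measure_pmf.expectation \<nu> (\<lambda>k. Re (g k))"
  by (rule integral_bounded_linear[OF bounded_linear_Re assms, symmetric])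

lemma defect_expectation:
  "defect \<nu> t = measure_pmf.expectation \<nu> (\<lambda>k. 1 - cos (2 * pi * of_int k * t))"
proof -
  have "Re (chi k t) = cos (2 * pi * of_int k * t)" for k
    by (simp add: chi_def)
  thus ?thesis
    unfolding defect_def fourier_expectation by (subst Re_expectation) simp_all
qed

lemma defect_zero [simp]: "defect \<nu> 0 = 0"
  by (simp add: defect_def)

lemma defect_nonneg [simp]: "0 \<le> defect \<nu> t"
  unfolding defect_expectation by (intro Bochner_Integration.integral_nonneg) simp

lemma defect_le_2: "defect \<nu> t \<le> 2"
  using norm_fourier_le_1[of \<nu> t] abs_Re_le_cmod[of "fourier \<nu> t"] by (simp add: defect_def)

lemma defect_uminus [simp]: "defect \<nu> (- t) = defect \<nu> t"
  by (simp add: defect_def fourier_uminus)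

lemma defect_abs [simp]: "defect \<nu> \<bar>t\<bar> = defect \<nu> t"
  by (simp add: abs_if)

lemma defect_reflect: "defect \<nu> (1 - t) = defect \<nu> t"
  using fourier_periodic[of \<nu> "- t" 1] by (simp add: defect_def fourier_uminus)

lemma defect_double: "defect \<nu> (2 * t) \<le> 4 * defect \<nu> t"
proof -
  have "1 - cos (2 * x) \<le> 4 * (1 - cos x)" for x :: real
  proof -
    have "4 * (1 - cos x) - (1 - cos (2 * x)) = 2 * (1 - cos x)\<^sup>2"
      using cos_double_cos[of x] by (simp add: power2_eq_square algebra_simps)
    thus ?thesis
      using zero_le_power2[of "1 - cos x"] by linarith
  qed
  from this[of "2 * pi * of_int k * t" for k]
  have "measure_pmf.expectation \<nu> (\<lambda>k. 1 - cos (2 * pi * of_int k * (2 * t)))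
      \<le> measure_pmf.expectation \<nu> (\<lambda>k. 4 * (1 - cos (2 * pi * of_int k * t)))"
    by (intro integral_mono) (simp_all add: mult_ac)
  thus ?thesis
    by (simp add: defect_expectation)
qed

text \<open>
  The defect is half the mean square distance of the characters from 1, and that distance
  is subadditive in \<open>t\<close>.
\<close>

lemma defect_add: "defect \<nu> (a + b) \<le> 2 * defect \<nu> a + 2 * defect \<nu> b"
proof -
  have *: "1 - cos (2 * pi * of_int k * (a + b))
      \<le> 2 * (1 - cos (2 * pi * of_int k * a)) + 2 * (1 - cos (2 * pi * of_int k * b))" for k :: int
  proof -
    let ?x = "cmod (chi k a - 1)" and ?y = "cmod (chi k b - 1)"
    have "chi k (a + b) - 1 = chi k b * (chi k a - 1) + (chi k b - 1)"
      by (simp add: chi_add algebra_simps)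
    hence "cmod (chi k (a + b) - 1) \<le> ?x + ?y"
      using norm_triangle_ineq[of "chi k b * (chi k a - 1)" "chi k b - 1"] by (simp only: norm_mult norm_chi mult_1)
    hence "cmod (chi k (a + b) - 1) ^ 2 \<le> (?x + ?y)\<^sup>2"
      by (intro power_mono) auto
    also have "\<dots> \<le> 2 * ?x\<^sup>2 + 2 * ?y\<^sup>2"
      using zero_le_power2[of "?x - ?y"] by (simp add: power2_eq_square algebra_simps)
    finally have "2 * (1 - cos (2 * pi * of_int k * (a + b)))
        \<le> 2 * (2 * (1 - cos (2 * pi * of_int k * a))) + 2 * (2 * (1 - cos (2 * pi * of_int k * b)))"
      unfolding cmod_chi_diff_1 .
    moreover have "P \<le> 2 * Q + 2 * R" if "2 * P \<le> 2 * (2 * Q) + 2 * (2 * R)" for P Q R :: real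
      using that by linarith
    ultimately show ?thesis by blast
  qed
  have "measure_pmf.expectation \<nu> (\<lambda>k. 1 - cos (2 * pi * of_int k * (a + b)))
      \<le> measure_pmf.expectation \<nu> (\<lambda>k. 2 * (1 - cos (2 * pi * of_int k * a))
          + 2 * (1 - cos (2 * pi * of_int k * b)))"
    by (intro integral_mono *) simp_all
  thus ?thesis
    by (simp add: defect_expectation)
qed

text \<open>
  The second difference of a character at \<open>t\<close> is the character times \<open>- 2 (1 - cos (2 \<pi> k h))\<close>, whose
  sign does not depend on \<open>k\<close>.  Hence the defect at the single point \<open>h\<close> controls the second
  difference with step \<open>h\<close> everywhere.
\<close>

lemma fourier_second_difference:
  "cmod (fourier \<nu> (t + h) + fourier \<nu> (t - h) - 2 * fourier \<nu> t) \<le> 2 * defect \<nu> h"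
proof -
  have *: "chi k (t + h) + chi k (t - h) - 2 * chi k t
      = chi k t * of_real (- 2 * (1 - cos (2 * pi * of_int k * h)))" for k
  proof -
    have "chi k h + cnj (chi k h) = of_real (2 * cos (2 * pi * of_int k * h))"
      by (simp add: chi_def complex_add_cnj)
    thus ?thesis
      using chi_add[of k t "- h"]
      by (simp add: chi_add chi_uminus distrib_left[symmetric] right_diff_distrib)
  qed
  have "fourier \<nu> (t + h) + fourier \<nu> (t - h) - 2 * fourier \<nu> t
      = measure_pmf.expectation \<nu> (\<lambda>k. chi k (t + h) + chi k (t - h) - 2 * chi k t)"
    unfolding fourier_expectation by simp
  also have "cmod \<dots> \<le> measure_pmf.expectation \<nu> (\<lambda>k. cmod (chi k (t + h) + chi k (t - h) - 2 * chi k t))"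
    by (rule integral_norm_bound)
  also have "\<dots> = 2 * defect \<nu> h"
    unfolding * defect_expectation norm_mult norm_of_real norm_chi
    by (simp add: abs_mult abs_of_nonneg del: of_real_mult of_real_diff of_real_minus)
  finally show ?thesis .
qed

section \<open>Elementary estimates\<close>

lemma norm_power_diff_le:
  fixes a b :: "'a::{comm_ring_1, real_normed_algebra_1}"
  assumes "norm a \<le> r" "norm b \<le> r"
  shows "norm (a ^ n - b ^ n) \<le> real n * r ^ (n - 1) * norm (a - b)"
proof (induction n)
  case (Suc n)
  have r: "0 \<le> r" using assms(1) norm_ge_zero order_trans by blast
  have "a ^ Suc n - b ^ Suc n = a * (a ^ n - b ^ n) + (a - b) * b ^ n"
    by (simp add: algebra_simps)
  hence "norm (a ^ Suc n - b ^ Suc n) \<le> norm a * norm (a ^ n - b ^ n) + norm (a - b) * norm (b ^ n)"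
    by (metis add_mono norm_mult_ineq norm_triangle_le)
  also have "norm a * norm (a ^ n - b ^ n) \<le> r * (real n * r ^ (n - 1) * norm (a - b))"
    by (intro mult_mono assms Suc.IH r) auto
  also have "r * (real n * r ^ (n - 1) * norm (a - b)) = real n * r ^ n * norm (a - b)"
    by (cases n) auto
  also have "norm (a - b) * norm (b ^ n) \<le> norm (a - b) * r ^ n"
    by (intro mult_left_mono order_trans[OF norm_power_ineq] power_mono assms) auto
  finally show ?case
    by (simp add: algebra_simps)
qed simp

lemma one_minus_power_le_exp:
  fixes z :: real
  assumes "0 \<le> z" "z \<le> 1" "0 < n"
  shows "(1 - z) ^ (n - 1) \<le> 3 * exp (- (real n * z))"
proof -
  have "(1 - z) ^ (n - 1) \<le> exp (- z) ^ (n - 1)"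
    using assms exp_ge_add_one_self[of "- z"] by (intro power_mono) auto
  also have "\<dots> = exp z * exp (- (real n * z))"
    using assms by (simp add: exp_of_nat_mult[symmetric] of_nat_diff algebra_simps flip: exp_add)
  also have "exp z \<le> 3"
    using exp_le assms by (metis exp_le_cancel_iff order_trans)
  finally show ?thesis by simp
qed

lemma power2_times_exp_le:
  fixes w c :: real
  assumes "0 < c" "0 \<le> w"
  shows "w\<^sup>2 * exp (- (c * w)) \<le> 2 / c\<^sup>2"
proof -
  have "0 \<le> c * w" using assms by simp
  with exp_lower_Taylor_quadratic[OF this] have "(c * w)\<^sup>2 / 2 \<le> exp (c * w)" by linarith
  hence "(c * w)\<^sup>2 * exp (- (c * w)) \<le> 2"
    by (simp add: exp_minus field_simps)
  thus ?thesis
    using assms by (simp add: power_mult_distrib field_simps)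
qed

text \<open>
  Here \<open>z\<close> is a value of the defect.  The exponential decay is traded for a small power of \<open>w = n z\<close>;
  the power is so small that its square times \<open>(h/t)\<^bsup>3/2\<^esup>\<close> remains integrable at infinity after \<open>w\<close> is
  estimated by a multiple of \<open>t\<^sup>2\<close>.
\<close>

lemma defect_decay_small_power:
  fixes z c B :: real
  assumes "0 < c" "c \<le> 1" "0 \<le> z" "c * z \<le> 1" "0 < n" "1 \<le> B"
  defines "w \<equiv> real n * z"
  shows "w * (1 + B * w) * (1 - c * z) ^ (n - 1) \<le> 6 * (1 + B) / c\<^sup>2 * w powr (1/16)"
proof -
  have w: "0 \<le> w" using assms by (simp add: w_def)
  have e: "(1 - c * z) ^ (n - 1) \<le> 3 * exp (- (c * w))"
    using one_minus_power_le_exp[of "c * z" n] assms by (simp add: w_def mult_ac)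
  have c2: "1 \<le> 1 / c\<^sup>2"
    using assms by (simp add: power_le_one)
  show ?thesis
  proof (cases "w \<le> 1")
    case True
    have "(1 - c * z) ^ (n - 1) \<le> 1"
      using assms by (intro power_le_one) auto
    hence "w * (1 + B * w) * (1 - c * z) ^ (n - 1) \<le> w * (1 + B * w) * 1"
      using w assms by (intro mult_left_mono) auto
    also have "\<dots> \<le> w * (1 + B)"
      using w True assms mult_left_le[of w B] by (intro order_trans[OF _ mult_left_mono[of "1 + B * w" "1 + B" w]]) auto
    also have "w * (1 + B) \<le> w powr (1/16) * (1 + B)"
      using powr_mono'[of "1/16" 1 w] w True assms by (intro mult_right_mono) (cases "w = 0", auto)
    also have "w powr (1/16) * (1 + B) \<le> 6 * (1 + B) / c\<^sup>2 * w powr (1/16)"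
    proof -
      have "1 * (1 + B) \<le> (6 / c\<^sup>2) * (1 + B)"
        using c2 assms by (intro mult_right_mono) auto
      from mult_right_mono[OF this, of "w powr (1/16)"] show ?thesis by (simp add: mult_ac)
    qed
    finally show ?thesis .
  next
    case False
    have "w * (1 + B * w) * (1 - c * z) ^ (n - 1) \<le> ((1 + B) * w\<^sup>2) * (3 * exp (- (c * w)))"
    proof (rule mult_mono[OF _ e])
      show "w * (1 + B * w) \<le> (1 + B) * w\<^sup>2"
        using False by (simp add: power2_eq_square algebra_simps)
    qed (use assms w in auto)
    also have "\<dots> = 3 * (1 + B) * (w\<^sup>2 * exp (- (c * w)))" by simp
    also have "\<dots> \<le> 3 * (1 + B) * (2 / c\<^sup>2)"
      using assms w by (intro mult_left_mono power2_times_exp_le) auto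
    also have "\<dots> \<le> 6 * (1 + B) / c\<^sup>2 * w powr (1/16)"
    proof -
      have "1 \<le> w powr (1/16)" using False by (intro ge_one_powr_ge_zero) auto
      from mult_left_mono[OF this, of "6 * (1 + B) / c\<^sup>2"] show ?thesis
        using assms by simp
    qed
    finally show ?thesis .
  qed
qed

lemma has_integral_even:
  fixes g :: "real \<Rightarrow> real"
  assumes "(g has_integral I) {0..a}" "0 \<le> a"
  shows "((\<lambda>t. g \<bar>t\<bar>) has_integral 2 * I) {- a..a}"
proof -
  have 1: "((\<lambda>t. g \<bar>t\<bar>) has_integral I) {0..a}"
    by (rule has_integral_eq[OF _ assms(1)]) auto
  have "((\<lambda>t. g (- t)) has_integral I) {- a..- 0}"
    using assms(1) by (subst has_integral_reflect_real) auto
  hence 2: "((\<lambda>t. g \<bar>t\<bar>) has_integral I) {- a..0}"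
    using has_integral_eq[of "{- a..0}" "\<lambda>t. g (- t)" "\<lambda>t. g \<bar>t\<bar>" I] by auto
  show ?thesis
    using has_integral_combine[OF _ _ 2 1] assms(2) by simp
qed

lemma integral_decay_kernel:
  fixes h :: real
  assumes "0 < h"
  obtains I where "((\<lambda>t. (h / (h + \<bar>t\<bar>)) powr (5/4)) has_integral I) {- 1/2..1/2}" "I \<le> 8 * h"
proof -
  define g where "g t = (h / (h + t)) powr (5/4)" for t
  define G where "G t = - 4 * h powr (5/4) * (h + t) powr (- 1/4)" for t
  have g: "(g has_integral (G (1/2) - G 0)) {0..1/2}"
  proof (rule fundamental_theorem_of_calculus)
    fix t :: real
    assume "t \<in> {0..1/2}"
    hence ht: "0 < h + t" using assms by simp
    have "((\<lambda>t. (h + t) powr (- 1/4)) has_real_derivative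
        (- 1/4) * (h + t) powr (- 1/4 - of_nat 1) * 1) (at t)"
      by (rule DERIV_fun_powr[where g = "\<lambda>t. h + t", OF _ ht]) (auto intro!: derivative_eq_intros)
    hence "(G has_real_derivative
        - 4 * h powr (5/4) * ((- 1/4) * (h + t) powr (- 1/4 - of_nat 1) * 1)) (at t)"
      unfolding G_def by (rule DERIV_cmult)
    moreover have "- 4 * h powr (5/4) * ((- 1/4) * (h + t) powr (- 1/4 - of_nat 1) * 1) = g t"
    proof -
      have "(h + t) powr (- 1/4 - of_nat 1) = inverse ((h + t) powr (5/4))"
        using powr_minus[of "h + t" "5/4"] by simp
      moreover have "g t = h powr (5/4) * inverse ((h + t) powr (5/4))"
        unfolding g_def powr_divide by (rule divide_inverse)
      ultimately show ?thesis by simp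
    qed
    ultimately show "(G has_vector_derivative g t) (at t within {0..1/2})"
      by (simp only: has_real_derivative_iff_has_vector_derivative has_vector_derivative_at_within)
  qed simp
  have "(0::real) \<le> 1/2" by simp
  from has_integral_even[OF g this]
  have "((\<lambda>t. (h / (h + \<bar>t\<bar>)) powr (5/4)) has_integral (2 * (G (1/2) - G 0))) {- 1/2..1/2}"
    unfolding minus_divide_left g_def .
  moreover have "2 * (G (1/2) - G 0) \<le> 8 * h"
  proof -
    have "h powr (5/4) * h powr (- 1/4) = h powr 1"
      unfolding powr_add[symmetric] by simp
    hence "G 0 = - 4 * h"
      using assms by (simp add: G_def)
    moreover have "0 \<le> h powr (5/4) * (h + 1/2) powr (- 1/4)"
      by (intro mult_nonneg_nonneg powr_ge_zero)
    hence "G (1/2) \<le> 0"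
      unfolding G_def by linarith
    moreover have "2 * (a - b) \<le> 8 * h" if "b = - 4 * h" "a \<le> 0" for a b
      using that by simp
    ultimately show ?thesis by blast
  qed
  ultimately show thesis by (rule that)
qed

lemma integral_smoothness_kernel:
  fixes Y :: real
  assumes "0 < Y"
  obtains I where
    "((\<lambda>t. (\<bar>t\<bar> * Y) powr (- 1/2) * (1 + \<bar>t\<bar> * Y) powr (- 3/2)) has_integral I) {- 1/2..1/2}"
    "I \<le> 4 / Y"
proof -
  define g where "g t = (t * Y) powr (- 1/2) * (1 + t * Y) powr (- 3/2)" for t
  define G where "G t = 2 / Y * sqrt (t * Y / (1 + t * Y))" for t
  have g: "(g has_integral (G (1/2) - G 0)) {0..1/2}"
  proof (rule fundamental_theorem_of_calculus_interior)
    show "continuous_on {0..1/2} G"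
      unfolding G_def using assms by (intro continuous_intros) (auto simp: add_nonneg_eq_0_iff)
    fix t :: real
    assume t: "t \<in> {0<..<1/2}"
    define z where "z = t * Y"
    have z: "0 < z" using t assms by (simp add: z_def)
    have d: "((\<lambda>t. t * Y / (1 + t * Y)) has_real_derivative Y / (1 + z)\<^sup>2) (at t)"
      using z by (auto intro!: derivative_eq_intros simp: z_def power2_eq_square field_simps)
    have "(G has_real_derivative 2 / Y * (inverse (sqrt (z / (1 + z))) / 2 * (Y / (1 + z)\<^sup>2))) (at t)"
      unfolding G_def
      by (intro DERIV_cmult DERIV_chain2[OF DERIV_real_sqrt d, unfolded z_def[symmetric]]) (use z in simp)
    moreover have "2 / Y * (inverse (sqrt (z / (1 + z))) / 2 * (Y / (1 + z)\<^sup>2))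
        = z powr (- 1/2) * (1 + z) powr (- 3/2)"
    proof -
      have "(1 + z) powr (- 3/2) = (1 + z) powr (1/2) * (1 + z) powr (- 2)"
        by (simp flip: powr_add)
      also have "(1 + z) powr (1/2) = sqrt (1 + z)"
        using z by (simp add: powr_half_sqrt)
      also have "(1 + z) powr (- 2) = inverse ((1 + z)\<^sup>2)"
        using z by (simp add: powr_minus)
      finally have 1: "(1 + z) powr (- 3/2) = sqrt (1 + z) * inverse ((1 + z)\<^sup>2)" .
      have 2: "z powr (- 1/2) = inverse (sqrt z)"
        using z powr_minus[of z "1/2"] by (simp add: powr_half_sqrt)
      have 3: "sqrt (z / (1 + z)) = sqrt z / sqrt (1 + z)"
        by (rule real_sqrt_divide)
      have "2 / Y * (inverse (a / b) / 2 * (Y / q)) = inverse a * (b * inverse q)"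
        if "a \<noteq> 0" "b \<noteq> 0" "q \<noteq> 0" for a b q :: real
        using assms that by (simp add: field_simps)
      thus ?thesis
        unfolding 1 2 3 using z by (metis add_pos_pos less_numeral_extra(1) less_numeral_extra(3) power_not_zero real_sqrt_eq_zero_cancel_iff)
    qed
    ultimately show "(G has_vector_derivative g t) (at t)"
      by (simp only: has_real_derivative_iff_has_vector_derivative z_def g_def)
  qed simp
  have "(0::real) \<le> 1/2" by simp
  from has_integral_even[OF g this]
  have "((\<lambda>t. (\<bar>t\<bar> * Y) powr (- 1/2) * (1 + \<bar>t\<bar> * Y) powr (- 3/2)) has_integral 2 * (G (1/2) - G 0))
      {- 1/2..1/2}"
    unfolding minus_divide_left g_def .
  moreover have "2 * (G (1/2) - G 0) \<le> 4 / Y"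
  proof -
    have "sqrt (1/2 * Y / (1 + 1/2 * Y)) \<le> 1"
      unfolding real_sqrt_le_1_iff using assms by (subst divide_le_eq_1_pos) auto
    from mult_left_mono[OF this, of "2 / Y"] have "G (1/2) \<le> 2 / Y * 1"
      unfolding G_def using assms by (simp only: divide_nonneg_pos zero_le_numeral)
    hence "2 * (G (1/2) - 0) \<le> 2 * (2 / Y)"
      by (simp only: mult_1_right diff_0_right mult_le_cancel_left_pos zero_less_numeral)
    moreover have "G 0 = 0"
      unfolding G_def by simp
    ultimately show ?thesis by simp
  qed
  ultimately show thesis by (rule that)
qed

lemma card_int_le:
  fixes X :: "int set" and r :: real
  assumes "\<And>x. x \<in> X \<Longrightarrow> \<bar>real_of_int x\<bar> \<le> r" "0 \<le> r"
  shows "finite X" "real (card X) \<le> 2 * r + 1"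
proof -
  have sub: "X \<subseteq> {- \<lfloor>r\<rfloor>..\<lfloor>r\<rfloor>}"
  proof
    fix x assume "x \<in> X"
    hence "real_of_int x \<le> r" "real_of_int (- x) \<le> r" using assms(1)[of x] by auto
    hence "x \<le> \<lfloor>r\<rfloor>" "- x \<le> \<lfloor>r\<rfloor>" by (simp_all only: le_floor_iff)
    thus "x \<in> {- \<lfloor>r\<rfloor>..\<lfloor>r\<rfloor>}" by simp
  qed
  thus "finite X" by (rule finite_subset) simp
  have "card X \<le> card {- \<lfloor>r\<rfloor>..\<lfloor>r\<rfloor>}"
    using sub by (intro card_mono) auto
  also have "\<dots> = nat (2 * \<lfloor>r\<rfloor> + 1)" by simp
  finally have "real (card X) \<le> real (nat (2 * \<lfloor>r\<rfloor> + 1))" by simp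
  also have "\<dots> = 2 * real_of_int \<lfloor>r\<rfloor> + 1" using assms(2) by simp
  also have "\<dots> \<le> 2 * r + 1" by simp
  finally show "real (card X) \<le> 2 * r + 1" .
qed

lemma powr_squared: "(x powr a)\<^sup>2 = x powr (2 * a)" for x a :: real
  unfolding power2_eq_square powr_add[symmetric] mult_2 ..

text \<open>
  Of the two exponents, - 5/8 serves frequencies below \<open>1/Y\<close> and - 1 those above.
\<close>

lemma exp_decay_power_bound:
  fixes w d :: real
  assumes "0 < d" "d \<le> 1" "0 < w"
  shows "w * exp (- (d * w)) \<le> 2 / d\<^sup>2 * w powr (- 5/8)"
    and "w * exp (- (d * w)) \<le> 2 / d\<^sup>2 * w powr (- 1)"
proof -
  have d: "1 \<le> 1 / d\<^sup>2" using assms by (simp add: power_le_one)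
  have e: "w\<^sup>2 * exp (- (d * w)) \<le> 2 / d\<^sup>2"
    using assms by (intro power2_times_exp_le) auto
  have "w powr (13/8) * exp (- (d * w)) \<le> 2 / d\<^sup>2"
  proof (cases "w \<le> 1")
    case True
    have "w powr (13/8) * exp (- (d * w)) \<le> 1 * 1"
      using True assms by (intro mult_mono powr_le1) auto
    thus ?thesis using d by simp
  next
    case False
    have "w powr (13/8) \<le> w powr 2" using False by (intro powr_mono) auto
    also have "\<dots> = w\<^sup>2" using assms by simp
    finally have "w powr (13/8) * exp (- (d * w)) \<le> w\<^sup>2 * exp (- (d * w))"
      by (intro mult_right_mono) auto
    with e show ?thesis by linarith
  qed
  from mult_right_mono[OF this, of "w powr (- 5/8)"]
  have "w powr (13/8) * w powr (- 5/8) * exp (- (d * w)) \<le> 2 / d\<^sup>2 * w powr (- 5/8)"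
    by (simp add: mult_ac)
  moreover have "w powr (13/8) * w powr (- 5/8) = w"
    unfolding powr_add[symmetric] using assms by simp
  ultimately show "w * exp (- (d * w)) \<le> 2 / d\<^sup>2 * w powr (- 5/8)" by simp
  from mult_right_mono[OF e, of "w powr (- 1)"]
  show "w * exp (- (d * w)) \<le> 2 / d\<^sup>2 * w powr (- 1)"
    using assms by (simp add: powr_minus power2_eq_square field_simps)
qed

lemma powr_neg_le_one:
  fixes w a :: real
  assumes "1 < w" "0 \<le> a"
  shows "w powr (- a) \<le> 1"
  using powr_mono[of "- a" 0 w] assms by simp

text \<open>
  As \<open>n\<close> increases, \<open>(n v)\<^sup>a\<close> grows and \<open>(n v)\<^bsup>-a\<^esup>\<close> decreases by at least a constant times
  \<open>(n v)\<^bsup>\<plusminus>a\<^esup> / n\<close>.  So both ranges telescope, and the point \<open>n v = 1\<close> at which they meet does not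
  enter the bound.
\<close>

lemma sum_min_powr_le:
  fixes v a :: real
  assumes "0 < v" "0 < a" "a \<le> 1"
  shows "(\<Sum>n=1..N. 1 / real n * min ((real n * v) powr a) ((real n * v) powr (- a))) \<le> 2 + 3 / a"
proof -
  define b where "b n = 1 / real n * min ((real n * v) powr a) ((real n * v) powr (- a))" for n
  have step: "(1 - 1 / real n) powr a \<le> 1 - a / (2 * real n)"
      "1 + a / real n \<le> (1 - 1 / real n) powr (- a)" if "2 \<le> n" for n :: nat
  proof -
    define x where "x = 1 / real n"
    have x: "0 < x" "x \<le> 1/2" unfolding x_def using that by auto
    have "ln (1 - x) \<le> - x" using ln_le_minus_one[of "1 - x"] x by simp
    hence l: "a * ln (1 - x) \<le> - (a * x)" using assms mult_left_mono[of "ln (1 - x)" "- x" a] by simp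
    define z where "z = a * x"
    have z: "0 < z" "z \<le> 1" unfolding z_def using assms x by (auto intro: mult_le_one)
    have "(1 - x) powr a = exp (a * ln (1 - x))" using x by (simp add: powr_def)
    also have "\<dots> \<le> exp (- z)" using l by (simp add: z_def)
    also have "\<dots> \<le> 1 / (1 + z)"
      using exp_ge_add_one_self[of z] z by (simp add: exp_minus divide_inverse le_imp_inverse_le)
    also have "\<dots> \<le> 1 - z / 2"
    proof -
      have "1 * z \<le> 1 * 1" "z * z \<le> z * 1" using z by (auto intro!: mult_left_mono)
      hence "1 \<le> (1 - z / 2) * (1 + z)" by (simp add: algebra_simps)
      thus ?thesis using z by (simp add: divide_le_eq)
    qed
    finally show "(1 - 1 / real n) powr a \<le> 1 - a / (2 * real n)"
      by (simp add: x_def z_def)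
    have "1 + z \<le> exp z" by (rule exp_ge_add_one_self)
    also have "\<dots> \<le> exp (- a * ln (1 - x))" using l by (simp add: z_def)
    also have "\<dots> = (1 - x) powr (- a)" using x by (simp add: powr_def)
    finally show "1 + a / real n \<le> (1 - 1 / real n) powr (- a)"
      by (simp add: x_def z_def)
  qed
  have split: "real (n - 1) * v = (1 - 1 / real n) * (real n * v)" if "2 \<le> n" for n
    using that by (simp add: field_simps of_nat_diff)
  have "(real N * v \<le> 1 \<longrightarrow> (\<Sum>n=1..N. b n) \<le> 2 / a * (real N * v) powr a) \<and>
        (1 < real N * v \<longrightarrow> (\<Sum>n=1..N. b n) \<le> 2 + 3 / a - 1 / a * (real N * v) powr (- a))"
  proof (induction N)
    case (Suc N)
    define w where "w = real (Suc N) * v"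
    have w: "0 < w" unfolding w_def using assms by simp
    have S: "(\<Sum>n=1..Suc N. b n) = (\<Sum>n=1..N. b n) + b (Suc N)" by simp
    have b1: "b (Suc N) \<le> 1 / real (Suc N) * w powr a" "b (Suc N) \<le> 1 / real (Suc N) * w powr (- a)"
      unfolding b_def w_def by (intro mult_left_mono; simp)+
    have a1: "1 \<le> 1 / a" using assms by simp
    show ?case
    proof (cases "N = 0")
      case True
      have "w powr (- a) \<le> 1" if "1 < w" using that assms by (intro powr_neg_le_one) auto
      hence "b (Suc N) \<le> 1 \<and> 1 / a * w powr (- a) \<le> 1 / a" if "1 < w"
        using b1(2) True that assms by (auto simp: divide_right_mono)
      moreover have "1 * w powr a \<le> 2 / a * w powr a" using a1 by (intro mult_right_mono) auto
      moreover have "1 / a \<le> 3 / a" using assms by (intro divide_right_mono) auto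
      ultimately show ?thesis
        unfolding w_def[symmetric] S using True b1(1) by auto
    next
      case False
      hence N2: "2 \<le> Suc N" by simp
      define q where "q = 1 - 1 / real (Suc N)"
      have q: "0 < q" "q < 1" unfolding q_def using False by auto
      have Nv: "real N * v = q * w"
        using split[OF N2] by (simp add: q_def w_def)
      have s: "q powr a \<le> 1 - a / (2 * real (Suc N))" "1 + a / real (Suc N) \<le> q powr (- a)"
        unfolding q_def by (rule step[OF N2])+
      have small: "(real N * v) powr a \<le> w powr a - a / (2 * real (Suc N)) * w powr a"
        unfolding Nv powr_mult using mult_right_mono[OF s(1), of "w powr a"]
        by (simp only: powr_ge_zero left_diff_distrib mult_1_left)
      have large: "w powr (- a) + a / real (Suc N) * w powr (- a) \<le> (real N * v) powr (- a)"
        unfolding Nv powr_mult using mult_right_mono[OF s(2), of "w powr (- a)"]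
        by (simp only: powr_ge_zero distrib_right mult_1_left)
      have "real N * v \<le> w" unfolding Nv using q w by simp
      consider "w \<le> 1" | "1 < w" "real N * v \<le> 1" | "1 < real N * v"
        using \<open>real N * v \<le> w\<close> by linarith
      thus ?thesis
      proof cases
        case 1
        hence "(\<Sum>n=1..N. b n) \<le> 2 / a * (real N * v) powr a"
          using Suc.IH \<open>real N * v \<le> w\<close> by auto
        also have "\<dots> \<le> 2 / a * (w powr a - a / (2 * real (Suc N)) * w powr a)"
          using assms by (intro mult_left_mono small) auto
        also have "\<dots> = 2 / a * w powr a - 1 / real (Suc N) * w powr a"
        proof -
          have "2 / a * (p - a / (2 * m) * p) = 2 / a * p - 1 / m * p" if "m \<noteq> 0" for p m :: real
            using assms that by (simp add: field_simps)
          note eq = this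
          show ?thesis by (rule eq) simp
        qed
        finally show ?thesis
          unfolding w_def[symmetric] S using 1 b1(1) by auto
      next
        case 2
        have "(real N * v) powr a \<le> 1"
          using 2 assms by (intro powr_le1) auto
        from mult_left_mono[OF this, of "2 / a"]
        have "(\<Sum>n=1..N. b n) \<le> 2 / a"
          using Suc.IH 2 assms by auto
        moreover have wa: "w powr (- a) \<le> 1" using 2 assms by (intro powr_neg_le_one) auto
        moreover have "b (Suc N) \<le> 1"
        proof -
          have "1 / real (Suc N) * w powr (- a) \<le> 1 * 1"
            using wa by (intro mult_mono) auto
          with b1(2) show ?thesis by linarith
        qed
        moreover have "1 / a * w powr (- a) \<le> 1 / a"
          using wa assms by (simp add: divide_right_mono)
        moreover have "3 / a = 2 / a + 1 / a" by (simp flip: add_divide_distrib)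
        ultimately show ?thesis
          unfolding w_def[symmetric] S using 2 by auto
      next
        case 3
        hence "(\<Sum>n=1..N. b n) \<le> 2 + 3 / a - 1 / a * (real N * v) powr (- a)"
          using Suc.IH by auto
        also have "\<dots> \<le> 2 + 3 / a - 1 / a * (w powr (- a) + a / real (Suc N) * w powr (- a))"
          using assms by (intro diff_left_mono mult_left_mono large) auto
        also have "\<dots> = 2 + 3 / a - 1 / a * w powr (- a) - 1 / real (Suc N) * w powr (- a)"
        proof -
          have "c - 1 / a * (p + a / m * p) = c - 1 / a * p - 1 / m * p" if "m \<noteq> 0" for c p m :: real
            using assms that by (simp add: field_simps)
          note eq = this
          show ?thesis by (rule eq) simp
        qed
        finally show ?thesis
          unfolding w_def[symmetric] S using 3 \<open>real N * v \<le> w\<close> b1(2) by auto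
      qed
    qed
  qed simp
  moreover have "2 / a * (real N * v) powr a \<le> 2 + 3 / a" if "real N * v \<le> 1"
  proof -
    have "(real N * v) powr a \<le> 1"
      using that assms by (intro powr_le1) auto
    from mult_left_mono[OF this, of "2 / a"] have "2 / a * (real N * v) powr a \<le> 2 / a"
      using assms by simp
    moreover have "2 / a \<le> 3 / a" using assms by (intro divide_right_mono) auto
    ultimately show ?thesis by linarith
  qed
  moreover have "0 \<le> 1 / a * (real N * v) powr (- a)" using assms by simp
  ultimately show ?thesis unfolding b_def[symmetric] by (cases "real N * v \<le> 1") auto
qed

section \<open>Symbols with quasiconvex defect\<close>

text \<open>
  The assumption \<open>quasiconvex\<close> says that \<open>u(s) / s\<close> is increasing up to a constant factor.  For
  a convex defect the factor is 1; the factor lets the property extend from a neighbourhood of 0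
  to the whole half period, so that one set of estimates covers all frequencies.
\<close>

locale quasiconvex_symbol =
  fixes \<mu> :: "int pmf" and B C :: real
  assumes B: "1 \<le> B" and C: "1 \<le> C"
    and ratio: "cmod (fourier \<mu> t - 1) \<le> B * (1 - cmod (fourier \<mu> t))"
    and defect_pos: "0 < t \<Longrightarrow> t \<le> 1/2 \<Longrightarrow> 0 < defect \<mu> t"
    and quasiconvex: "0 < s \<Longrightarrow> s \<le> t \<Longrightarrow> t \<le> 1/2 \<Longrightarrow> t * defect \<mu> s \<le> C * s * defect \<mu> t"
begin

abbreviation u :: "real \<Rightarrow> real" where "u \<equiv> defect \<mu>"
abbreviation \<theta> :: "real \<Rightarrow> complex" where "\<theta> \<equiv> fourier \<mu>"

lemma BC: "1 \<le> B * C"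
  using mult_mono[OF B C] B C by simp

lemma cmod_le_defect: "cmod (\<theta> t) \<le> 1 - u t / B"
proof -
  have "u t \<le> cmod (\<theta> t - 1)"
    using abs_Re_le_cmod[of "\<theta> t - 1"] by (simp add: defect_def)
  also note ratio
  finally have "u t / B \<le> 1 - cmod (\<theta> t)"
    using B by (simp add: pos_divide_le_eq mult.commute)
  thus ?thesis by linarith
qed

lemma cmod_diff_1_le_defect: "cmod (\<theta> t - 1) \<le> B * u t"
proof -
  have "1 - cmod (\<theta> t) \<le> u t"
    using complex_Re_le_cmod[of "\<theta> t"] by (simp add: defect_def)
  hence "B * (1 - cmod (\<theta> t)) \<le> B * u t"
    using B by (intro mult_left_mono) auto
  with ratio show ?thesis by (rule order_trans)
qed

lemma defect_quasimono:
  assumes "0 \<le> s" "s \<le> t" "t \<le> 1/2"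
  shows "u s \<le> C * u t"
proof (cases "s = 0")
  case False
  hence "t * u s \<le> C * s * u t" using assms by (intro quasiconvex) auto
  also have "\<dots> = s * (C * u t)" by simp
  also have "\<dots> \<le> t * (C * u t)" using assms C by (intro mult_right_mono) auto
  finally show ?thesis using False assms by simp
qed (use C in auto)

text \<open>
  Doubling the argument multiplies the defect by at most 4, so its growth is at most quadratic.
\<close>

lemma defect_upper:
  assumes "0 < s" "s \<le> 1/2" "s \<le> t"
  shows "u t \<le> 4 * C * (t / s)\<^sup>2 * u s"
proof -
  have base: "u r \<le> 4 * C * (r / s)\<^sup>2 * u s" if "s / 2 \<le> r" "r \<le> s" for r
  proof -
    have "(1/2)\<^sup>2 \<le> (r / s)\<^sup>2"
      using that assms by (intro power_mono) (auto simp: field_simps)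
    moreover have "(1/2 :: real)\<^sup>2 = 1/4" by (simp add: power2_eq_square)
    ultimately have "1 \<le> 4 * (r / s)\<^sup>2" by linarith
    hence "1 * (C * u s) \<le> 4 * (r / s)\<^sup>2 * (C * u s)"
      using C by (intro mult_right_mono) auto
    moreover have "u r \<le> C * u s"
      using that assms by (intro defect_quasimono) auto
    ultimately show ?thesis by (simp add: mult_ac)
  qed
  have "u r \<le> 4 * C * (r / s)\<^sup>2 * u s" if "s / 2 \<le> r" "r \<le> 2 ^ J * s" for J r
    using that
  proof (induction J arbitrary: r)
    case 0
    thus ?case by (intro base) auto
  next
    case (Suc J)
    show ?case
    proof (cases "r \<le> s")
      case False
      have "u r \<le> 4 * u (r / 2)"
        using defect_double[of \<mu> "r / 2"] by simp
      also have "u (r / 2) \<le> 4 * C * (r / 2 / s)\<^sup>2 * u s"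
        using Suc.prems False by (intro Suc.IH) auto
      finally show ?thesis by (simp add: power_divide)
    qed (use Suc.prems base in auto)
  qed
  moreover obtain J where "t / s < 2 ^ J"
    using real_arch_pow[of 2 "t / s"] by auto
  hence "t \<le> 2 ^ J * s" using assms by (simp add: field_simps)
  ultimately show ?thesis using assms by auto
qed

lemma defect_near:
  assumes "t \<noteq> 0" "\<bar>t\<bar> \<le> 1/2" "\<bar>h\<bar> \<le> \<bar>t\<bar> / 2"
  shows "u t \<le> 4 * C * u (t + h)"
proof -
  have pos: "u t \<le> 4 * C * u (t + h)" if t: "0 < t" "t \<le> 1/2" "\<bar>h\<bar> \<le> t / 2" for t h
  proof -
    have "u (t / 2) \<le> C * u (t + h)"
    proof (cases "t + h \<le> 1/2")
      case False
      have "u (t / 2) \<le> C * u (1 - (t + h))"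
        using t False by (intro defect_quasimono) auto
      thus ?thesis by (simp only: defect_reflect)
    qed (use t in \<open>intro defect_quasimono; simp\<close>)
    with defect_double[of \<mu> "t / 2"] show ?thesis by simp
  qed
  show ?thesis
  proof (cases "0 < t")
    case True
    thus ?thesis using assms pos by auto
  next
    case False
    with assms have "u (- t) \<le> 4 * C * u (- t + - h)" by (intro pos) auto
    moreover have "u (- t + - h) = u (t + h)"
      using defect_uminus[of \<mu> "t + h"] by simp
    ultimately show ?thesis by simp
  qed
qed

text \<open>
  Let \<open>F(h) = \<bar>\<theta>(t + h) - \<theta>(t)\<bar>\<close>.  The second difference at \<open>t + h\<close> gives \<open>F(h) \<le> F(2 h) / 2 + u(h)\<close>, and
  \<open>u(h) \<le> C (h/t) u(t)\<close>.  Iterating up to the scale \<open>t\<close>, where the angular ratio bound applies, would give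
  \<open>(h/t) u(t)\<close> times the number of steps; the exponent 3/4 instead of 1 absorbs that logarithm.
\<close>

lemma fourier_increment:
  assumes "h \<noteq> 0" "\<bar>h\<bar> \<le> \<bar>t\<bar>" "\<bar>t\<bar> \<le> 1/2"
  shows "cmod (\<theta> (t + h) - \<theta> t) \<le> 10 * B * C * (\<bar>h\<bar> / \<bar>t\<bar>) powr (3/4) * u t"
proof -
  have pos: "cmod (\<theta> (t + h) - \<theta> t) \<le> 10 * B * C * (\<bar>h\<bar> / t) powr (3/4) * u t"
    if t: "0 < t" "t \<le> 1/2" "h \<noteq> 0" "\<bar>h\<bar> \<le> t" for t h
  proof -
    have base: "cmod (\<theta> (t + h) - \<theta> t) \<le> 10 * B * C * (\<bar>h\<bar> / t) powr (3/4) * u t"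
      if h: "t / 2 \<le> \<bar>h\<bar>" "\<bar>h\<bar> \<le> t" for h
    proof -
      have "cmod (\<theta> (t + h) - \<theta> t) \<le> cmod (\<theta> (t + h) - 1) + cmod (\<theta> t - 1)"
        using norm_triangle_ineq4[of "\<theta> (t + h) - 1" "\<theta> t - 1"] by simp
      also have "\<dots> \<le> B * u (t + h) + B * u t"
        by (intro add_mono cmod_diff_1_le_defect)
      also have "\<dots> \<le> B * (5 * C * u t)"
      proof -
        have "u h \<le> C * u t"
          using defect_quasimono[of "\<bar>h\<bar>" t] h t by simp
        moreover have "u t \<le> C * u t"
          using C mult_right_mono[of 1 C "u t"] by simp
        ultimately have "u (t + h) + u t \<le> 5 * C * u t"
          using defect_add[of \<mu> t h] by linarith
        from mult_left_mono[OF this, of B] show ?thesis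
          using B by (simp add: algebra_simps)
      qed
      also have "\<dots> \<le> 10 * B * C * (\<bar>h\<bar> / t) powr (3/4) * u t"
      proof -
        have "(1/2::real) = (1/2) powr 1" by simp
        also have "\<dots> \<le> (1/2) powr (3/4)" by (intro powr_mono') auto
        also have "\<dots> \<le> (\<bar>h\<bar> / t) powr (3/4)"
          using h t by (intro powr_mono2) (auto simp: field_simps)
        finally have "10 * B * C * u t * (1/2) \<le> 10 * B * C * u t * (\<bar>h\<bar> / t) powr (3/4)"
          using B C by (intro mult_left_mono) auto
        thus ?thesis by (simp add: mult_ac)
      qed
      finally show ?thesis .
    qed
    \<comment> \<open>Halving \<open>h\<close> multiplies the bound by \<open>2\<^bsup>-3/4\<^esup>\<close> but \<open>F / 2\<close> only gains \<open>1/2\<close>; the quotient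
      \<open>2\<^bsup>-1/4\<^esup>\<close> is below 1, so a constant of size \<open>10 B C\<close> reproduces itself.\<close>
    have q: "(1/2::real) powr (1/4) \<le> 9/10"
    proof -
      have "(1/2::real) powr (1/4) \<le> ((9/10) ^ 4) powr (1/4)"
        by (intro powr_mono2) (auto simp: power_divide)
      also have "\<dots> = 9/10"
        by (simp add: powr_powr flip: powr_numeral)
      finally show ?thesis .
    qed
    have "cmod (\<theta> (t + h) - \<theta> t) \<le> 10 * B * C * (\<bar>h\<bar> / t) powr (3/4) * u t"
      if "h \<noteq> 0" "\<bar>h\<bar> \<le> t" "t \<le> 2 ^ J * \<bar>h\<bar>" for J h
      using that
    proof (induction J arbitrary: h)
      case 0
      thus ?case using base[of h] t by simp
    next
      case (Suc J)
      show ?case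
      proof (cases "t / 2 \<le> \<bar>h\<bar>")
        case False
        define A where "A = 10 * B * C"
        define p where "p = (\<bar>h\<bar> / t) powr (3/4)"
        have IH: "cmod (\<theta> (t + 2 * h) - \<theta> t) \<le> A * (\<bar>2 * h\<bar> / t) powr (3/4) * u t"
          unfolding A_def using Suc.prems False by (intro Suc.IH) (auto simp: abs_mult)
        have "2 * (\<theta> (t + h) - \<theta> t) = (\<theta> (t + 2 * h) - \<theta> t)
            - (\<theta> ((t + h) + h) + \<theta> ((t + h) - h) - 2 * \<theta> (t + h))"
          by (simp add: algebra_simps)
        hence "2 * cmod (\<theta> (t + h) - \<theta> t) \<le> cmod (\<theta> (t + 2 * h) - \<theta> t)
            + cmod (\<theta> ((t + h) + h) + \<theta> ((t + h) - h) - 2 * \<theta> (t + h))"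
          by (metis norm_mult norm_numeral norm_triangle_ineq4)
        also have "\<dots> \<le> A * (\<bar>2 * h\<bar> / t) powr (3/4) * u t + 2 * u h"
          by (intro add_mono IH fourier_second_difference)
        finally have 1: "cmod (\<theta> (t + h) - \<theta> t) \<le> A * ((\<bar>2 * h\<bar> / t) powr (3/4) / 2) * u t + u h"
          by simp
        have "(\<bar>2 * h\<bar> / t) powr (3/4) / 2 = (2 powr (3/4) / 2) * p"
          unfolding p_def using t by (simp add: abs_mult powr_mult powr_divide)
        also have "(2::real) powr (3/4) / 2 = (1/2) powr (1/4)"
        proof -
          have "(2::real) powr (3/4) / 2 = 2 powr (3/4) / 2 powr 1" by simp
          also have "\<dots> = 2 powr (3/4 - 1)" by (rule powr_diff[symmetric])
          also have "\<dots> = (1/2) powr (1/4)"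
            using powr_minus_divide[of "2::real" "1/4"] by (simp add: powr_divide)
          finally show ?thesis .
        qed
        also have "(1/2) powr (1/4) * p \<le> 9/10 * p"
          unfolding p_def using q by (intro mult_right_mono) auto
        finally have "A * ((\<bar>2 * h\<bar> / t) powr (3/4) / 2) * u t \<le> A * (9/10 * p) * u t"
          unfolding A_def using B C by (intro mult_right_mono mult_left_mono) auto
        moreover have "u h \<le> C * p * u t"
        proof -
          have "t * u \<bar>h\<bar> \<le> C * \<bar>h\<bar> * u t"
            using Suc.prems t by (intro quasiconvex) auto
          hence "u h \<le> C * (\<bar>h\<bar> / t) * u t"
            using t by (simp add: field_simps)
          also have "\<bar>h\<bar> / t = (\<bar>h\<bar> / t) powr 1" using t by simp
          also have "\<dots> \<le> p"
            unfolding p_def using Suc.prems t by (intro powr_mono') auto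
          finally show ?thesis using C by (simp add: mult_left_mono mult_right_mono)
        qed
        moreover have "C * p * u t \<le> A / 10 * p * u t"
          unfolding A_def p_def using B C mult_right_mono[OF B, of C] by (intro mult_right_mono) auto
        ultimately show ?thesis
          using 1 unfolding A_def[symmetric] p_def[symmetric] by (simp add: algebra_simps)
      qed (use Suc.prems base in auto)
    qed
    moreover obtain J where "t / \<bar>h\<bar> < 2 ^ J"
      using real_arch_pow[of 2 "t / \<bar>h\<bar>"] by auto
    hence "t \<le> 2 ^ J * \<bar>h\<bar>" using t by (simp add: field_simps)
    ultimately show ?thesis using t by blast
  qed
  show ?thesis
  proof (cases "0 < t")
    case True
    thus ?thesis using assms pos[of t h] by auto
  next
    case False
    have "\<theta> (t + h) - \<theta> t = cnj (\<theta> (- t + - h) - \<theta> (- t))"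
      using fourier_uminus[of \<mu> "t + h"] fourier_uminus[of \<mu> t] by simp
    hence "cmod (\<theta> (t + h) - \<theta> t) = cmod (\<theta> (- t + - h) - \<theta> (- t))"
      by (simp only: complex_mod_cnj)
    also have "\<dots> \<le> 10 * B * C * (\<bar>- h\<bar> / - t) powr (3/4) * u (- t)"
      using assms False by (intro pos) auto
    finally show ?thesis using False by simp
  qed
qed

text \<open>
  The Fourier transform of \<open>E n\<close>.
\<close>

definition increment :: "nat \<Rightarrow> real \<Rightarrow> complex" where
  "increment n t = \<theta> t ^ n * (\<theta> t - 1)"

text \<open>
  The rate in \<open>\<bar>\<theta>\<bar> \<le> 1 - decay * u(t)\<close>, valid at \<open>t\<close> and at all points within \<open>\<bar>t\<bar> / 2\<close> of it.
\<close>

definition decay :: real where "decay = 1 / (4 * B * C)"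

lemma decay: "0 < decay" "decay \<le> 1" "decay * u t \<le> 1" "decay * u t \<le> u t / B"
proof -
  show d: "0 < decay" unfolding decay_def using B C by simp
  have "decay \<le> 1 / 4"
    unfolding decay_def using BC by (intro divide_left_mono) auto
  thus "decay \<le> 1" by simp
  have "decay * u t \<le> 1 / 4 * 2"
    using \<open>decay \<le> 1/4\<close> d defect_le_2[of \<mu> t] by (intro mult_mono) auto
  thus "decay * u t \<le> 1" by simp
  have "1 * B \<le> 4 * B * C" using mult_mono[of 1 4 B "B * C"] B C mult_left_mono[OF C, of B] by simp
  hence "decay \<le> 1 / B"
    unfolding decay_def using B C by (intro divide_left_mono) auto
  from mult_right_mono[OF this, of "u t"] show "decay * u t \<le> u t / B" by simp
qed

lemma cmod_near_le:
  assumes "t \<noteq> 0" "\<bar>t\<bar> \<le> 1/2" "\<bar>h\<bar> \<le> \<bar>t\<bar> / 2"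
  shows "cmod (\<theta> (t + h)) \<le> 1 - decay * u t"
proof -
  have "u t / (4 * C) \<le> u (t + h)"
    using defect_near[OF assms] C by (simp add: field_simps)
  hence "u t / (4 * C) / B \<le> u (t + h) / B"
    using B by (intro divide_right_mono) auto
  moreover have "decay * u t = u t / (4 * C) / B"
    by (simp add: decay_def)
  ultimately show ?thesis
    using cmod_le_defect[of "t + h"] by linarith
qed

lemma norm_increment_le:
  assumes "t \<noteq> 0" "\<bar>t\<bar> \<le> 1/2"
  shows "cmod (increment n t) \<le> B * u t * (1 - decay * u t) ^ n"
proof -
  have "cmod (\<theta> t) ^ n \<le> (1 - decay * u t) ^ n"
    using cmod_near_le[of t 0] assms by (intro power_mono) auto
  hence "cmod (\<theta> t) ^ n * cmod (\<theta> t - 1) \<le> (1 - decay * u t) ^ n * (B * u t)"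
    using decay(3)[of t] by (intro mult_mono cmod_diff_1_le_defect) auto
  thus ?thesis
    by (simp add: increment_def norm_mult norm_power mult_ac)
qed

lemma increment_difference:
  assumes "t \<noteq> 0" "\<bar>t\<bar> \<le> 1/2" "h \<noteq> 0" "\<bar>h\<bar> \<le> \<bar>t\<bar> / 2" "0 < n"
  shows "cmod (increment n (t + h) - increment n t) \<le>
    10 * B * C * (\<bar>h\<bar> / \<bar>t\<bar>) powr (3/4) * u t * (1 + B * (real n * u t)) * (1 - decay * u t) ^ (n - 1)"
proof -
  define m where "m = 1 - decay * u t"
  have m: "0 \<le> m" "m \<le> 1" "cmod (\<theta> t) \<le> m" "cmod (\<theta> (t + h)) \<le> m"
    unfolding m_def using decay(1) decay(3)[of t] defect_nonneg[of \<mu> t] cmod_near_le[of t 0] cmod_near_le[of t h] assms by auto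
  define d where "d = cmod (\<theta> (t + h) - \<theta> t)"
  have "increment n (t + h) - increment n t
      = \<theta> (t + h) ^ n * (\<theta> (t + h) - \<theta> t) + (\<theta> (t + h) ^ n - \<theta> t ^ n) * (\<theta> t - 1)"
    by (simp add: increment_def algebra_simps)
  hence "cmod (increment n (t + h) - increment n t)
      \<le> cmod (\<theta> (t + h)) ^ n * d + cmod (\<theta> (t + h) ^ n - \<theta> t ^ n) * cmod (\<theta> t - 1)"
    unfolding d_def by (metis norm_mult norm_power norm_triangle_ineq)
  also have "\<dots> \<le> m ^ (n - 1) * d + (real n * m ^ (n - 1) * d) * (B * u t)"
  proof (intro add_mono mult_mono)
    have "cmod (\<theta> (t + h)) ^ n \<le> m ^ n" using m by (intro power_mono) auto
    also have "\<dots> \<le> m ^ (n - 1)" using m by (intro power_decreasing) auto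
    finally show "cmod (\<theta> (t + h)) ^ n \<le> m ^ (n - 1)" .
    show "cmod (\<theta> (t + h) ^ n - \<theta> t ^ n) \<le> real n * m ^ (n - 1) * d"
      unfolding d_def using m by (intro norm_power_diff_le) auto
  qed (use m cmod_diff_1_le_defect in \<open>auto simp: d_def\<close>)
  also have "\<dots> = d * ((1 + B * (real n * u t)) * m ^ (n - 1))"
    by (simp add: algebra_simps)
  also have "\<dots> \<le> (10 * B * C * (\<bar>h\<bar> / \<bar>t\<bar>) powr (3/4) * u t) * ((1 + B * (real n * u t)) * m ^ (n - 1))"
    unfolding d_def using assms B m by (intro mult_right_mono fourier_increment mult_nonneg_nonneg) auto
  finally show ?thesis
    by (simp add: m_def mult_ac)
qed

section \<open>Increments of the convolution powers\<close>

definition K :: "nat \<Rightarrow> int \<Rightarrow> real" where "K n x = pmf (conv_pmf \<mu> n) x"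

definition E :: "nat \<Rightarrow> int \<Rightarrow> real" where "E n x = K (Suc n) x - K n x"

lemma increment_has_integral:
  "((\<lambda>t. increment n (t + h) * cnj (chi x t)) has_integral of_real (E n x) * chi x h) {- 1/2..1/2}"
proof -
  have "((\<lambda>t. \<theta> (t + h) ^ m * cnj (chi x t)) has_integral of_real (K m x) * chi x h) {- 1/2..1/2}" for m
    using fourier_inversion[of "conv_pmf \<mu> m" h x] by (simp add: fourier_conv_pmf K_def)
  from has_integral_diff[OF this[of "Suc n"] this[of n]] show ?thesis
    by (simp add: increment_def E_def algebra_simps)
qed

lemma continuous_increment [continuous_intros]:
  "continuous_on A f \<Longrightarrow> continuous_on A (\<lambda>t. increment n (f t))"
  unfolding increment_def by (intro continuous_intros)

text \<open>
  Only the finiteness of this and the following constants matters.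
\<close>

definition shell_const :: real where "shell_const = 480 * B * C\<^sup>2 * (1 + B) / decay\<^sup>2"

lemma shell_const_ge: "150 * B * C\<^sup>2 \<le> shell_const" "0 < shell_const"
proof -
  have "decay\<^sup>2 \<le> 1" using decay by (intro power_le_one) auto
  hence "1 \<le> 1 / decay\<^sup>2" using decay by (simp add: field_simps)
  moreover have "150 \<le> 480 * (1 + B)" using B by simp
  ultimately have "150 * 1 \<le> (480 * (1 + B)) * (1 / decay\<^sup>2)"
    by (intro mult_mono) auto
  hence "B * C\<^sup>2 * (150 * 1) \<le> B * C\<^sup>2 * ((480 * (1 + B)) * (1 / decay\<^sup>2))"
    using B C by (intro mult_left_mono) auto
  moreover have "shell_const = B * C\<^sup>2 * ((480 * (1 + B)) * (1 / decay\<^sup>2))"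
    by (simp add: shell_const_def)
  ultimately show 1: "150 * B * C\<^sup>2 \<le> shell_const"
    by (simp only: mult_1_right mult_ac)
  have "0 < 150 * B * C\<^sup>2" using B C by simp
  with 1 show "0 < shell_const" by linarith
qed

text \<open>
  For \<open>\<bar>t\<bar> \<ge> 2 h\<close> the previous estimates apply, with \<open>n u(t)\<close> bounded by \<open>C \<tau> \<bar>t\<bar> Y\<close> below the frequency
  \<open>1/Y\<close> (quasiconvexity) and by \<open>4 C \<tau> (\<bar>t\<bar> Y)\<^sup>2\<close> above it (doubling).  For smaller \<open>\<bar>t\<bar>\<close> both terms of the
  difference are of the size of \<open>u(h)\<close>.  The majorant has a square whose integral is of order \<open>h\<close>.
\<close>

lemma increment_modulus:
  fixes Y h :: real and n :: nat
  defines "\<tau> \<equiv> real n * u (1 / Y)"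
  assumes Y: "2 \<le> Y" and n: "0 < n" and h: "0 < h" "h * Y \<le> 1" "\<tau> * h * Y \<le> 1" and t: "\<bar>t\<bar> \<le> 1/2"
  shows "real n * cmod (increment n (t + h) - increment n t)
    \<le> shell_const * (\<tau> * h * Y) powr (1/16) * (h / (h + \<bar>t\<bar>)) powr (5/8)"
proof (cases "2 * h \<le> \<bar>t\<bar>")
  case True
  define w where "w = real n * u t"
  define r where "r = h / \<bar>t\<bar>"
  have t0: "0 < \<bar>t\<bar>" using True h by linarith
  have r: "0 < r" "r \<le> 1" unfolding r_def using True h t0 by auto
  have w: "0 \<le> w" by (simp add: w_def)
  have wr: "w * r\<^sup>2 \<le> 4 * C * (\<tau> * h * Y)"
  proof (cases "1 / Y \<le> \<bar>t\<bar>")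
    case le: True
    have "u \<bar>t\<bar> \<le> 4 * C * (\<bar>t\<bar> / (1 / Y))\<^sup>2 * u (1 / Y)"
      using Y le by (intro defect_upper) auto
    hence "real n * u t * r\<^sup>2 \<le> real n * (4 * C * (\<bar>t\<bar> / (1 / Y))\<^sup>2 * u (1 / Y)) * r\<^sup>2"
      by (intro mult_right_mono mult_left_mono) auto
    also have "\<dots> = 4 * C * \<tau> * (h * Y)\<^sup>2"
      unfolding r_def \<tau>_def using t0 by (simp add: power_mult_distrib power_divide)
    also have "(h * Y)\<^sup>2 \<le> h * Y"
      using h Y by (simp add: power2_eq_square mult_left_le)
    hence "4 * C * \<tau> * (h * Y)\<^sup>2 \<le> 4 * C * \<tau> * (h * Y)"
      unfolding \<tau>_def using C by (intro mult_left_mono) auto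
    finally show ?thesis by (simp add: w_def mult_ac)
  next
    case False
    have "(1 / Y) * u \<bar>t\<bar> \<le> C * \<bar>t\<bar> * u (1 / Y)"
      using False Y t0 by (intro quasiconvex) auto
    hence "u t \<le> C * \<bar>t\<bar> * Y * u (1 / Y)"
      using Y by (simp add: field_simps)
    hence "real n * u t * r\<^sup>2 \<le> real n * (C * \<bar>t\<bar> * Y * u (1 / Y)) * r\<^sup>2"
      by (intro mult_right_mono mult_left_mono) auto
    also have "\<dots> = C * (\<tau> * (\<bar>t\<bar> * r) * Y) * r"
      unfolding \<tau>_def by (simp add: power2_eq_square)
    also have "\<dots> = C * (\<tau> * h * Y) * r"
      unfolding r_def using t0 by simp
    also have "\<dots> \<le> C * (\<tau> * h * Y) * 1"
      unfolding \<tau>_def using r C Y h by (intro mult_left_mono) auto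
    also have "\<dots> \<le> 4 * C * (\<tau> * h * Y)"
      unfolding \<tau>_def using C Y h by simp
    finally show ?thesis by (simp add: w_def)
  qed
  have "w powr (1/16) * r powr (1/8) = (w * r\<^sup>2) powr (1/16)"
    using w r by (simp add: powr_mult powr_powr flip: powr_numeral)
  also have "\<dots> \<le> (4 * C * (\<tau> * h * Y)) powr (1/16)"
    using w wr by (intro powr_mono2) auto
  also have "\<dots> = (4 * C) powr (1/16) * (\<tau> * h * Y) powr (1/16)"
    using C h Y by (simp add: powr_mult \<tau>_def)
  also have "(4 * C) powr (1/16) \<le> (4 * C) powr 1"
    using C by (intro powr_mono) auto
  hence "(4 * C) powr (1/16) * (\<tau> * h * Y) powr (1/16) \<le> 4 * C * (\<tau> * h * Y) powr (1/16)"
    using C by (intro mult_right_mono) auto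
  finally have small: "w powr (1/16) * r powr (1/8) \<le> 4 * C * (\<tau> * h * Y) powr (1/16)" .
  have far: "r powr (5/8) \<le> 2 * (h / (h + \<bar>t\<bar>)) powr (5/8)"
  proof -
    have "r \<le> 2 * (h / (h + \<bar>t\<bar>))"
      unfolding r_def using True h t0 by (simp add: field_simps)
    hence "r powr (5/8) \<le> (2 * (h / (h + \<bar>t\<bar>))) powr (5/8)"
      using r by (intro powr_mono2) auto
    also have "\<dots> = 2 powr (5/8) * (h / (h + \<bar>t\<bar>)) powr (5/8)"
      using h by (simp only: powr_mult)
    also have "(2::real) powr (5/8) \<le> 2 powr 1" by (intro powr_mono) auto
    hence "2 powr (5/8) * (h / (h + \<bar>t\<bar>)) powr (5/8) \<le> 2 * (h / (h + \<bar>t\<bar>)) powr (5/8)"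
      by (intro mult_right_mono) auto
    finally show ?thesis .
  qed
  define D where "D = cmod (increment n (t + h) - increment n t)"
  have "D \<le> 10 * B * C * (\<bar>h\<bar> / \<bar>t\<bar>) powr (3/4) * u t * (1 + B * (real n * u t)) * (1 - decay * u t) ^ (n - 1)"
    unfolding D_def using True h t t0 n by (intro increment_difference) auto
  hence "real n * D \<le> real n * (10 * B * C * r powr (3/4) * u t * (1 + B * w) * (1 - decay * u t) ^ (n - 1))"
    using h by (intro mult_left_mono) (auto simp: w_def r_def)
  also have "\<dots> = 10 * B * C * r powr (3/4) * (w * (1 + B * w) * (1 - decay * u t) ^ (n - 1))"
    by (simp add: w_def mult_ac)
  also have "\<dots> \<le> 10 * B * C * r powr (3/4) * (6 * (1 + B) / decay\<^sup>2 * w powr (1/16))"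
    unfolding w_def using decay B C n
    by (intro mult_left_mono defect_decay_small_power) (auto simp: mult_nonneg_nonneg)
  also have "r powr (3/4) = r powr (5/8) * r powr (1/8)"
    by (simp flip: powr_add)
  also have "10 * B * C * (r powr (5/8) * r powr (1/8)) * (6 * (1 + B) / decay\<^sup>2 * w powr (1/16))
      = 60 * B * C * (1 + B) / decay\<^sup>2 * (r powr (5/8) * (w powr (1/16) * r powr (1/8)))"
    by simp
  also have "\<dots> \<le> 60 * B * C * (1 + B) / decay\<^sup>2 *
      (2 * (h / (h + \<bar>t\<bar>)) powr (5/8) * (4 * C * (\<tau> * h * Y) powr (1/16)))"
    using B C by (intro mult_left_mono mult_mono far small) auto
  also have "\<dots> = shell_const * (\<tau> * h * Y) powr (1/16) * (h / (h + \<bar>t\<bar>)) powr (5/8)"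
    by (simp add: shell_const_def power2_eq_square)
  finally show ?thesis by (simp add: D_def)
next
  case False
  have "h * 2 \<le> h * Y" using h Y by (intro mult_left_mono) auto
  hence h2: "h \<le> 1/2" using h(2) by linarith
  define P where "P = \<tau> * h * Y"
  have P: "0 \<le> P" "P \<le> 1" unfolding P_def using h Y by (auto simp: \<tau>_def)
  have ut: "u t \<le> 16 * C * u h"
  proof (cases "\<bar>t\<bar> \<le> h")
    case True
    have "u \<bar>t\<bar> \<le> C * u h" using True h2 by (intro defect_quasimono) auto
    also have "\<dots> \<le> 16 * C * u h" using C by (intro mult_right_mono) auto
    finally show ?thesis by simp
  next
    case ht: False
    have "u \<bar>t\<bar> \<le> 4 * C * (\<bar>t\<bar> / h)\<^sup>2 * u h"
      using ht h h2 by (intro defect_upper) auto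
    also have "(\<bar>t\<bar> / h)\<^sup>2 \<le> 2\<^sup>2"
      using False h by (intro power_mono) (auto simp: field_simps)
    hence "4 * C * (\<bar>t\<bar> / h)\<^sup>2 * u h \<le> 4 * C * 2\<^sup>2 * u h"
      using C by (intro mult_right_mono mult_left_mono) auto
    finally show ?thesis by simp
  qed
  have uh: "real n * u h \<le> C * P"
  proof -
    have "(1 / Y) * u h \<le> C * h * u (1 / Y)"
      using h Y by (intro quasiconvex) (auto simp: field_simps)
    hence "u h \<le> C * h * Y * u (1 / Y)"
      using Y by (simp add: field_simps)
    hence "real n * u h \<le> real n * (C * h * Y * u (1 / Y))"
      by (intro mult_left_mono) auto
    thus ?thesis by (simp add: P_def \<tau>_def mult_ac)
  qed
  have incr: "cmod (increment n s) \<le> B * u s" for s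
  proof -
    have "cmod (\<theta> s) ^ n * cmod (\<theta> s - 1) \<le> 1 * (B * u s)"
      by (intro mult_mono power_le_one norm_fourier_le_1 cmod_diff_1_le_defect) auto
    thus ?thesis by (simp add: increment_def norm_mult norm_power)
  qed
  have "cmod (increment n (t + h) - increment n t) \<le> B * u (t + h) + B * u t"
    by (rule order_trans[OF norm_triangle_ineq4 add_mono[OF incr incr]])
  also have "\<dots> \<le> B * (50 * C * u h)"
  proof -
    have "1 * u h \<le> C * u h" using C by (intro mult_right_mono) auto
    hence "u (t + h) + u t \<le> 50 * C * u h"
      using defect_add[of \<mu> t h] ut by linarith
    from mult_left_mono[OF this, of B] show ?thesis using B by (simp add: algebra_simps)
  qed
  finally have "real n * cmod (increment n (t + h) - increment n t) \<le> real n * (B * (50 * C * u h))"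
    by (intro mult_left_mono) auto
  also have "\<dots> = 50 * B * C * (real n * u h)" by simp
  also have "\<dots> \<le> 50 * B * C * (C * P)"
    using uh B C by (intro mult_left_mono) auto
  also have "\<dots> = 50 * B * C\<^sup>2 * P" by (simp add: power2_eq_square)
  also have "\<dots> \<le> 50 * B * C\<^sup>2 * (3 * (P powr (1/16) * (h / (h + \<bar>t\<bar>)) powr (5/8)))"
  proof (intro mult_left_mono)
    have "P \<le> P powr (1/16)"
      using P powr_mono'[of "1/16" 1 P] by (cases "P = 0") auto
    moreover have "1/3 \<le> (h / (h + \<bar>t\<bar>)) powr (5/8)"
    proof -
      have "(1/3::real) = (1/3) powr 1" by simp
      also have "\<dots> \<le> (1/3) powr (5/8)" by (intro powr_mono') auto
      also have "\<dots> \<le> (h / (h + \<bar>t\<bar>)) powr (5/8)"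
        using False h by (intro powr_mono2) (auto simp: field_simps)
      finally show ?thesis .
    qed
    ultimately have "P * (1/3) \<le> P powr (1/16) * (h / (h + \<bar>t\<bar>)) powr (5/8)"
      using P by (intro mult_mono) auto
    thus "P \<le> 3 * (P powr (1/16) * (h / (h + \<bar>t\<bar>)) powr (5/8))" by simp
  qed (use B C in auto)
  also have "\<dots> = 150 * B * C\<^sup>2 * (P powr (1/16) * (h / (h + \<bar>t\<bar>)) powr (5/8))" by simp
  also have "\<dots> \<le> shell_const * (P powr (1/16) * (h / (h + \<bar>t\<bar>)) powr (5/8))"
    using shell_const_ge by (intro mult_right_mono) auto
  finally show ?thesis by (simp add: P_def mult_ac)
qed

text \<open>
  Multiplication of the coefficients of a Fourier series by \<open>e\<^bsup>2\<pi>ixh\<^esup> - 1\<close> amounts to taking differences with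
  step \<open>h\<close>.  For \<open>h = 1 / (4 R)\<close> that factor has modulus at least 1 on the shell, so Bessel's inequality and
  the Cauchy-Schwarz inequality bound the sum by the \<open>L\<^sup>2\<close> modulus of continuity.
\<close>

lemma increments_on_shell:
  fixes Y R :: real and n :: nat
  defines "\<tau> \<equiv> real n * u (1 / Y)"
  assumes Y: "2 \<le> Y" and n: "0 < n" and R: "Y \<le> R" "\<tau> * Y \<le> R"
    and X: "\<And>x. x \<in> X \<Longrightarrow> R \<le> \<bar>real_of_int x\<bar>" "\<And>x. x \<in> X \<Longrightarrow> \<bar>real_of_int x\<bar> < 2 * R"
  shows "(\<Sum>x\<in>X. \<bar>E n x\<bar>) \<le> 4 * shell_const / real n * (\<tau> * Y / R) powr (1/16)"
proof -
  define h where "h = 1 / (4 * R)"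
  define P where "P = \<tau> * h * Y"
  have R2: "2 \<le> R" using R Y by linarith
  have X2R: "\<bar>real_of_int x\<bar> \<le> 2 * R" if "x \<in> X" for x
    using X(2)[OF that] by simp
  have finX: "finite X"
    by (rule card_int_le(1)[of X "2 * R"]) (use X2R R2 in auto)
  have "real (card X) \<le> 2 * (2 * R) + 1"
    by (rule card_int_le(2)) (use X2R R2 in auto)
  hence cardX: "real (card X) \<le> 5 * R"
    using R2 by linarith
  have h: "0 < h" "h * Y \<le> 1" "\<tau> * h * Y \<le> 1"
  proof -
    show "0 < h" using R2 by (simp add: h_def)
    show "h * Y \<le> 1" using R R2 by (simp add: h_def)
    have "\<tau> * h * Y = \<tau> * Y / (4 * R)" by (simp add: h_def)
    also have "\<dots> \<le> 1" using R R2 by (subst divide_le_eq_1_pos) auto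
    finally show "\<tau> * h * Y \<le> 1" .
  qed
  have P0: "0 \<le> P" unfolding P_def using h Y by (simp add: \<tau>_def)
  let ?F = "\<lambda>t. increment n (t + h) - increment n t"
  let ?I = "{- 1/2..1/2 :: real}"
  obtain I where I: "((\<lambda>t. (h / (h + \<bar>t\<bar>)) powr (5/4)) has_integral I) ?I" "I \<le> 8 * h"
    using integral_decay_kernel[OF h(1)] .
  have "continuous_on ?I (\<lambda>t. cmod (?F t) ^ 2)" by (intro continuous_intros)
  then obtain J where J: "((\<lambda>t. cmod (?F t) ^ 2) has_integral J) ?I"
    using integrable_continuous_real integrable_integral by blast
  have "J \<le> (shell_const / real n)\<^sup>2 * P powr (1/8) * I"
  proof (rule has_integral_le[OF J])
    show "((\<lambda>t. (shell_const / real n)\<^sup>2 * P powr (1/8) * (h / (h + \<bar>t\<bar>)) powr (5/4)) has_integral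
        (shell_const / real n)\<^sup>2 * P powr (1/8) * I) ?I"
      by (intro has_integral_mult_right I)
    fix t :: real assume "t \<in> ?I"
    hence "\<bar>t\<bar> \<le> 1/2" by (auto simp: abs_le_iff)
    from increment_modulus[OF Y n h(1,2) h(3)[unfolded \<tau>_def] this]
    have "real n * cmod (?F t) \<le> shell_const * P powr (1/16) * (h / (h + \<bar>t\<bar>)) powr (5/8)"
      unfolding P_def \<tau>_def .
    hence "cmod (?F t) \<le> (shell_const / real n) * P powr (1/16) * (h / (h + \<bar>t\<bar>)) powr (5/8)"
      using n by (simp add: field_simps)
    hence "cmod (?F t) ^ 2 \<le> ((shell_const / real n) * P powr (1/16) * (h / (h + \<bar>t\<bar>)) powr (5/8))\<^sup>2"
      by (intro power_mono) auto
    also have "\<dots> = (shell_const / real n)\<^sup>2 * (P powr (1/16))\<^sup>2 * ((h / (h + \<bar>t\<bar>)) powr (5/8))\<^sup>2"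
      by (simp only: power_mult_distrib)
    also have "(P powr (1/16))\<^sup>2 = P powr (1/8)"
      by (simp only: powr_squared) simp
    also have "((h / (h + \<bar>t\<bar>)) powr (5/8))\<^sup>2 = (h / (h + \<bar>t\<bar>)) powr (5/4)"
      by (simp only: powr_squared) simp
    finally show "cmod (?F t) ^ 2
      \<le> (shell_const / real n)\<^sup>2 * P powr (1/8) * (h / (h + \<bar>t\<bar>)) powr (5/4)" .
  qed
  also have "\<dots> \<le> (shell_const / real n)\<^sup>2 * P powr (1/8) * (8 * h)"
    using I by (intro mult_left_mono) auto
  finally have Jle: "J \<le> (shell_const / real n)\<^sup>2 * P powr (1/8) * (8 * h)" .
  have "(\<Sum>x\<in>X. cmod (of_real (E n x) * (chi x h - 1)) ^ 2) \<le> J"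
  proof (rule bessel_inequality[OF _ finX _ J])
    show "continuous_on ?I ?F" by (intro continuous_intros)
    show "((\<lambda>t. ?F t * cnj (chi x t)) has_integral of_real (E n x) * (chi x h - 1)) ?I" for x
      using has_integral_diff[OF increment_has_integral[of n h x] increment_has_integral[of n 0 x]]
      by (simp add: algebra_simps)
  qed
  moreover have "\<bar>E n x\<bar>\<^sup>2 \<le> cmod (of_real (E n x) * (chi x h - 1)) ^ 2" if "x \<in> X" for x
  proof -
    \<comment> \<open>On the shell \<open>x h\<close> lies between 1/4 and 1/2 in absolute value.\<close>
    have "cos (2 * pi * of_int x * h) \<le> 0"
    proof -
      define a where "a = \<bar>2 * pi * of_int x * h\<bar>"
      define q where "q = \<bar>real_of_int x\<bar> / R"
      have a: "a = (pi / 2) * q"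
        using R2 by (simp add: a_def h_def q_def abs_mult)
      have "1 \<le> q" "q \<le> 2"
        unfolding q_def using X(1)[OF that] X2R[OF that] R2
        by (simp_all add: le_divide_eq_1_pos pos_divide_le_eq)
      hence "pi / 2 * 1 \<le> a" "a \<le> pi / 2 * 2"
        unfolding a by (intro mult_left_mono; simp)+
      hence "0 \<le> cos (pi - a)" by (intro cos_ge_zero) auto
      hence "cos a \<le> 0" by (simp add: cos_diff)
      thus ?thesis
        unfolding a_def cos_abs_real .
    qed
    hence "1 \<le> cmod (chi x h - 1) ^ 2"
      unfolding cmod_chi_diff_1 by simp
    from mult_left_mono[OF this, of "\<bar>E n x\<bar>\<^sup>2"] show ?thesis
      by (simp add: norm_mult power_mult_distrib)
  qed
  hence "(\<Sum>x\<in>X. \<bar>E n x\<bar>\<^sup>2) \<le> (\<Sum>x\<in>X. cmod (of_real (E n x) * (chi x h - 1)) ^ 2)"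
    by (rule sum_mono)
  ultimately have "(\<Sum>x\<in>X. \<bar>E n x\<bar>\<^sup>2) \<le> (shell_const / real n)\<^sup>2 * P powr (1/8) * (8 * h)"
    using Jle by linarith
  hence "(\<Sum>x\<in>X. \<bar>E n x\<bar>\<^sup>2) * card X \<le> ((shell_const / real n)\<^sup>2 * P powr (1/8) * (8 * h)) * (5 * R)"
    using h by (intro mult_mono cardX) auto
  also have "\<dots> = 10 * ((shell_const / real n)\<^sup>2 * P powr (1/8))"
    using R2 by (simp add: h_def)
  also have "\<dots> \<le> 16 * ((shell_const / real n)\<^sup>2 * P powr (1/8))"
    by (intro mult_right_mono) auto
  also have "\<dots> = (4 * (shell_const / real n) * P powr (1/16))\<^sup>2"
    unfolding power_mult_distrib powr_squared by simp
  finally have "(\<Sum>x\<in>X. \<bar>E n x\<bar>)\<^sup>2 \<le> (4 * (shell_const / real n) * P powr (1/16))\<^sup>2"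
    by (rule order_trans[OF sum_squared_le_sum_of_squares])
  hence "(\<Sum>x\<in>X. \<bar>E n x\<bar>) \<le> 4 * (shell_const / real n) * P powr (1/16)"
    by (rule power2_le_imp_le) (use shell_const_ge in auto)
  also have "P powr (1/16) \<le> (\<tau> * Y / R) powr (1/16)"
  proof (rule powr_mono2)
    have "P = \<tau> * Y / (4 * R)" by (simp add: P_def h_def)
    also have "\<dots> \<le> \<tau> * Y / R"
      using R2 Y by (intro divide_left_mono) (auto simp: \<tau>_def)
    finally show "P \<le> \<tau> * Y / R" .
  qed (use P0 in auto)
  hence "4 * (shell_const / real n) * P powr (1/16) \<le> 4 * (shell_const / real n) * (\<tau> * Y / R) powr (1/16)"
    using shell_const_ge by (intro mult_left_mono) auto
  finally show ?thesis by simp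
qed

definition tail_const :: real where "tail_const = 4 * shell_const / (1 - 2 powr (- 1/16))"

lemma tail_const: "0 < tail_const" "4 * shell_const + 2 powr (- 1/16) * tail_const = tail_const"
proof -
  have "(2::real) powr (- 1/16) < 2 powr 0" by (intro powr_less_mono) auto
  hence "0 < 1 - (2::real) powr (- 1/16)" by simp
  thus "0 < tail_const" "4 * shell_const + 2 powr (- 1/16) * tail_const = tail_const"
    unfolding tail_const_def using shell_const_ge by (simp_all add: field_simps)
qed

text \<open>
  The shell bounds form a geometric series with ratio \<open>2\<^bsup>-1/16\<^esup>\<close>; \<open>tail_const\<close> is the fixed point of
  the resulting recursion.
\<close>

lemma increments_tail:
  fixes Y R :: real and n :: nat
  defines "\<tau> \<equiv> real n * u (1 / Y)"
  assumes Y: "2 \<le> Y" and n: "0 < n" and R: "Y \<le> R" "\<tau> * Y \<le> R"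
    and X: "finite X" "\<And>x. x \<in> X \<Longrightarrow> R \<le> \<bar>real_of_int x\<bar>"
  shows "(\<Sum>x\<in>X. \<bar>E n x\<bar>) \<le> tail_const / real n * (\<tau> * Y / R) powr (1/16)"
proof -
  have "(\<Sum>x\<in>X. \<bar>E n x\<bar>) \<le> tail_const / real n * (\<tau> * Y / R) powr (1/16)"
    if "finite X" "\<And>x. x \<in> X \<Longrightarrow> R \<le> \<bar>real_of_int x\<bar>" "\<And>x. x \<in> X \<Longrightarrow> \<bar>real_of_int x\<bar> < 2 ^ J * R"
      "Y \<le> R" "\<tau> * Y \<le> R" for J X R
    using that
  proof (induction J arbitrary: X R)
    case 0
    hence "X = {}" by force
    thus ?case using tail_const by simp
  next
    case (Suc J)
    have R0: "0 < R" using Suc.prems Y by linarith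
    define p where "p = (\<tau> * Y / R) powr (1/16)"
    let ?X1 = "{x \<in> X. \<bar>real_of_int x\<bar> < 2 * R}" and ?X2 = "{x \<in> X. \<not> \<bar>real_of_int x\<bar> < 2 * R}"
    have "(\<Sum>x\<in>X. \<bar>E n x\<bar>) = (\<Sum>x\<in>?X1. \<bar>E n x\<bar>) + (\<Sum>x\<in>?X2. \<bar>E n x\<bar>)"
      using sum.Int_Diff[OF Suc.prems(1), of "\<lambda>x. \<bar>E n x\<bar>" "{x. \<bar>real_of_int x\<bar> < 2 * R}"]
      by (simp add: Int_def set_diff_eq)
    also have "(\<Sum>x\<in>?X1. \<bar>E n x\<bar>) \<le> 4 * shell_const / real n * p"
      unfolding p_def \<tau>_def using Suc.prems by (intro increments_on_shell[OF Y n]) (auto simp: \<tau>_def)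
    also have "(\<Sum>x\<in>?X2. \<bar>E n x\<bar>) \<le> tail_const / real n * (\<tau> * Y / (2 * R)) powr (1/16)"
    proof (rule Suc.IH)
      show "\<bar>real_of_int x\<bar> < 2 ^ J * (2 * R)" if "x \<in> ?X2" for x
        using Suc.prems(3)[of x] that by (simp add: mult_ac)
    qed (use Suc.prems R0 in auto)
    also have "(\<tau> * Y / (2 * R)) powr (1/16) = 2 powr (- 1/16) * p"
    proof -
      have "(\<tau> * Y / (2 * R)) powr (1/16) = (\<tau> * Y / R / 2) powr (1/16)" by (simp add: mult.commute)
      also have "\<dots> = p / 2 powr (1/16)" unfolding p_def by (rule powr_divide)
      also have "\<dots> = 2 powr (- 1/16) * p"
        using powr_minus_divide[of "2::real" "1/16"] by simp
      finally show ?thesis .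
    qed
    finally have "(\<Sum>x\<in>X. \<bar>E n x\<bar>) \<le> (4 * shell_const + 2 powr (- 1/16) * tail_const) / real n * p"
      by (simp add: add_divide_distrib algebra_simps)
    thus ?case unfolding tail_const p_def .
  qed
  moreover obtain J where "\<And>x. x \<in> X \<Longrightarrow> \<bar>real_of_int x\<bar> < 2 ^ J * R"
  proof -
    define m where "m = (\<Sum>x\<in>X. \<bar>real_of_int x\<bar>)"
    obtain J where J: "m < 2 ^ J" using real_arch_pow[of 2 m] by auto
    have "\<bar>real_of_int x\<bar> < 2 ^ J * R" if "x \<in> X" for x
    proof -
      have "\<bar>real_of_int x\<bar> \<le> m"
        unfolding m_def using that X(1) by (intro member_le_sum) auto
      also have "m < 2 ^ J * 1" using J by simp
      also have "\<dots> \<le> 2 ^ J * R" using R Y by (intro mult_left_mono) auto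
      finally show ?thesis .
    qed
    thus thesis by (rule that)
  qed
  ultimately show ?thesis using X R by blast
qed

section \<open>Smoothness of the increments\<close>

lemma increment_exp_decay:
  assumes "t \<noteq> 0" "\<bar>t\<bar> \<le> 1/2"
  shows "real n * cmod (increment n t) \<le> B * (real n * u t * exp (- (decay * (real n * u t))))"
proof -
  have "(1 - decay * u t) ^ n \<le> exp (- (decay * u t)) ^ n"
    using exp_ge_add_one_self[of "- (decay * u t)"] decay(3)[of t] by (intro power_mono) auto
  also have "\<dots> = exp (- (decay * (real n * u t)))"
    by (simp add: exp_of_nat_mult[symmetric] mult_ac)
  finally have "B * u t * (1 - decay * u t) ^ n \<le> B * u t * exp (- (decay * (real n * u t)))"
    using B by (intro mult_left_mono) auto
  with norm_increment_le[OF assms, of n]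
  have "cmod (increment n t) \<le> B * u t * exp (- (decay * (real n * u t)))" by linarith
  from mult_left_mono[OF this, of "real n"] show ?thesis by (simp add: mult_ac)
qed

definition smooth_const :: real where "smooth_const = 13000 * B\<^sup>2 * C\<^sup>2 / decay ^ 4"

lemma smooth_const: "0 < smooth_const"
  unfolding smooth_const_def using B C decay by simp

text \<open>
  This is where large \<open>\<tau>\<close> helps.  The factor \<open>e\<^bsup>-2\<pi>iyt\<^esup> - 1\<close> is at most \<open>7 \<bar>t\<bar> Y\<close>, and \<open>n u(t)\<close> is at least
  \<open>\<tau> (\<bar>t\<bar> Y)\<^sup>2 / (4 C)\<close> below the frequency \<open>1/Y\<close> and at least \<open>\<tau> \<bar>t\<bar> Y / C\<close> above it.  The exponent - 5/4 of
  \<open>\<tau>\<close> is admissible because it stays above - 3/2, where integrability at 0 would be lost.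
\<close>

lemma increment_smoothness:
  fixes Y :: real and n :: nat and y :: int
  defines "\<tau> \<equiv> real n * u (1 / Y)"
  assumes Y: "2 \<le> Y" and n: "0 < n" and \<tau>: "1 \<le> \<tau>" and y: "\<bar>real_of_int y\<bar> \<le> Y"
    and t: "\<bar>t\<bar> \<le> 1/2"
  shows "(real n * cmod (increment n t * (cnj (chi y t) - 1)))\<^sup>2 \<le>
    smooth_const * \<tau> powr (- 5/4) * ((\<bar>t\<bar> * Y) powr (- 1/2) * (1 + \<bar>t\<bar> * Y) powr (- 3/2))"
proof (cases "t = 0")
  case False
  define z where "z = \<bar>t\<bar> * Y"
  define w where "w = real n * u t"
  define r where "r = z powr (- 1/2) * (1 + z) powr (- 3/2)"
  have z: "0 < z" unfolding z_def using False Y by simp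
  have ut: "0 < u t"
    using defect_pos[of "\<bar>t\<bar>"] False t by simp
  have w: "0 < w" unfolding w_def using ut n by simp
  have c: "cmod (cnj (chi y t) - 1) = cmod (chi y t - 1)"
    by (metis complex_cnj_diff complex_cnj_one complex_mod_cnj)
  have c2: "cmod (chi y t - 1) \<le> 2"
    using norm_triangle_ineq4[of "chi y t" 1] by simp
  have c7: "cmod (chi y t - 1) \<le> 7 * z"
  proof -
    have "cmod (chi y t - 1) \<le> 2 * pi * (\<bar>of_int y\<bar> * \<bar>t\<bar>)"
      using cmod_chi_diff_1_le[of y t] by (simp add: mult_ac)
    also have "\<dots> \<le> 2 * pi * (Y * \<bar>t\<bar>)"
      using y by (intro mult_left_mono mult_right_mono) auto
    also have "\<dots> \<le> 7 * (Y * \<bar>t\<bar>)"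
      using pi_less_4 pi_approx Y by (intro mult_right_mono) auto
    finally show ?thesis by (simp add: z_def mult.commute)
  qed
  have main: "real n * cmod (increment n t * (cnj (chi y t) - 1))
      \<le> B * (w * exp (- (decay * w))) * cmod (chi y t - 1)"
    using mult_right_mono[OF increment_exp_decay[OF False t, of n], of "cmod (chi y t - 1)"]
    by (simp add: norm_mult c w_def mult_ac)
  define L where "L = real n * cmod (increment n t * (cnj (chi y t) - 1))"
  have L0: "0 \<le> L" by (simp add: L_def)
  have one_z: "(1 + z) powr (- 3/2) \<ge> (max 1 z) powr (- 3/2) / 4"
  proof -
    have "(2 * max 1 z) powr (- 3/2) \<le> (1 + z) powr (- 3/2)"
      using z by (intro powr_mono2') auto
    moreover have "(2 * max 1 z) powr (- 3/2) = 2 powr (- 3/2) * (max 1 z) powr (- 3/2)"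
      using z by (simp only: powr_mult)
    moreover have "(2::real) powr (- 2) \<le> 2 powr (- 3/2)"
      by (intro powr_mono) auto
    hence "1/4 \<le> (2::real) powr (- 3/2)" by (simp add: powr_minus)
    hence "1/4 * (max 1 z) powr (- 3/2) \<le> 2 powr (- 3/2) * (max 1 z) powr (- 3/2)"
      by (intro mult_right_mono) auto
    ultimately show ?thesis by simp
  qed
  have "L\<^sup>2 \<le> 12544 * B\<^sup>2 * C\<^sup>2 / decay ^ 4 * \<tau> powr (- 5/4) * r"
  proof (cases "z \<le> 1")
    case le: True
    have "u (1 / Y) \<le> 4 * C * ((1 / Y) / \<bar>t\<bar>)\<^sup>2 * u \<bar>t\<bar>"
      using le False t Y by (intro defect_upper) (auto simp: z_def field_simps)
    also have "(1 / Y) / \<bar>t\<bar> = 1 / z" by (simp add: z_def mult.commute)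
    finally have "z\<^sup>2 * u (1 / Y) \<le> 4 * C * u t"
      using z by (simp add: field_simps)
    from mult_left_mono[OF this, of "real n"] have wlow: "z\<^sup>2 * \<tau> / (4 * C) \<le> w"
      using C by (simp add: w_def \<tau>_def field_simps)
    have "L \<le> B * (2 / decay\<^sup>2 * w powr (- 5/8)) * (7 * z)"
      unfolding L_def using decay w B z
      by (intro order_trans[OF main] mult_mono c7 mult_left_mono exp_decay_power_bound) auto
    hence "L\<^sup>2 \<le> (B * (2 / decay\<^sup>2 * w powr (- 5/8)) * (7 * z))\<^sup>2"
      using L0 by (intro power_mono) auto
    also have "\<dots> = 196 * B\<^sup>2 / decay ^ 4 * (w powr (- 5/4)) * z\<^sup>2"
      unfolding power_mult_distrib powr_squared power_divide by simp
    also have "w powr (- 5/4) \<le> (z\<^sup>2 * \<tau> / (4 * C)) powr (- 5/4)"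
      using wlow z C \<tau> by (intro powr_mono2') auto
    hence "196 * B\<^sup>2 / decay ^ 4 * (w powr (- 5/4)) * z\<^sup>2
        \<le> 196 * B\<^sup>2 / decay ^ 4 * ((z\<^sup>2 * \<tau> / (4 * C)) powr (- 5/4)) * z\<^sup>2"
      by (intro mult_right_mono mult_left_mono) auto
    also have "(z\<^sup>2 * \<tau> / (4 * C)) powr (- 5/4) = z powr (- 5/2) * \<tau> powr (- 5/4) * (4 * C) powr (5/4)"
    proof -
      have "(z\<^sup>2 * \<tau> / (4 * C)) powr (- 5/4) = (z\<^sup>2) powr (- 5/4) * \<tau> powr (- 5/4) * (1 / (4 * C) powr (- 5/4))"
        unfolding powr_divide powr_mult by simp
      moreover have "(z\<^sup>2) powr (- 5/4) = z powr (- 5/2)"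
        using z powr_powr[of z 2 "- 5/4"] by simp
      moreover have "1 / (4 * C) powr (- 5/4) = (4 * C) powr (5/4)"
        using powr_minus_divide[of "4 * C" "- 5/4"] by simp
      ultimately show ?thesis by (simp only:)
    qed
    also have "196 * B\<^sup>2 / decay ^ 4 * (z powr (- 5/2) * \<tau> powr (- 5/4) * (4 * C) powr (5/4)) * z\<^sup>2
        = 196 * B\<^sup>2 / decay ^ 4 * (4 * C) powr (5/4) * \<tau> powr (- 5/4) * (z powr (- 5/2) * z\<^sup>2)"
      by simp
    also have "z powr (- 5/2) * z\<^sup>2 = z powr (- 1/2)"
    proof -
      have "z powr (- 5/2) * z powr 2 = z powr (- 1/2)"
        unfolding powr_add[symmetric] by simp
      thus ?thesis using z by simp
    qed
    also have "196 * B\<^sup>2 / decay ^ 4 * (4 * C) powr (5/4) * \<tau> powr (- 5/4) * z powr (- 1/2)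
        \<le> 196 * B\<^sup>2 / decay ^ 4 * (16 * C\<^sup>2) * \<tau> powr (- 5/4) * (4 * r)"
    proof (intro mult_mono)
      have "(4 * C) powr (5/4) \<le> (4 * C) powr 2" using C by (intro powr_mono) auto
      also have "\<dots> = 16 * C\<^sup>2" using C by (simp add: power_mult_distrib)
      finally show "(4 * C) powr (5/4) \<le> 16 * C\<^sup>2" .
      have "max 1 z = 1" using le by simp
      hence "1 \<le> 4 * (1 + z) powr (- 3/2)" using one_z by simp
      from mult_left_mono[OF this, of "z powr (- 1/2)"] show "z powr (- 1/2) \<le> 4 * r"
        by (simp add: r_def mult_ac)
    qed (auto simp: r_def)
    also have "\<dots> = 12544 * B\<^sup>2 * C\<^sup>2 / decay ^ 4 * \<tau> powr (- 5/4) * r" by simp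
    finally show ?thesis .
  next
    case False
    hence z1: "1 < z" by simp
    have "\<bar>t\<bar> * u (1 / Y) \<le> C * (1 / Y) * u \<bar>t\<bar>"
      using z1 t Y by (intro quasiconvex) (auto simp: z_def field_simps)
    hence "z * u (1 / Y) \<le> C * u t"
      using Y by (simp add: z_def field_simps)
    from mult_left_mono[OF this, of "real n"] have wlow: "z * \<tau> / C \<le> w"
      using C by (simp add: w_def \<tau>_def field_simps)
    have "L \<le> B * (2 / decay\<^sup>2 * w powr (- 1)) * 2"
      unfolding L_def using decay w B z
      by (intro order_trans[OF main] mult_mono c2 mult_left_mono exp_decay_power_bound) auto
    hence "L\<^sup>2 \<le> (B * (2 / decay\<^sup>2 * w powr (- 1)) * 2)\<^sup>2"
      using L0 by (intro power_mono) auto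
    also have "\<dots> = 16 * B\<^sup>2 / decay ^ 4 * w powr (- 2)"
      unfolding power_mult_distrib powr_squared power_divide by simp
    also have "w powr (- 2) \<le> (z * \<tau> / C) powr (- 2)"
      using wlow z C \<tau> by (intro powr_mono2') auto
    hence "16 * B\<^sup>2 / decay ^ 4 * w powr (- 2) \<le> 16 * B\<^sup>2 / decay ^ 4 * (z * \<tau> / C) powr (- 2)"
      by (intro mult_left_mono) auto
    also have "(z * \<tau> / C) powr (- 2) = C\<^sup>2 * \<tau> powr (- 2) * z powr (- 2)"
    proof -
      have "(z * \<tau> / C) powr (- 2) = z powr (- 2) * \<tau> powr (- 2) * (1 / C powr (- 2))"
        unfolding powr_divide powr_mult by simp
      moreover have "1 / C powr (- 2) = C\<^sup>2"
        using powr_minus_divide[of C "- 2"] C by simp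
      ultimately show ?thesis by (simp only: mult_ac)
    qed
    also have "16 * B\<^sup>2 / decay ^ 4 * (C\<^sup>2 * \<tau> powr (- 2) * z powr (- 2))
        \<le> 16 * B\<^sup>2 / decay ^ 4 * (C\<^sup>2 * \<tau> powr (- 5/4) * (4 * r))"
    proof (intro mult_left_mono mult_mono)
      show "\<tau> powr (- 2) \<le> \<tau> powr (- 5/4)" using \<tau> by (intro powr_mono) auto
      have "z powr (- 2) = z powr (- 1/2) * z powr (- 3/2)"
        unfolding powr_add[symmetric] by simp
      also have "\<dots> \<le> z powr (- 1/2) * (4 * (1 + z) powr (- 3/2))"
      proof (rule mult_left_mono)
        have "max 1 z = z" using z1 by simp
        thus "z powr (- 3/2) \<le> 4 * (1 + z) powr (- 3/2)" using one_z by simp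
      qed simp
      finally show "z powr (- 2) \<le> 4 * r" by (simp add: r_def)
    qed auto
    also have "\<dots> = 64 * (B\<^sup>2 * C\<^sup>2 / decay ^ 4 * \<tau> powr (- 5/4) * r)" by simp
    also have "\<dots> \<le> 12544 * (B\<^sup>2 * C\<^sup>2 / decay ^ 4 * \<tau> powr (- 5/4) * r)"
      by (intro mult_right_mono) (auto simp: r_def)
    finally show ?thesis by simp
  qed
  also have "\<dots> \<le> smooth_const * \<tau> powr (- 5/4) * r"
    unfolding smooth_const_def r_def by (intro mult_right_mono divide_right_mono) auto
  finally show ?thesis
    unfolding L_def r_def z_def .
qed simp

definition shift_const :: real where
  "shift_const = sqrt (20 * smooth_const) + 2 * tail_const"

lemma shift_const: "0 < shift_const" "2 * tail_const \<le> shift_const"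
  unfolding shift_const_def using smooth_const tail_const(1) by (auto intro: add_nonneg_pos)

text \<open>
  The sum is split at \<open>\<bar>x\<bar> = 2 R\<close> with \<open>R = Y \<tau>\<^bsup>9/8\<^esup>\<close>.  Far out the two terms are estimated separately
  by the tail bound, which decays in \<open>\<tau>\<close> because 9/8 > 1; near the origin the Cauchy-Schwarz inequality costs
  \<open>R\<^bsup>1/2\<^esup>\<close>, which the smoothness gain \<open>\<tau>\<^bsup>-5/8\<^esup>\<close> outweighs because 9/8 < 5/4.
\<close>

lemma increments_shift_large:
  fixes Y :: real and n :: nat and y :: int
  defines "\<tau> \<equiv> real n * u (1 / Y)"
  assumes Y: "2 \<le> Y" and n: "0 < n" and \<tau>: "1 \<le> \<tau>" and y: "\<bar>real_of_int y\<bar> \<le> Y" and X: "finite X"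
  shows "(\<Sum>x\<in>X. \<bar>E n (x + y) - E n x\<bar>) \<le> shift_const / real n * \<tau> powr (- 1/128)"
proof -
  define R where "R = Y * \<tau> powr (9/8)"
  let ?I = "{- 1/2..1/2 :: real}"
  let ?F = "\<lambda>t. increment n t * (cnj (chi y t) - 1)"
  let ?D = "\<lambda>x. \<bar>E n (x + y) - E n x\<bar>"
  have \<tau>R: "\<tau> \<le> \<tau> powr (9/8)" using powr_mono[of 1 "9/8" \<tau>] \<tau> by simp
  hence YR: "\<tau> * Y \<le> R" "Y \<le> R"
    unfolding R_def using mult_left_mono[of \<tau> "\<tau> powr (9/8)" Y] mult_left_mono[of 1 "\<tau> powr (9/8)" Y] Y \<tau>
    by (auto simp: mult.commute)
  have R2: "2 \<le> R" using YR Y by linarith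
  obtain I where I: "((\<lambda>t. (\<bar>t\<bar> * Y) powr (- 1/2) * (1 + \<bar>t\<bar> * Y) powr (- 3/2)) has_integral I) ?I"
      "I \<le> 4 / Y"
    using integral_smoothness_kernel[of Y] Y by auto
  have "continuous_on ?I (\<lambda>t. cmod (?F t) ^ 2)" by (intro continuous_intros)
  then obtain J where J: "((\<lambda>t. cmod (?F t) ^ 2) has_integral J) ?I"
    using integrable_continuous_real integrable_integral by blast
  define A where "A = smooth_const / (real n)\<^sup>2 * \<tau> powr (- 5/4)"
  have A: "0 \<le> A" unfolding A_def using smooth_const by simp
  have "J \<le> A * I"
  proof (rule has_integral_le[OF J has_integral_mult_right[OF I(1)]])
    fix t :: real assume "t \<in> ?I"
    hence "\<bar>t\<bar> \<le> 1/2" by (auto simp: abs_le_iff)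
    from increment_smoothness[OF Y n \<tau>[unfolded \<tau>_def] y this]
    have "(real n * cmod (?F t))\<^sup>2 \<le>
        smooth_const * \<tau> powr (- 5/4) * ((\<bar>t\<bar> * Y) powr (- 1/2) * (1 + \<bar>t\<bar> * Y) powr (- 3/2))"
      unfolding \<tau>_def .
    thus "cmod (?F t) ^ 2 \<le> A * ((\<bar>t\<bar> * Y) powr (- 1/2) * (1 + \<bar>t\<bar> * Y) powr (- 3/2))"
      using n by (simp add: A_def power_mult_distrib pos_le_divide_eq mult_ac)
  qed
  also have "\<dots> \<le> A * (4 / Y)" using A I by (intro mult_left_mono) auto
  finally have JA: "J \<le> A * (4 / Y)" .
  have l2: "(\<Sum>x\<in>X'. (?D x)\<^sup>2) \<le> A * (4 / Y)" if "finite X'" for X'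
  proof -
    have "(\<Sum>x\<in>X'. cmod (of_real (E n (x + y) - E n x)) ^ 2) \<le> J"
    proof (rule bessel_inequality[OF _ that _ J])
      show "continuous_on ?I ?F" by (intro continuous_intros)
      show "((\<lambda>t. ?F t * cnj (chi x t)) has_integral of_real (E n (x + y) - E n x)) ?I" for x
        using has_integral_diff[OF increment_has_integral[of n 0 "x + y"] increment_has_integral[of n 0 x]]
        by (simp add: algebra_simps chi_add_freq)
    qed
    from order_trans[OF this JA] show ?thesis by (simp only: norm_of_real)
  qed
  let ?X1 = "{x \<in> X. \<bar>real_of_int x\<bar> < 2 * R}" and ?X2 = "{x \<in> X. \<not> \<bar>real_of_int x\<bar> < 2 * R}"
  have "(\<Sum>x\<in>X. ?D x) = (\<Sum>x\<in>?X1. ?D x) + (\<Sum>x\<in>?X2. ?D x)"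
    using sum.Int_Diff[OF X, of ?D "{x. \<bar>real_of_int x\<bar> < 2 * R}"]
    by (simp add: Int_def set_diff_eq)
  also have "(\<Sum>x\<in>?X1. ?D x) \<le> sqrt (20 * smooth_const) / real n * \<tau> powr (- 1/128)"
  proof -
    have "real (card ?X1) \<le> 2 * (2 * R) + 1"
      by (rule card_int_le(2)) (use R2 in auto)
    hence c: "real (card ?X1) \<le> 5 * R" using R2 by linarith
    have "(\<Sum>x\<in>?X1. ?D x)\<^sup>2 \<le> (\<Sum>x\<in>?X1. (?D x)\<^sup>2) * card ?X1"
      by (rule sum_squared_le_sum_of_squares)
    also have "\<dots> \<le> (A * (4 / Y)) * (5 * R)"
      using X A Y by (intro mult_mono c l2) auto
    also have "\<dots> = 20 * smooth_const / (real n)\<^sup>2 * (\<tau> powr (- 5/4) * \<tau> powr (9/8))"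
      unfolding A_def R_def using Y by simp
    also have "\<tau> powr (- 5/4) * \<tau> powr (9/8) = \<tau> powr (- 1/8)"
      unfolding powr_add[symmetric] by simp
    also have "\<tau> powr (- 1/8) \<le> \<tau> powr (- 1/64)"
      using \<tau> by (intro powr_mono) auto
    hence "20 * smooth_const / (real n)\<^sup>2 * \<tau> powr (- 1/8) \<le> 20 * smooth_const / (real n)\<^sup>2 * \<tau> powr (- 1/64)"
      using smooth_const by (intro mult_left_mono) auto
    also have "\<dots> = (sqrt (20 * smooth_const) / real n * \<tau> powr (- 1/128))\<^sup>2"
      unfolding power_mult_distrib powr_squared power_divide using smooth_const by simp
    finally show ?thesis
      by (rule power2_le_imp_le) (use smooth_const in auto)
  qed
  also have "(\<Sum>x\<in>?X2. ?D x) \<le> 2 * tail_const / real n * \<tau> powr (- 1/128)"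
  proof -
    have pw: "(\<tau> * Y / R) powr (1/16) = \<tau> powr (- 1/128)"
    proof -
      have "\<tau> * Y / R = \<tau> powr 1 / \<tau> powr (9/8)"
        unfolding R_def using Y \<tau> by simp
      also have "\<dots> = \<tau> powr (- 1/8)" unfolding powr_diff[symmetric] by simp
      finally show ?thesis by (simp add: powr_powr)
    qed
    have "(\<Sum>x\<in>?X2. ?D x) \<le> (\<Sum>x\<in>?X2. \<bar>E n (x + y)\<bar>) + (\<Sum>x\<in>?X2. \<bar>E n x\<bar>)"
      unfolding sum.distrib[symmetric] by (intro sum_mono abs_triangle_ineq4)
    also have "(\<Sum>x\<in>?X2. \<bar>E n (x + y)\<bar>) = (\<Sum>x\<in>(\<lambda>x. x + y) ` ?X2. \<bar>E n x\<bar>)"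
      by (subst sum.reindex) (auto simp: inj_on_def)
    also have "\<dots> \<le> tail_const / real n * (\<tau> * Y / R) powr (1/16)"
      unfolding \<tau>_def
    proof (rule increments_tail[OF Y n])
      fix x assume "x \<in> (\<lambda>x. x + y) ` ?X2"
      then obtain x' where "x = x' + y" "2 * R \<le> \<bar>real_of_int x'\<bar>" by auto
      thus "R \<le> \<bar>real_of_int x\<bar>" using y YR by simp
    qed (use X YR in \<open>auto simp: \<tau>_def\<close>)
    also have "(\<Sum>x\<in>?X2. \<bar>E n x\<bar>) \<le> tail_const / real n * (\<tau> * Y / R) powr (1/16)"
      unfolding \<tau>_def
      by (rule increments_tail[OF Y n]) (use X YR R2 in \<open>auto simp: \<tau>_def\<close>)
    finally show ?thesis unfolding pw by simp
  qed
  finally show ?thesis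
    by (simp add: shift_const_def add_divide_distrib distrib_right)
qed

text \<open>
  For small \<open>\<tau>\<close> the increment is concentrated within the distance \<open>Y\<close> of the origin, and the tail
  bound suffices without any cancellation.
\<close>

lemma increments_shift_small:
  fixes Y :: real and n :: nat and y :: int
  defines "\<tau> \<equiv> real n * u (1 / Y)"
  assumes Y: "2 \<le> Y" and n: "0 < n" and \<tau>: "\<tau> \<le> 1" and y: "\<bar>real_of_int y\<bar> \<le> Y"
    and X: "finite X" "\<And>x. x \<in> X \<Longrightarrow> 2 * Y \<le> \<bar>real_of_int x\<bar>"
  shows "(\<Sum>x\<in>X. \<bar>E n (x + y) - E n x\<bar>) \<le> shift_const / real n * \<tau> powr (1/128)"
proof -
  have \<tau>Y: "\<tau> * Y \<le> Y" using \<tau> Y by simp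
  have \<tau>0: "0 \<le> \<tau>" by (simp add: \<tau>_def)
  have "(\<Sum>x\<in>X. \<bar>E n (x + y) - E n x\<bar>) \<le> (\<Sum>x\<in>X. \<bar>E n (x + y)\<bar>) + (\<Sum>x\<in>X. \<bar>E n x\<bar>)"
    unfolding sum.distrib[symmetric] by (intro sum_mono abs_triangle_ineq4)
  also have "(\<Sum>x\<in>X. \<bar>E n (x + y)\<bar>) = (\<Sum>x\<in>(\<lambda>x. x + y) ` X. \<bar>E n x\<bar>)"
    by (subst sum.reindex) (auto simp: inj_on_def)
  also have "\<dots> \<le> tail_const / real n * (\<tau> * Y / Y) powr (1/16)"
    unfolding \<tau>_def
  proof (rule increments_tail[OF Y n])
    fix x assume "x \<in> (\<lambda>x. x + y) ` X"
    then obtain x' where "x = x' + y" "2 * Y \<le> \<bar>real_of_int x'\<bar>" using X by auto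
    thus "Y \<le> \<bar>real_of_int x\<bar>" using y by simp
  qed (use X \<tau>Y in \<open>auto simp: \<tau>_def\<close>)
  also have "(\<Sum>x\<in>X. \<bar>E n x\<bar>) \<le> tail_const / real n * (\<tau> * Y / Y) powr (1/16)"
    unfolding \<tau>_def
  proof (rule increments_tail[OF Y n])
    show "Y \<le> \<bar>real_of_int x\<bar>" if "x \<in> X" for x using X(2)[OF that] Y by simp
  qed (use X \<tau>Y in \<open>auto simp: \<tau>_def\<close>)
  finally have "(\<Sum>x\<in>X. \<bar>E n (x + y) - E n x\<bar>) \<le> 2 * tail_const / real n * \<tau> powr (1/16)"
    using Y by simp
  also have "\<dots> \<le> shift_const / real n * \<tau> powr (1/128)"
  proof (intro mult_mono divide_right_mono shift_const)
    show "\<tau> powr (1/16) \<le> \<tau> powr (1/128)"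
      using \<tau> \<tau>0 by (cases "\<tau> = 0") (auto intro: powr_mono')
  qed (use shift_const in auto)
  finally show ?thesis .
qed

section \<open>The kernel estimate\<close>

lemma sum_increments_shift:
  fixes Y :: real and y :: int
  assumes Y: "2 \<le> Y" and y: "\<bar>real_of_int y\<bar> \<le> Y"
    and X: "finite X" "\<And>x. x \<in> X \<Longrightarrow> 2 * Y \<le> \<bar>real_of_int x\<bar>"
  shows "(\<Sum>x\<in>X. \<Sum>n=1..N. \<bar>E n (x + y) - E n x\<bar>) \<le> 386 * shift_const"
proof -
  define v where "v = u (1 / Y)"
  have v: "0 < v" unfolding v_def using Y by (intro defect_pos) auto
  have "(\<Sum>x\<in>X. \<Sum>n=1..N. \<bar>E n (x + y) - E n x\<bar>) = (\<Sum>n=1..N. \<Sum>x\<in>X. \<bar>E n (x + y) - E n x\<bar>)"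
    by (rule sum.swap)
  also have "\<dots> \<le> (\<Sum>n=1..N. shift_const * (1 / real n * min ((real n * v) powr (1/128)) ((real n * v) powr (- (1/128)))))"
  proof (rule sum_mono)
    fix n assume "n \<in> {1..N}"
    hence n: "0 < n" by simp
    show "(\<Sum>x\<in>X. \<bar>E n (x + y) - E n x\<bar>)
      \<le> shift_const * (1 / real n * min ((real n * v) powr (1/128)) ((real n * v) powr (- (1/128))))"
    proof (cases "real n * v \<le> 1")
      case True
      have "1 \<le> (real n * v) powr (- (1/128))"
        using True v n powr_mono2'[of "- (1/128)" "real n * v" 1] by simp
      moreover have "(real n * v) powr (1/128) \<le> 1" using True v n by (intro powr_le1) auto
      ultimately show ?thesis
        using increments_shift_small[OF Y n _ y X] True by (simp add: v_def min_def)
    next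
      case False
      have "(real n * v) powr (- (1/128)) \<le> 1" using False by (intro powr_neg_le_one) auto
      moreover have "1 \<le> (real n * v) powr (1/128)" using False by (intro ge_one_powr_ge_zero) auto
      ultimately show ?thesis
        using increments_shift_large[OF Y n _ y X(1)] False by (simp add: v_def min_def)
    qed
  qed
  also have "\<dots> \<le> shift_const * (2 + 3 / (1/128))"
    unfolding sum_distrib_left[symmetric] using shift_const v
    by (intro mult_left_mono sum_min_powr_le) auto
  finally show ?thesis by simp
qed

lemma K_increment: "m \<le> n \<Longrightarrow> K n x = K m x + (\<Sum>i=m..<n. E i x)"
proof (induction n rule: dec_induct)
  case (step n)
  thus ?case by (simp add: E_def)
qed simp

lemma sum_K_le: "finite X \<Longrightarrow> (\<Sum>x\<in>X. K n x) \<le> 1"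
  unfolding K_def by (rule sum_pmf_le_1)

lemma K_nonneg [simp]: "0 \<le> K n x"
  by (simp add: K_def)

text \<open>
  The variation in \<open>n\<close>, which dominates the supremum over \<open>1 \<le> n \<le> N\<close> of \<open>\<bar>K n (x + y) - K n x\<bar>\<close>.
\<close>

definition kernel_modulus :: "nat \<Rightarrow> int \<Rightarrow> int \<Rightarrow> real" where
  "kernel_modulus N y x = \<bar>K 1 (x + y) - K 1 x\<bar> + (\<Sum>n=1..N. \<bar>E n (x + y) - E n x\<bar>)"

lemma kernel_modulus_bound:
  assumes "1 \<le> n" "n \<le> N"
  shows "\<bar>K n (x + y) - K n x\<bar> \<le> kernel_modulus N y x"
proof -
  have "K n (x + y) - K n x = (K 1 (x + y) - K 1 x) + (\<Sum>i=1..<n. E i (x + y) - E i x)"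
    using K_increment[OF assms(1)] by (simp add: sum_subtractf)
  also have "\<bar>\<dots>\<bar> \<le> \<bar>K 1 (x + y) - K 1 x\<bar> + (\<Sum>i=1..<n. \<bar>E i (x + y) - E i x\<bar>)"
    by (intro order_trans[OF abs_triangle_ineq] add_mono sum_abs order_refl)
  also have "(\<Sum>i=1..<n. \<bar>E i (x + y) - E i x\<bar>) \<le> (\<Sum>i=1..N. \<bar>E i (x + y) - E i x\<bar>)"
    using assms by (intro sum_mono2) auto
  finally show ?thesis by (simp add: kernel_modulus_def)
qed

lemma sum_kernel_modulus:
  fixes Y :: real and y :: int
  assumes "2 \<le> Y" "\<bar>real_of_int y\<bar> \<le> Y" "finite X" "\<And>x. x \<in> X \<Longrightarrow> 2 * Y \<le> \<bar>real_of_int x\<bar>"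
  shows "(\<Sum>x\<in>X. kernel_modulus N y x) \<le> 386 * shift_const + 2"
proof -
  have "(\<Sum>x\<in>X. \<bar>K 1 (x + y) - K 1 x\<bar>) \<le> (\<Sum>x\<in>X. K 1 (x + y)) + (\<Sum>x\<in>X. K 1 x)"
    unfolding sum.distrib[symmetric] by (intro sum_mono) (simp add: abs_le_iff)
  also have "(\<Sum>x\<in>X. K 1 (x + y)) = (\<Sum>x\<in>(\<lambda>x. x + y) ` X. K 1 x)"
    by (subst sum.reindex) (auto simp: inj_on_def)
  also have "\<dots> \<le> 1" using assms by (intro sum_K_le) auto
  also have "(\<Sum>x\<in>X. K 1 x) \<le> 1" using assms by (intro sum_K_le) auto
  finally show ?thesis
    using sum_increments_shift[OF assms, of N] by (simp add: kernel_modulus_def sum.distrib)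
qed

text \<open>
  The Fourier transform has modulus less than 1 off the integers, so dominated convergence applies.
\<close>

lemma K_tendsto_0: "(\<lambda>n. K n x) \<longlonglongrightarrow> 0"
proof -
  let ?I = "{- 1/2..1/2 :: real}"
  define g where "g t = (if t = 0 then 1 else (0::complex))" for t :: real
  have F: "((\<lambda>t. \<theta> t ^ n * cnj (chi x t)) has_integral of_real (K n x)) ?I" for n
    using fourier_inversion[of "conv_pmf \<mu> n" 0 x] by (simp add: fourier_conv_pmf K_def)
  have "(\<lambda>n. integral ?I (\<lambda>t. \<theta> t ^ n * cnj (chi x t))) \<longlonglongrightarrow> integral ?I g"
  proof (rule dominated_convergence(2))
    show "(\<lambda>t. \<theta> t ^ n * cnj (chi x t)) integrable_on ?I" for n using F by blast
    show "(\<lambda>_. 1 :: real) integrable_on ?I" by (rule integrable_const_ivl)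
    show "norm (\<theta> t ^ n * cnj (chi x t)) \<le> 1" for t n
      by (simp add: norm_mult norm_power power_le_one norm_fourier_le_1)
    fix t assume t: "t \<in> ?I"
    show "(\<lambda>n. \<theta> t ^ n * cnj (chi x t)) \<longlonglongrightarrow> g t"
    proof (cases "t = 0")
      case False
      have "0 < u \<bar>t\<bar>" using False t by (intro defect_pos) auto
      hence "0 < u t / B" using B by simp
      hence "cmod (\<theta> t) < 1" using cmod_le_defect[of t] by linarith
      hence "(\<lambda>n. \<theta> t ^ n) \<longlonglongrightarrow> 0" by (rule LIMSEQ_power_zero)
      hence "(\<lambda>n. \<theta> t ^ n * cnj (chi x t)) \<longlonglongrightarrow> 0 * cnj (chi x t)" by (rule tendsto_mult[OF _ tendsto_const])
      thus ?thesis using False by (simp add: g_def)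
    qed (simp add: g_def)
  qed
  moreover have "(g has_integral 0) ?I"
    by (rule has_integral_spike_finite[of "{0}" _ _ "\<lambda>_. 0"]) (auto simp: g_def)
  hence "integral ?I g = 0" by (rule integral_unique)
  moreover have "integral ?I (\<lambda>t. \<theta> t ^ n * cnj (chi x t)) = of_real (K n x)" for n
    using F by (rule integral_unique)
  ultimately have "(\<lambda>n. complex_of_real (K n x)) \<longlonglongrightarrow> complex_of_real 0" by simp
  thus ?thesis by (simp only: tendsto_of_real_iff)
qed

text \<open>
  Since \<open>K m (x + y) - K m x\<close> tends to 0 for every \<open>x\<close>, the norm of the difference at time \<open>n\<close> is at most
  the sum over \<open>i \<ge> n\<close> of the norms of its increments, the tail of a convergent series.
\<close>

lemma shift_invariance_l1:
  assumes "0 < \<epsilon>"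
  shows "\<exists>n0. \<forall>n\<ge>n0. \<forall>X. finite X \<longrightarrow> (\<Sum>x\<in>X. \<bar>K n (x + y) - K n x\<bar>) \<le> \<epsilon>"
proof -
  define Y where "Y = max 2 \<bar>real_of_int y\<bar>"
  define v where "v = u (1 / Y)"
  have Y: "2 \<le> Y" "\<bar>real_of_int y\<bar> \<le> Y" by (auto simp: Y_def)
  have v: "0 < v" unfolding v_def using Y by (intro defect_pos) auto
  define b where "b n = shift_const * v powr (- 1/128) * real n powr (- 1 - 1/128)" for n :: nat
  have summ: "summable b"
    unfolding b_def by (intro summable_mult) (simp add: summable_real_powr_iff)
  then obtain n1 where n1: "\<And>m n. n1 \<le> m \<Longrightarrow> norm (sum b {m..<n}) < \<epsilon>"
    using assms unfolding summable_Cauchy by blast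
  obtain n2 :: nat where n2: "1 / v < real n2" using reals_Archimedean2 by blast
  show ?thesis
  proof (intro exI[of _ "max 1 (max n1 n2)"] allI impI)
    fix n and X :: "int set" assume n: "max 1 (max n1 n2) \<le> n" and X: "finite X"
    have Eb: "(\<Sum>x\<in>X. \<bar>E i (x + y) - E i x\<bar>) \<le> b i" if "n \<le> i" for i
    proof -
      have i: "0 < i" using that n by simp
      have "1 / v \<le> real i" using n2 n that by linarith
      hence "1 \<le> real i * v" using v by (simp add: field_simps)
      hence "(\<Sum>x\<in>X. \<bar>E i (x + y) - E i x\<bar>) \<le> shift_const / real i * (real i * v) powr (- 1/128)"
        unfolding v_def by (intro increments_shift_large[OF Y(1) i _ Y(2) X])
      also have "\<dots> = b i"
      proof -
        have "real i powr (- 1 - 1/128) = real i powr (- 1) * real i powr (- 1/128)"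
          unfolding powr_add[symmetric] by simp
        also have "real i powr (- 1) = 1 / real i"
          using i by (simp add: powr_minus divide_inverse)
        finally have e: "real i powr (- 1 - 1/128) = 1 / real i * real i powr (- 1/128)" .
        show ?thesis
          unfolding b_def e powr_mult by simp
      qed
      finally show ?thesis .
    qed
    have le: "(\<Sum>x\<in>X. \<bar>K n (x + y) - K n x\<bar>) \<le> (\<Sum>x\<in>X. \<bar>K m (x + y) - K m x\<bar>) + \<epsilon>" if "n \<le> m" for m
    proof -
      have "\<bar>K n (x + y) - K n x\<bar> \<le> \<bar>K m (x + y) - K m x\<bar> + (\<Sum>i=n..<m. \<bar>E i (x + y) - E i x\<bar>)" for x
      proof -
        have "K n (x + y) - K n x = (K m (x + y) - K m x) - (\<Sum>i=n..<m. E i (x + y) - E i x)"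
          using K_increment[OF that] by (simp add: sum_subtractf)
        also have "\<bar>\<dots>\<bar> \<le> \<bar>K m (x + y) - K m x\<bar> + (\<Sum>i=n..<m. \<bar>E i (x + y) - E i x\<bar>)"
          by (intro order_trans[OF abs_triangle_ineq4] add_mono sum_abs order_refl)
        finally show ?thesis .
      qed
      hence "(\<Sum>x\<in>X. \<bar>K n (x + y) - K n x\<bar>) \<le>
          (\<Sum>x\<in>X. \<bar>K m (x + y) - K m x\<bar> + (\<Sum>i=n..<m. \<bar>E i (x + y) - E i x\<bar>))"
        by (intro sum_mono)
      also have "\<dots> = (\<Sum>x\<in>X. \<bar>K m (x + y) - K m x\<bar>) + (\<Sum>i=n..<m. \<Sum>x\<in>X. \<bar>E i (x + y) - E i x\<bar>)"
        by (simp add: sum.distrib sum.swap[of _ X])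
      also have "(\<Sum>i=n..<m. \<Sum>x\<in>X. \<bar>E i (x + y) - E i x\<bar>) \<le> (\<Sum>i=n..<m. b i)"
        by (intro sum_mono Eb) auto
      also have "(\<Sum>i=n..<m. b i) \<le> \<epsilon>"
        using n1[of n m] n by auto
      finally show ?thesis by simp
    qed
    \<comment> \<open>Pointwise convergence suffices to let \<open>m\<close> tend to infinity, as \<open>X\<close> is finite.\<close>
    have "(\<lambda>m. (\<Sum>x\<in>X. \<bar>K m (x + y) - K m x\<bar>) + \<epsilon>) \<longlonglongrightarrow> (\<Sum>x\<in>X. \<bar>0 - 0\<bar>) + \<epsilon>"
      by (intro tendsto_intros K_tendsto_0)
    hence "(\<Sum>x\<in>X. \<bar>K n (x + y) - K n x\<bar>) \<le> (\<Sum>x\<in>X. \<bar>0 - 0\<bar>) + \<epsilon>"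
      by (rule tendsto_lowerbound) (auto intro!: eventually_sequentiallyI[of n] le)
    thus "(\<Sum>x\<in>X. \<bar>K n (x + y) - K n x\<bar>) \<le> \<epsilon>" by simp
  qed
qed

end

section \<open>A weak type inequality on the integers\<close>

text \<open>
  The function \<open>V N y\<close> stands for any majorant of the supremum over \<open>1 \<le> n \<le> N\<close>; what matters is that the
  bound \<open>A\<close> is the same for all \<open>N\<close>.
\<close>

locale hormander_kernels =
  fixes k :: "nat \<Rightarrow> int \<Rightarrow> real" and V :: "nat \<Rightarrow> int \<Rightarrow> int \<Rightarrow> real" and A :: real
  assumes k_nonneg [simp]: "0 \<le> k n x"
    and k_mass: "finite X \<Longrightarrow> (\<Sum>x\<in>X. k n x) \<le> 1"
    and k_modulus: "1 \<le> n \<Longrightarrow> n \<le> N \<Longrightarrow> \<bar>k n (x + y) - k n x\<bar> \<le> V N y x"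
    and hormander: "2 \<le> Y \<Longrightarrow> \<bar>real_of_int y\<bar> \<le> Y \<Longrightarrow> finite X \<Longrightarrow>
      (\<And>x. x \<in> X \<Longrightarrow> 2 * Y \<le> \<bar>real_of_int x\<bar>) \<Longrightarrow> (\<Sum>x\<in>X. V N y x) \<le> A"

lemma (in hormander_kernels) A_nonneg: "0 \<le> A"
  using hormander[of 2 0 "{}"] by simp

text \<open>
  The pair \<open>(m, q)\<close> encodes the dyadic interval of length \<open>2\<^sup>m\<close> that starts at \<open>q 2\<^sup>m\<close>.
\<close>

definition dyadic :: "nat \<times> int \<Rightarrow> int set" where
  "dyadic Q = {z. z div 2 ^ fst Q = snd Q}"

lemma dyadic_iff: "z \<in> dyadic (m, q) \<longleftrightarrow> z div 2 ^ m = q"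
  by (simp add: dyadic_def)

lemma dyadic_eq: "dyadic (m, q) = {q * 2 ^ m..<(q + 1) * 2 ^ m}"
proof -
  have p: "(0::int) < 2 ^ m" by simp
  have "z div 2 ^ m = q \<longleftrightarrow> q * 2 ^ m \<le> z \<and> z < (q + 1) * 2 ^ m" for z :: int
  proof
    assume q: "z div 2 ^ m = q"
    define d r :: int where "d = 2 ^ m" and "r = z mod 2 ^ m"
    have "z = q * d + r"
      unfolding d_def r_def q[symmetric] by (rule div_mult_mod_eq[symmetric])
    moreover have "0 \<le> r" "r < d" by (simp_all add: d_def r_def)
    ultimately have "q * d \<le> z \<and> z < q * d + d" by linarith
    thus "q * 2 ^ m \<le> z \<and> z < (q + 1) * 2 ^ m"
      by (simp add: d_def distrib_right)
  next
    define d :: int where "d = 2 ^ m"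
    assume "q * 2 ^ m \<le> z \<and> z < (q + 1) * 2 ^ m"
    hence "q * d \<le> z" "z < q * d + d" by (simp_all add: d_def distrib_right)
    hence "z div d = q"
      by (intro int_div_pos_eq[of z d q "z - q * d"]) (simp_all add: mult.commute)
    thus "z div 2 ^ m = q" by (simp add: d_def)
  qed
  note eq = this
  show ?thesis
    by (rule Set.set_eqI) (simp only: dyadic_def fst_conv snd_conv mem_Collect_eq atLeastLessThan_iff eq)
qed

lemma finite_dyadic [simp]: "finite (dyadic Q)"
  by (cases Q) (simp add: dyadic_eq)

lemma card_dyadic: "card (dyadic Q) = 2 ^ fst Q"
  by (cases Q) (simp add: dyadic_eq distrib_right nat_power_eq)

lemma dyadic_ancestor: "z \<in> dyadic (m, q) \<Longrightarrow> m \<le> m' \<Longrightarrow> z \<in> dyadic (m', q div 2 ^ (m' - m))"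
  using div_mult2_eq'[of z "2 ^ m" "2 ^ (m' - m)"]
  by (auto simp: dyadic_def zdiv_zmult2_eq[symmetric] power_add[symmetric])

text \<open>
  Take the maximal dyadic intervals on which the average of \<open>\<phi>\<close> exceeds \<open>\<kappa>\<close>.  They exist because large
  intervals have small averages, and the average over the parent is at most \<open>\<kappa>\<close>, which gives
  the upper bound \<open>2 \<kappa>\<close>.
\<close>

lemma calderon_zygmund_cubes:
  fixes \<phi> :: "int \<Rightarrow> real"
  assumes S: "finite S" and \<phi>: "\<And>y. 0 \<le> \<phi> y" and lam: "0 < \<kappa>"
  obtains \<Q> :: "(nat \<times> int) set" where "finite \<Q>"
    "\<forall>Q\<in>\<Q>. \<forall>Q'\<in>\<Q>. Q \<noteq> Q' \<longrightarrow> dyadic Q \<inter> dyadic Q' = {}"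
    "\<forall>Q\<in>\<Q>. \<kappa> * 2 ^ fst Q \<le> sum \<phi> (S \<inter> dyadic Q)"
    "\<forall>Q\<in>\<Q>. sum \<phi> (S \<inter> dyadic Q) \<le> 2 * \<kappa> * 2 ^ fst Q"
    "\<forall>y\<in>S - (\<Union>Q\<in>\<Q>. dyadic Q). \<phi> y \<le> \<kappa>"
proof -
  define mass where "mass Q = sum \<phi> (S \<inter> dyadic Q)" for Q
  define heavy where "heavy m q \<longleftrightarrow> \<kappa> * 2 ^ m < mass (m, q)" for m q
  define \<Q> where "\<Q> = {(m, q). heavy m q \<and> (\<forall>m'>m. \<not> heavy m' (q div 2 ^ (m' - m)))}"
  obtain m0 where m0: "sum \<phi> S / \<kappa> < 2 ^ m0" using real_arch_pow[of 2 "sum \<phi> S / \<kappa>"] by auto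
  have small: "m \<le> m0" if "heavy m q" for m q
  proof (rule ccontr)
    assume "\<not> m \<le> m0"
    hence "(2::real) ^ m0 \<le> 2 ^ m" by (intro power_increasing) auto
    with m0 lam have "sum \<phi> S < \<kappa> * 2 ^ m"
      by (metis mult.commute order_less_le_trans pos_divide_less_eq)
    moreover have "mass (m, q) \<le> sum \<phi> S"
      unfolding mass_def using S \<phi> by (intro sum_mono2) auto
    ultimately show False using that by (simp add: heavy_def)
  qed
  have meets: "\<exists>y\<in>S. q = y div 2 ^ m" if "heavy m q" for m q
  proof (rule ccontr)
    assume "\<not> (\<exists>y\<in>S. q = y div 2 ^ m)"
    hence "S \<inter> dyadic (m, q) = {}" by (auto simp: dyadic_def)
    hence "mass (m, q) = 0" by (simp add: mass_def)
    moreover have "0 \<le> \<kappa> * 2 ^ m" using lam by simp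
    ultimately show False using that by (simp add: heavy_def)
  qed
  show thesis
  proof (rule that[of \<Q>])
    have "\<Q> \<subseteq> (\<lambda>(m, y). (m, y div 2 ^ m)) ` ({..m0} \<times> S)"
      unfolding \<Q>_def using small meets by force
    thus "finite \<Q>" by (rule finite_subset) (use S in auto)
  next
    have "dyadic Q \<inter> dyadic Q' = {}" if Q: "Q \<in> \<Q>" "Q' \<in> \<Q>" "Q \<noteq> Q'" for Q Q'
    proof (rule ccontr)
      assume "dyadic Q \<inter> dyadic Q' \<noteq> {}"
      then obtain z where z: "z \<in> dyadic Q" "z \<in> dyadic Q'" by blast
      have le: "m' \<le> m" if "(m, q) \<in> \<Q>" "(m', q') \<in> \<Q>" "z \<in> dyadic (m, q)" "z \<in> dyadic (m', q')" for m q m' q'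
      proof (rule ccontr)
        assume "\<not> m' \<le> m"
        hence mm: "m < m'" by simp
        have "z \<in> dyadic (m', q div 2 ^ (m' - m))" using that mm by (intro dyadic_ancestor) auto
        hence "q' = q div 2 ^ (m' - m)" using that(4) unfolding dyadic_iff by blast
        thus False using that mm by (auto simp: \<Q>_def)
      qed
      obtain m q m' q' where QQ: "Q = (m, q)" "Q' = (m', q')" by (metis surj_pair)
      have "m = m'" using le[of m q m' q'] le[of m' q' m q] Q z QQ by auto
      moreover from this have "q = q'" using z unfolding QQ dyadic_iff by blast
      ultimately show False using Q QQ by simp
    qed
    thus "\<forall>Q\<in>\<Q>. \<forall>Q'\<in>\<Q>. Q \<noteq> Q' \<longrightarrow> dyadic Q \<inter> dyadic Q' = {}" by blast
  next
    show "\<forall>Q\<in>\<Q>. \<kappa> * 2 ^ fst Q \<le> sum \<phi> (S \<inter> dyadic Q)"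
      by (auto simp: \<Q>_def heavy_def mass_def)
  next
    show "\<forall>Q\<in>\<Q>. sum \<phi> (S \<inter> dyadic Q) \<le> 2 * \<kappa> * 2 ^ fst Q"
    proof
      fix Q assume Q: "Q \<in> \<Q>"
      obtain m q where mq: "Q = (m, q)" by (metis surj_pair)
      have "dyadic (m, q) \<subseteq> dyadic (Suc m, q div 2)"
        using dyadic_ancestor[of _ m q "Suc m"] by auto
      hence "mass (m, q) \<le> mass (Suc m, q div 2)"
        unfolding mass_def using S \<phi> by (intro sum_mono2) auto
      moreover have "\<not> heavy (Suc m) (q div 2 ^ (Suc m - m))"
        using Q unfolding mq \<Q>_def by blast
      hence "mass (Suc m, q div 2) \<le> 2 * \<kappa> * 2 ^ m" by (simp add: heavy_def mult_ac)
      ultimately show "sum \<phi> (S \<inter> dyadic Q) \<le> 2 * \<kappa> * 2 ^ fst Q"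
        by (simp add: mq mass_def)
    qed
  next
    have "\<phi> y \<le> \<kappa>" if y: "y \<in> S" "y \<notin> (\<Union>Q\<in>\<Q>. dyadic Q)" for y
    proof (rule ccontr)
      assume "\<not> \<phi> y \<le> \<kappa>"
      moreover have "S \<inter> dyadic (0, y) = {y}" using y by (auto simp: dyadic_def)
      ultimately have "heavy 0 (y div 2 ^ 0)" by (simp add: heavy_def mass_def)
      then obtain m where m: "heavy m (y div 2 ^ m)" "\<And>m'. heavy m' (y div 2 ^ m') \<Longrightarrow> m' \<le> m"
        using GreatestI_nat[of "\<lambda>m. heavy m (y div 2 ^ m)" 0 m0]
          Greatest_le_nat[of "\<lambda>m. heavy m (y div 2 ^ m)" _ m0] small by blast
      have "y div 2 ^ m div 2 ^ (m' - m) = y div 2 ^ m'" if "m < m'" for m'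
        using dyadic_ancestor[of y m "y div 2 ^ m" m'] that unfolding dyadic_iff by simp
      hence "(m, y div 2 ^ m) \<in> \<Q>"
        unfolding \<Q>_def using m by (auto simp: not_le[symmetric])
      moreover have "y \<in> dyadic (m, y div 2 ^ m)" by (simp only: dyadic_iff)
      ultimately show False using y by blast
    qed
    thus "\<forall>y\<in>S - (\<Union>Q\<in>\<Q>. dyadic Q). \<phi> y \<le> \<kappa>" by blast
  qed
qed

context hormander_kernels
begin

lemma k_mass_shift: "finite W \<Longrightarrow> (\<Sum>z\<in>W. k n (z - x)) \<le> 1"
proof -
  assume "finite W"
  have "(\<Sum>z\<in>W. k n (z - x)) = (\<Sum>z\<in>(\<lambda>z. z - x) ` W. k n z)"
    by (subst sum.reindex) (auto simp: inj_on_def)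
  also have "\<dots> \<le> 1" using \<open>finite W\<close> by (intro k_mass) auto
  finally show ?thesis .
qed

text \<open>
  On each Calderon-Zygmund interval \<open>Q\<close> the value \<open>k n (y - x)\<close> is replaced by its average over \<open>y \<in> Q\<close>.
  The replaced sums amount to averaging a function bounded by \<open>2 \<kappa>\<close> against a probability, so an excess over
  \<open>3 \<kappa>\<close> forces the replacement error \<open>err x\<close> to exceed \<open>\<kappa>\<close>.  Off a fixed enlargement of the
  intervals the error is summable by the Hormander condition, and the enlargement has size at
  most a multiple of \<open>sum \<phi> S / \<kappa>\<close>.
\<close>

theorem weak_type_integers:
  fixes \<phi> :: "int \<Rightarrow> real"
  assumes S: "finite S" and \<phi>: "\<And>y. 0 \<le> \<phi> y" and lam: "0 < \<kappa>" and X: "finite X"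
  shows "\<kappa> * card {x \<in> X. \<exists>n\<in>{1..N}. 3 * \<kappa> < (\<Sum>y\<in>S. k n (y - x) * \<phi> y)} \<le> (10 + A) * sum \<phi> S"
proof -
  obtain \<Q> :: "(nat \<times> int) set" where fin: "finite \<Q>"
    and disj: "\<forall>Q\<in>\<Q>. \<forall>Q'\<in>\<Q>. Q \<noteq> Q' \<longrightarrow> dyadic Q \<inter> dyadic Q' = {}"
    and heavy: "\<forall>Q\<in>\<Q>. \<kappa> * 2 ^ fst Q \<le> sum \<phi> (S \<inter> dyadic Q)"
    and light: "\<forall>Q\<in>\<Q>. sum \<phi> (S \<inter> dyadic Q) \<le> 2 * \<kappa> * 2 ^ fst Q"
    and good: "\<forall>y\<in>S - (\<Union>Q\<in>\<Q>. dyadic Q). \<phi> y \<le> \<kappa>"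
    by (rule calderon_zygmund_cubes[OF S \<phi> lam])
  define U where "U = (\<Union>Q\<in>\<Q>. dyadic Q)"
  define err where "err x = (\<Sum>Q\<in>\<Q>. 1 / 2 ^ fst Q *
      (\<Sum>y\<in>S \<inter> dyadic Q. \<Sum>z\<in>dyadic Q. \<phi> y * V N (y - z) (z - x)))" for x
  have finU: "finite U" unfolding U_def using fin by auto
  have sumU: "(\<Sum>Q\<in>\<Q>. sum g (W \<inter> dyadic Q)) = sum g (W \<inter> U)" if "finite W" for g :: "int \<Rightarrow> real" and W
  proof -
    have "W \<inter> U = (\<Union>Q\<in>\<Q>. W \<inter> dyadic Q)" by (auto simp: U_def)
    moreover have "sum g (\<Union>Q\<in>\<Q>. W \<inter> dyadic Q) = (\<Sum>Q\<in>\<Q>. sum g (W \<inter> dyadic Q))"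
      by (rule sum.UNION_disjoint[OF fin]) (use that disj in blast)+
    ultimately show ?thesis by (simp only:)
  qed
  have massU: "(\<Sum>Q\<in>\<Q>. sum \<phi> (S \<inter> dyadic Q)) \<le> sum \<phi> S"
    unfolding sumU[OF S] using S \<phi> by (intro sum_mono2) auto
  have pointwise: "(\<Sum>y\<in>S. k n (y - x) * \<phi> y) \<le> 2 * \<kappa> + err x" if n: "n \<in> {1..N}" for n x
  proof -
    have cube: "(\<Sum>y\<in>S \<inter> dyadic Q. k n (y - x) * \<phi> y)
        \<le> 2 * \<kappa> * (\<Sum>z\<in>dyadic Q. k n (z - x)) + 1 / 2 ^ fst Q *
          (\<Sum>y\<in>S \<inter> dyadic Q. \<Sum>z\<in>dyadic Q. \<phi> y * V N (y - z) (z - x))" if Q: "Q \<in> \<Q>" for Q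
    proof -
      define N' :: real where "N' = 2 ^ fst Q"
      have N': "0 < N'" by (simp add: N'_def)
      have "N' * (k n (y - x) * \<phi> y) \<le> \<phi> y * (\<Sum>z\<in>dyadic Q. k n (z - x))
          + (\<Sum>z\<in>dyadic Q. \<phi> y * V N (y - z) (z - x))" for y
      proof -
        have "k n (y - x) \<le> k n (z - x) + V N (y - z) (z - x)" for z
          using k_modulus[of n N "z - x" "y - z"] n by simp
        hence "(\<Sum>z\<in>dyadic Q. k n (y - x)) \<le> (\<Sum>z\<in>dyadic Q. k n (z - x) + V N (y - z) (z - x))"
          by (rule sum_mono)
        hence "N' * k n (y - x) \<le> (\<Sum>z\<in>dyadic Q. k n (z - x) + V N (y - z) (z - x))"
          by (simp add: card_dyadic N'_def)
        from mult_left_mono[OF this \<phi>[of y]] show ?thesis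
          by (simp add: sum.distrib sum_distrib_left distrib_left mult_ac)
      qed
      hence "(\<Sum>y\<in>S \<inter> dyadic Q. N' * (k n (y - x) * \<phi> y)) \<le> (\<Sum>y\<in>S \<inter> dyadic Q.
          \<phi> y * (\<Sum>z\<in>dyadic Q. k n (z - x)) + (\<Sum>z\<in>dyadic Q. \<phi> y * V N (y - z) (z - x)))"
        by (rule sum_mono)
      hence "N' * (\<Sum>y\<in>S \<inter> dyadic Q. k n (y - x) * \<phi> y)
          \<le> sum \<phi> (S \<inter> dyadic Q) * (\<Sum>z\<in>dyadic Q. k n (z - x))
            + (\<Sum>y\<in>S \<inter> dyadic Q. \<Sum>z\<in>dyadic Q. \<phi> y * V N (y - z) (z - x))"
        by (simp only: sum_distrib_left[symmetric] sum_distrib_right[symmetric] sum.distrib)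
      also have "sum \<phi> (S \<inter> dyadic Q) * (\<Sum>z\<in>dyadic Q. k n (z - x))
          \<le> 2 * \<kappa> * N' * (\<Sum>z\<in>dyadic Q. k n (z - x))"
        unfolding N'_def using light Q by (intro mult_right_mono sum_nonneg) auto
      finally show ?thesis
        unfolding N'_def[symmetric] using N' by (simp add: field_simps)
    qed
    have "(\<Sum>y\<in>S. k n (y - x) * \<phi> y) = (\<Sum>y\<in>S - U. k n (y - x) * \<phi> y) + (\<Sum>y\<in>S \<inter> U. k n (y - x) * \<phi> y)"
      using sum.Int_Diff[OF S, of _ U] by (simp add: add.commute)
    also have "(\<Sum>y\<in>S - U. k n (y - x) * \<phi> y) \<le> (\<Sum>y\<in>S - U. k n (y - x) * (2 * \<kappa>))"
    proof (intro sum_mono mult_left_mono)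
      show "\<phi> y \<le> 2 * \<kappa>" if "y \<in> S - U" for y
      proof -
        have "\<phi> y \<le> \<kappa>" using good that unfolding U_def by blast
        thus ?thesis using lam by linarith
      qed
    qed simp
    also have "(\<Sum>y\<in>S \<inter> U. k n (y - x) * \<phi> y) = (\<Sum>Q\<in>\<Q>. \<Sum>y\<in>S \<inter> dyadic Q. k n (y - x) * \<phi> y)"
      by (rule sumU[OF S, symmetric])
    also have "\<dots> \<le> (\<Sum>Q\<in>\<Q>. 2 * \<kappa> * (\<Sum>z\<in>dyadic Q. k n (z - x)) + 1 / 2 ^ fst Q *
          (\<Sum>y\<in>S \<inter> dyadic Q. \<Sum>z\<in>dyadic Q. \<phi> y * V N (y - z) (z - x)))"
      by (intro sum_mono cube)
    also have "\<dots> = 2 * \<kappa> * (\<Sum>Q\<in>\<Q>. \<Sum>z\<in>U \<inter> dyadic Q. k n (z - x)) + err x"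
    proof -
      have "U \<inter> dyadic Q = dyadic Q" if "Q \<in> \<Q>" for Q using that by (auto simp: U_def)
      thus ?thesis by (simp add: err_def sum.distrib sum_distrib_left)
    qed
    also have "(\<Sum>Q\<in>\<Q>. \<Sum>z\<in>U \<inter> dyadic Q. k n (z - x)) = (\<Sum>z\<in>U. k n (z - x))"
      using sumU[OF finU, of "\<lambda>z. k n (z - x)"] by simp
    also have "(\<Sum>y\<in>S - U. k n (y - x) * (2 * \<kappa>)) + (2 * \<kappa> * (\<Sum>z\<in>U. k n (z - x)) + err x)
        = 2 * \<kappa> * ((\<Sum>z\<in>S - U. k n (z - x)) + (\<Sum>z\<in>U. k n (z - x))) + err x"
      unfolding sum_distrib_right[symmetric] by (simp add: distrib_left)
    finally have "(\<Sum>y\<in>S. k n (y - x) * \<phi> y)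
        \<le> 2 * \<kappa> * ((\<Sum>z\<in>S - U. k n (z - x)) + (\<Sum>z\<in>U. k n (z - x))) + err x"
      by simp
    also have "(\<Sum>z\<in>S - U. k n (z - x)) + (\<Sum>z\<in>U. k n (z - x)) = (\<Sum>z\<in>(S - U) \<union> U. k n (z - x))"
      using S finU by (intro sum.union_disjoint[symmetric]) auto
    also have "2 * \<kappa> * (\<Sum>z\<in>(S - U) \<union> U. k n (z - x)) + err x \<le> 2 * \<kappa> * 1 + err x"
      using S finU lam by (intro add_mono mult_left_mono k_mass_shift) auto
    finally show ?thesis by simp
  qed
  \<comment> \<open>The enlarged intervals.  A point outside has distance at least \<open>4 * 2\<^sup>m\<close> from all of \<open>Q\<close>, which is
    twice the scale \<open>Y = 2 * 2\<^sup>m\<close> used below; the factor 2 in \<open>Y\<close> ensures \<open>2 \<le> Y\<close> for single points.\<close>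
  define far where "far Q = {x. \<bar>x - snd Q * 2 ^ fst Q\<bar> < 5 * 2 ^ fst Q}" for Q :: "nat \<times> int"
  have far: "finite (far Q)" "real (card (far Q)) \<le> 10 * 2 ^ fst Q" for Q
  proof -
    define c d :: int where "c = snd Q * 2 ^ fst Q" and "d = 2 ^ fst Q"
    have "far Q = {c - 5 * d<..<c + 5 * d}"
      by (auto simp: far_def c_def d_def abs_less_iff)
    moreover have "real (card {c - 5 * d<..<c + 5 * d}) \<le> 10 * real_of_int d"
      unfolding d_def by simp
    ultimately show "finite (far Q)" "real (card (far Q)) \<le> 10 * 2 ^ fst Q"
      by (auto simp: d_def)
  qed
  define X2 where "X2 = {x \<in> X. x \<notin> (\<Union>Q\<in>\<Q>. far Q) \<and> \<kappa> < err x}"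
  have X2: "finite X2" unfolding X2_def using X by auto
  have "{x \<in> X. \<exists>n\<in>{1..N}. 3 * \<kappa> < (\<Sum>y\<in>S. k n (y - x) * \<phi> y)} \<subseteq> (\<Union>Q\<in>\<Q>. far Q) \<union> X2"
  proof
    fix x assume x: "x \<in> {x \<in> X. \<exists>n\<in>{1..N}. 3 * \<kappa> < (\<Sum>y\<in>S. k n (y - x) * \<phi> y)}"
    then obtain n where n: "n \<in> {1..N}" "3 * \<kappa> < (\<Sum>y\<in>S. k n (y - x) * \<phi> y)" by blast
    have "\<kappa> < err x" using pointwise[OF n(1), of x] n(2) by linarith
    thus "x \<in> (\<Union>Q\<in>\<Q>. far Q) \<union> X2" using x by (auto simp: X2_def)
  qed
  hence "card {x \<in> X. \<exists>n\<in>{1..N}. 3 * \<kappa> < (\<Sum>y\<in>S. k n (y - x) * \<phi> y)} \<le> card ((\<Union>Q\<in>\<Q>. far Q) \<union> X2)"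
    using far X2 fin by (intro card_mono) auto
  also have "\<dots> \<le> card (\<Union>Q\<in>\<Q>. far Q) + card X2" by (rule card_Un_le)
  also have "card (\<Union>Q\<in>\<Q>. far Q) \<le> (\<Sum>Q\<in>\<Q>. card (far Q))" by (rule card_UN_le[OF fin])
  finally have "real (card {x \<in> X. \<exists>n\<in>{1..N}. 3 * \<kappa> < (\<Sum>y\<in>S. k n (y - x) * \<phi> y)})
      \<le> (\<Sum>Q\<in>\<Q>. real (card (far Q))) + real (card X2)"
    by (simp flip: of_nat_sum of_nat_add)
  also have "(\<Sum>Q\<in>\<Q>. real (card (far Q))) \<le> (\<Sum>Q\<in>\<Q>. 10 * 2 ^ fst Q)"
    by (intro sum_mono far)
  finally have "\<kappa> * card {x \<in> X. \<exists>n\<in>{1..N}. 3 * \<kappa> < (\<Sum>y\<in>S. k n (y - x) * \<phi> y)}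
      \<le> \<kappa> * ((\<Sum>Q\<in>\<Q>. 10 * 2 ^ fst Q) + real (card X2))"
    using lam by (intro mult_left_mono) auto
  also have "\<dots> = 10 * (\<Sum>Q\<in>\<Q>. \<kappa> * 2 ^ fst Q) + (\<Sum>x\<in>X2. \<kappa>)"
    by (simp add: distrib_left sum_distrib_left mult_ac)
  also have "(\<Sum>Q\<in>\<Q>. \<kappa> * 2 ^ fst Q) \<le> (\<Sum>Q\<in>\<Q>. sum \<phi> (S \<inter> dyadic Q))"
    using heavy by (intro sum_mono) auto
  also have "\<dots> \<le> sum \<phi> S" by (rule massU)
  also have "(\<Sum>x\<in>X2. \<kappa>) \<le> (\<Sum>x\<in>X2. err x)"
    by (intro sum_mono) (auto simp: X2_def)
  also have "\<dots> = (\<Sum>Q\<in>\<Q>. 1 / 2 ^ fst Q *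
      (\<Sum>y\<in>S \<inter> dyadic Q. \<Sum>z\<in>dyadic Q. \<phi> y * (\<Sum>x\<in>X2. V N (y - z) (z - x))))"
    unfolding err_def by (simp add: sum_distrib_left sum.swap[of _ X2])
  also have "\<dots> \<le> (\<Sum>Q\<in>\<Q>. 1 / 2 ^ fst Q * (\<Sum>y\<in>S \<inter> dyadic Q. \<Sum>z\<in>dyadic Q. \<phi> y * A))"
  proof (intro sum_mono mult_left_mono \<phi>)
    fix Q y z assume Q: "Q \<in> \<Q>" and y: "y \<in> S \<inter> dyadic Q" and z: "z \<in> dyadic Q"
    define Y :: real where "Y = 2 * 2 ^ fst Q"
    obtain m q where mq: "Q = (m, q)" by (cases Q) blast
    have "y \<in> {q * 2 ^ m..<(q + 1) * 2 ^ m}" "z \<in> {q * 2 ^ m..<(q + 1) * 2 ^ m}"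
      using y z unfolding mq dyadic_eq by blast+
    hence yz: "q * 2 ^ m \<le> y" "y < q * 2 ^ m + 2 ^ m" "q * 2 ^ m \<le> z" "z < q * 2 ^ m + 2 ^ m"
      by (simp_all only: atLeastLessThan_iff distrib_right mult_1)
    have "(\<Sum>x\<in>X2. V N (y - z) (z - x)) = (\<Sum>x\<in>(\<lambda>x. z - x) ` X2. V N (y - z) x)"
      by (subst sum.reindex) (auto simp: inj_on_def)
    also have "\<dots> \<le> A"
    proof (rule hormander[of Y])
      show "2 \<le> Y" by (simp add: Y_def)
      have "\<bar>y - z\<bar> \<le> 2 * 2 ^ m" using yz by linarith
      hence "real_of_int \<bar>y - z\<bar> \<le> real_of_int (2 * 2 ^ m)" by (simp only: of_int_le_iff)
      thus "\<bar>real_of_int (y - z)\<bar> \<le> Y" by (simp add: Y_def mq)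
      show "finite ((\<lambda>x. z - x) ` X2)" using X2 by simp
      fix x assume "x \<in> (\<lambda>x. z - x) ` X2"
      then obtain x' where x': "x = z - x'" "x' \<in> X2" by blast
      have "x' \<notin> far Q" using x' Q by (auto simp: X2_def)
      hence "5 * 2 ^ m \<le> \<bar>x' - q * 2 ^ m\<bar>" by (simp add: far_def mq)
      hence "4 * 2 ^ m \<le> \<bar>x\<bar>" using x' yz by linarith
      hence "real_of_int (4 * 2 ^ m) \<le> real_of_int \<bar>x\<bar>" by (simp only: of_int_le_iff)
      thus "2 * Y \<le> \<bar>real_of_int x\<bar>" by (simp add: Y_def mq)
    qed
    finally show "(\<Sum>x\<in>X2. V N (y - z) (z - x)) \<le> A" .
  qed simp
  also have "\<dots> = A * (\<Sum>Q\<in>\<Q>. sum \<phi> (S \<inter> dyadic Q))"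
    by (simp add: card_dyadic sum_distrib_left sum_distrib_right mult_ac)
  also have "\<dots> \<le> A * sum \<phi> S"
    using A_nonneg by (intro mult_left_mono massU)
  finally show ?thesis by (simp add: distrib_right)
qed

end

section \<open>Iterates of an invertible measure preserving map\<close>

locale invertible_system = prob_space M for M :: "'a measure" +
  fixes T :: "'a \<Rightarrow> 'a"
  assumes inv: "invertible_measure_preserving M T"
begin

abbreviation \<tau> :: "int \<Rightarrow> 'a \<Rightarrow> 'a" where "\<tau> \<equiv> int_iterate M T"

lemma T_bij: "bij_betw T (space M) (space M)"
  and measurable_T: "T \<in> measurable M M"
  and measurable_T_inv: "inv_into (space M) T \<in> measurable M M"
  using inv by (auto simp: invertible_measure_preserving_def)

lemma T_inv_T: "x \<in> space M \<Longrightarrow> inv_into (space M) T (T x) = x"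
  and T_T_inv: "x \<in> space M \<Longrightarrow> T (inv_into (space M) T x) = x"
  using T_bij by (auto simp: bij_betw_def f_inv_into_f)

lemma measurable_iterate [measurable]: "\<tau> j \<in> measurable M M"
  unfolding int_iterate_def
  by (auto intro!: measurable_compose_n measurable_T measurable_T_inv)

lemma iterate_in_space: "x \<in> space M \<Longrightarrow> \<tau> j x \<in> space M"
  by (rule measurable_space[OF measurable_iterate])

lemma iterate_0 [simp]: "\<tau> 0 x = x"
  by (simp add: int_iterate_def)

lemma iterate_Suc:
  assumes "x \<in> space M"
  shows "\<tau> (j + 1) x = T (\<tau> j x)"
proof (cases "0 \<le> j")
  case True
  hence "nat (j + 1) = Suc (nat j)" by simp
  thus ?thesis using True by (simp add: int_iterate_def)
next
  case False
  define n where "n = nat (- (j + 1))"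
  have n: "nat (- j) = Suc n" using False by (simp add: n_def)
  have "\<tau> (j + 1) x = (inv_into (space M) T ^^ n) x"
    using False by (cases "j + 1 = 0") (auto simp: int_iterate_def n_def)
  moreover have "\<tau> j x = inv_into (space M) T ((inv_into (space M) T ^^ n) x)"
    using False n by (simp add: int_iterate_def)
  moreover have "(inv_into (space M) T ^^ n) x \<in> space M"
    using assms by (rule measurable_space[OF measurable_compose_n[OF measurable_T_inv]])
  ultimately show ?thesis by (simp add: T_T_inv)
qed

lemma iterate_pred: "x \<in> space M \<Longrightarrow> \<tau> (j - 1) x = inv_into (space M) T (\<tau> j x)"
  using iterate_Suc[of x "j - 1"] by (simp add: T_inv_T iterate_in_space)

lemma iterate_add:
  assumes x: "x \<in> space M"
  shows "\<tau> (i + j) x = \<tau> i (\<tau> j x)"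
proof (induction i rule: int_induct[where k = 0])
  case (step1 i)
  have "\<tau> (i + 1 + j) x = \<tau> ((i + j) + 1) x" by (simp add: add_ac)
  thus ?case using step1 by (simp only: iterate_Suc[OF x] iterate_Suc[OF iterate_in_space[OF x]])
next
  case (step2 i)
  have "\<tau> (i - 1 + j) x = \<tau> ((i + j) - 1) x" by (simp add: algebra_simps)
  thus ?case using step2 by (simp only: iterate_pred[OF x] iterate_pred[OF iterate_in_space[OF x]])
qed simp

lemma distr_T: "distr M M T = M"
proof (rule measure_eqI)
  fix A assume "A \<in> sets (distr M M T)"
  thus "emeasure (distr M M T) A = emeasure M A"
    using inv by (simp add: emeasure_distr measurable_T invertible_measure_preserving_def)
qed simp

lemma distr_T_inv: "distr M M (inv_into (space M) T) = M"
proof -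
  have "distr M M (inv_into (space M) T) = distr (distr M M T) M (inv_into (space M) T)"
    by (simp add: distr_T)
  also have "\<dots> = distr M M (inv_into (space M) T \<circ> T)"
    by (rule distr_distr[OF measurable_T_inv measurable_T])
  also have "\<dots> = distr M M (\<lambda>x. x)"
    by (intro distr_cong) (auto simp: T_inv_T)
  also have "\<dots> = M" by (rule distr_id)
  finally show ?thesis .
qed

lemma distr_iterate: "distr M M (\<tau> j) = M"
proof -
  have "distr M M (S ^^ n) = M" if S: "S \<in> measurable M M" "distr M M S = M" for S n
  proof (induction n)
    case 0
    thus ?case by (simp add: id_def distr_id)
  next
    case (Suc n)
    have "distr M M (S ^^ Suc n) = distr (distr M M (S ^^ n)) M S"
      by (subst distr_distr[OF S(1) measurable_compose_n[OF S(1)]]) simp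
    also have "\<dots> = M" by (simp only: Suc.IH S(2))
    finally show ?case .
  qed
  thus ?thesis
    using measurable_T measurable_T_inv distr_T distr_T_inv by (auto simp: int_iterate_def)
qed

lemma integral_iterate:
  fixes f :: "'a \<Rightarrow> 'b::{banach, second_countable_topology}"
  assumes "f \<in> borel_measurable M"
  shows "(\<integral>x. f (\<tau> j x) \<partial>M) = (\<integral>x. f x \<partial>M)"
  using integral_distr[OF measurable_iterate assms, of j] by (simp add: distr_iterate)

lemma integrable_iterate:
  fixes f :: "'a \<Rightarrow> 'b::{banach, second_countable_topology}"
  assumes "integrable M f"
  shows "integrable M (\<lambda>x. f (\<tau> j x))"
  using integrable_distr_eq[OF measurable_iterate borel_measurable_integrable[OF assms], of j] assms
  by (simp add: distr_iterate)

lemma integrable_bounded: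
  fixes f :: "'a \<Rightarrow> 'b::{banach, second_countable_topology}"
  assumes "f \<in> borel_measurable M" "\<And>x. x \<in> space M \<Longrightarrow> norm (f x) \<le> c"
  shows "integrable M f"
  using assms by (intro integrable_const_bound[where B = c]) auto

section \<open>Ergodic averages of bounded functions\<close>

definition cesaro :: "nat \<Rightarrow> ('a \<Rightarrow> complex) \<Rightarrow> 'a \<Rightarrow> complex" where
  "cesaro N f x = (\<Sum>i<N. f (\<tau> (int i) x)) / of_nat N"

lemma measurable_cesaro [measurable]: "f \<in> borel_measurable M \<Longrightarrow> cesaro N f \<in> borel_measurable M"
  unfolding cesaro_def
  by (intro borel_measurable_divide borel_measurable_sum borel_measurable_const
      measurable_compose[OF measurable_iterate])

lemma norm_cesaro_le:
  assumes "\<And>x. x \<in> space M \<Longrightarrow> cmod (f x) \<le> c" "x \<in> space M" "0 < N"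
  shows "cmod (cesaro N f x) \<le> c"
proof -
  have "cmod (\<Sum>i<N. f (\<tau> (int i) x)) \<le> (\<Sum>i<N. c)"
    using assms by (intro order_trans[OF norm_sum sum_mono]) (auto intro: iterate_in_space)
  thus ?thesis
    using assms(3) by (simp add: cesaro_def norm_divide divide_le_eq mult.commute)
qed

lemma cesaro_midpoint: "cesaro N (\<lambda>x. (p x + q x) / 2) x = (cesaro N p x + cesaro N q x) / 2"
  unfolding cesaro_def sum_divide_distrib[symmetric] sum.distrib add_divide_distrib[symmetric] by simp

lemma shifted_sum_le:
  fixes f :: "nat \<Rightarrow> complex"
  assumes "\<And>i. cmod (f i) \<le> c"
  shows "cmod ((\<Sum>i<L. f (i + j)) - (\<Sum>i<L. f i)) \<le> 2 * real j * c"
proof (induction j)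
  case (Suc j)
  have "(\<Sum>i<L. f (i + Suc j)) - (\<Sum>i<L. f (i + j)) = f (L + j) - f j"
    using sum_lessThan_telescope[of "\<lambda>i. f (i + j)" L] by (simp add: sum_subtractf)
  hence "cmod ((\<Sum>i<L. f (i + Suc j)) - (\<Sum>i<L. f (i + j))) \<le> c + c"
    using assms norm_triangle_ineq4 by (metis add_mono order_trans)
  with Suc have "cmod (((\<Sum>i<L. f (i + Suc j)) - (\<Sum>i<L. f (i + j))) + ((\<Sum>i<L. f (i + j)) - (\<Sum>i<L. f i)))
      \<le> (c + c) + 2 * real j * c"
    by (intro order_trans[OF norm_triangle_ineq add_mono]) auto
  thus ?case by (simp add: algebra_simps)
qed simp

text \<open>
  Averaging twice differs from averaging once only by boundary terms.
\<close>

lemma cesaro_cesaro: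
  assumes f: "\<And>x. x \<in> space M \<Longrightarrow> cmod (f x) \<le> c" and x: "x \<in> space M" and N: "0 < N" and L: "0 < L"
  shows "cmod (cesaro L (cesaro N f) x - cesaro L f x) \<le> 2 * real N * c / real L"
proof -
  define a where "a i = f (\<tau> (int i) x)" for i
  have c0: "0 \<le> c" using f[OF x] norm_ge_zero order_trans by blast
  have a: "cmod (a i) \<le> c" for i unfolding a_def using f iterate_in_space[OF x] by blast
  have shift: "f (\<tau> (int j) (\<tau> (int i) x)) = a (i + j)" for i j
    using iterate_add[OF x, of "int j" "int i"] by (simp add: a_def add.commute)
  have "cesaro L (cesaro N f) x = (\<Sum>i<L. (\<Sum>j<N. a (i + j)) / of_nat N) / of_nat L"
    by (simp add: cesaro_def shift)
  also have "\<dots> = (\<Sum>j<N. \<Sum>i<L. a (i + j)) / (of_nat N * of_nat L)"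
    by (simp add: sum_divide_distrib[symmetric] sum.swap[of _ "{..<N}"])
  finally have 1: "cesaro L (cesaro N f) x = (\<Sum>j<N. \<Sum>i<L. a (i + j)) / (of_nat N * of_nat L)" .
  have 2: "cesaro L f x = (\<Sum>j<N. \<Sum>i<L. a i) / (of_nat N * of_nat L)"
    using N by (simp add: cesaro_def a_def)
  have "cesaro L (cesaro N f) x - cesaro L f x
      = (\<Sum>j<N. (\<Sum>i<L. a (i + j)) - (\<Sum>i<L. a i)) / (of_nat N * of_nat L)"
    unfolding 1 2 by (simp only: sum_subtractf diff_divide_distrib)
  also have "cmod \<dots> \<le> (\<Sum>j<N. 2 * real N * c) / (real N * real L)"
    unfolding norm_divide norm_mult norm_of_nat
  proof (intro divide_right_mono order_trans[OF norm_sum sum_mono])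
    fix j assume "j \<in> {..<N}"
    hence "2 * real j * c \<le> 2 * real N * c" using c0 by (intro mult_right_mono) auto
    thus "cmod ((\<Sum>i<L. a (i + j)) - (\<Sum>i<L. a i)) \<le> 2 * real N * c"
      by (rule order_trans[OF shifted_sum_le[OF a]])
  qed simp
  also have "\<dots> = 2 * real N * c / real L" using N by simp
  finally show ?thesis .
qed

definition energy :: "('a \<Rightarrow> complex) \<Rightarrow> real" where
  "energy f = (\<integral>x. (cmod (f x))\<^sup>2 \<partial>M)"

lemma energy_nonneg: "0 \<le> energy f"
  unfolding energy_def by (intro Bochner_Integration.integral_nonneg) simp

lemma integrable_energy:
  assumes "f \<in> borel_measurable M" "\<And>x. x \<in> space M \<Longrightarrow> cmod (f x) \<le> c"
  shows "integrable M (\<lambda>x. (cmod (f x))\<^sup>2)"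
  by (rule integrable_bounded[where c = "c\<^sup>2"]) (use assms in \<open>auto intro: power_mono\<close>)

lemma energy_cesaro_le:
  assumes f: "f \<in> borel_measurable M" "\<And>x. x \<in> space M \<Longrightarrow> cmod (f x) \<le> c" and L: "0 < L"
  shows "energy (cesaro L f) \<le> energy f"
proof -
  have int: "integrable M (\<lambda>x. (cmod (f (\<tau> j x)))\<^sup>2)" for j
    using integrable_iterate[OF integrable_energy[OF f]] .
  have same: "(\<integral>x. (cmod (f (\<tau> j x)))\<^sup>2 \<partial>M) = energy f" for j
    unfolding energy_def using f by (intro integral_iterate) auto
  have "energy (cesaro L f) \<le> (\<integral>x. (\<Sum>i<L. (cmod (f (\<tau> (int i) x)))\<^sup>2) / real L \<partial>M)"
    unfolding energy_def
  proof (rule integral_mono)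
    show "integrable M (\<lambda>x. (cmod (cesaro L f x))\<^sup>2)"
      using f L by (intro integrable_energy[where c = c] norm_cesaro_le) auto
    show "integrable M (\<lambda>x. (\<Sum>i<L. (cmod (f (\<tau> (int i) x)))\<^sup>2) / real L)"
      by (intro integrable_divide Bochner_Integration.integrable_sum int)
    fix x
    have "(cmod (\<Sum>i<L. f (\<tau> (int i) x)))\<^sup>2 \<le> (\<Sum>i<L. cmod (f (\<tau> (int i) x)))\<^sup>2"
      by (intro power_mono norm_sum) auto
    also have "\<dots> \<le> (\<Sum>i<L. (cmod (f (\<tau> (int i) x)))\<^sup>2) * card {..<L}"
      by (rule sum_squared_le_sum_of_squares)
    finally have "(cmod (\<Sum>i<L. f (\<tau> (int i) x)))\<^sup>2 / (real L)\<^sup>2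
        \<le> (\<Sum>i<L. (cmod (f (\<tau> (int i) x)))\<^sup>2) * real L / (real L)\<^sup>2"
      by (intro divide_right_mono) auto
    thus "(cmod (cesaro L f x))\<^sup>2 \<le> (\<Sum>i<L. (cmod (f (\<tau> (int i) x)))\<^sup>2) / real L"
      using L by (simp add: cesaro_def norm_divide power_divide power2_eq_square)
  qed
  also have "\<dots> = (\<Sum>i<L. energy f) / real L"
    using int by (simp add: same)
  also have "\<dots> = energy f" using L by simp
  finally show ?thesis .
qed

lemma energy_perturb:
  assumes f: "f \<in> borel_measurable M" "\<And>x. x \<in> space M \<Longrightarrow> cmod (f x) \<le> c"
    and g: "g \<in> borel_measurable M" "\<And>x. x \<in> space M \<Longrightarrow> cmod (g x) \<le> c"
    and close: "\<And>x. x \<in> space M \<Longrightarrow> cmod (f x - g x) \<le> \<eta>"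
  shows "energy f \<le> energy g + 2 * c * \<eta>"
proof -
  have "energy f \<le> (\<integral>x. (cmod (g x))\<^sup>2 + 2 * c * \<eta> \<partial>M)"
    unfolding energy_def
  proof (rule integral_mono)
    show "integrable M (\<lambda>x. (cmod (f x))\<^sup>2)" by (rule integrable_energy[OF f])
    show "integrable M (\<lambda>x. (cmod (g x))\<^sup>2 + 2 * c * \<eta>)"
      by (intro Bochner_Integration.integrable_add integrable_energy[OF g]) auto
    fix x assume x: "x \<in> space M"
    have le: "cmod (f x) - cmod (g x) \<le> \<eta>"
      using norm_triangle_ineq2[of "f x" "g x"] close[OF x] by linarith
    have \<eta>: "0 \<le> \<eta>" using close[OF x] norm_ge_zero order_trans by blast
    have "(cmod (f x))\<^sup>2 - (cmod (g x))\<^sup>2 = (cmod (f x) + cmod (g x)) * (cmod (f x) - cmod (g x))"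
      by (simp add: power2_eq_square algebra_simps)
    also have "\<dots> \<le> (cmod (f x) + cmod (g x)) * \<eta>"
      using le by (intro mult_left_mono) auto
    also have "\<dots> \<le> (c + c) * \<eta>"
      using f(2)[OF x] g(2)[OF x] \<eta> by (intro mult_right_mono) auto
    finally show "(cmod (f x))\<^sup>2 \<le> (cmod (g x))\<^sup>2 + 2 * c * \<eta>" by simp
  qed
  also have "\<dots> = energy g + 2 * c * \<eta>"
    unfolding energy_def using integrable_energy[OF g] by (simp add: prob_space)
  finally show ?thesis .
qed

text \<open>
  Von Neumann's argument without projections.  Let \<open>d\<close> be the infimum of the energies of the averages.
  Since averaging decreases energy and long averages forget short ones, the energies tend to \<open>d\<close>, and the midpoint of two
  averages has energy at least \<open>d\<close>.  The parallelogram law then makes the averages a Cauchy sequence.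
\<close>

lemma cesaro_energy_cauchy:
  assumes f: "f \<in> borel_measurable M" "\<And>x. x \<in> space M \<Longrightarrow> cmod (f x) \<le> c" and e: "0 < e"
  obtains N0 where "\<And>m n. N0 \<le> m \<Longrightarrow> N0 \<le> n \<Longrightarrow> energy (\<lambda>x. cesaro (Suc m) f x - cesaro (Suc n) f x) \<le> e"
proof -
  define s where "s n = cesaro (Suc n) f" for n
  define d where "d = (INF n. energy (s n))"
  have bdd: "bdd_below (range (\<lambda>n. energy (s n)))"
    using energy_nonneg by (intro bdd_belowI[of _ 0]) auto
  have c0: "0 \<le> c"
  proof -
    obtain x where "x \<in> space M" using not_empty by blast
    thus ?thesis using f(2) norm_ge_zero order_trans by blast
  qed
  have sm: "s n \<in> borel_measurable M" "\<And>x. x \<in> space M \<Longrightarrow> cmod (s n x) \<le> c" for n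
    unfolding s_def using f norm_cesaro_le[OF f(2)] by auto
  have lower: "d \<le> energy (s n)" for n
    unfolding d_def using bdd by (intro cINF_lower) auto
  have limit: "(\<lambda>L. a + 2 * c * (b / real (Suc L))) \<longlonglongrightarrow> a" for a b
    using tendsto_add[OF tendsto_const tendsto_mult[OF tendsto_const
        LIMSEQ_Suc[OF lim_const_over_n[of b]]], of a "2 * c"] by simp
  have mid: "d \<le> energy (\<lambda>x. (s m x + s n x) / 2)" for m n
  proof -
    let ?g = "\<lambda>x. (s m x + s n x) / 2"
    have g: "?g \<in> borel_measurable M" using sm by measurable
    have gc: "cmod (?g x) \<le> c" if "x \<in> space M" for x
      using norm_triangle_ineq[of "s m x" "s n x"] sm(2)[OF that, of m] sm(2)[OF that, of n]
      by (simp add: norm_divide)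
    define b where "b = 2 * real (Suc (max m n)) * c"
    have "d \<le> energy ?g + 2 * c * (b / real (Suc L))" for L
    proof -
      have close: "cmod (cesaro (Suc L) f x - cesaro (Suc L) ?g x) \<le> b / real (Suc L)"
        if x: "x \<in> space M" for x
      proof -
        have one: "cmod (cesaro (Suc L) (s i) x - cesaro (Suc L) f x) \<le> b / real (Suc L)"
          if "i \<le> max m n" for i
        proof -
          have "cmod (cesaro (Suc L) (s i) x - cesaro (Suc L) f x) \<le> 2 * real (Suc i) * c / real (Suc L)"
            unfolding s_def by (rule cesaro_cesaro[OF f(2) x]) auto
          also have "\<dots> \<le> b / real (Suc L)"
            unfolding b_def using that c0 by (intro divide_right_mono mult_right_mono) auto
          finally show ?thesis .
        qed
        have "cesaro (Suc L) ?g x = (cesaro (Suc L) (s m) x + cesaro (Suc L) (s n) x) / 2"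
          by (rule cesaro_midpoint)
        hence "cesaro (Suc L) f x - cesaro (Suc L) ?g x
            = - ((cesaro (Suc L) (s m) x - cesaro (Suc L) f x)
              + (cesaro (Suc L) (s n) x - cesaro (Suc L) f x)) / 2"
          by (simp add: field_simps)
        hence "cmod (cesaro (Suc L) f x - cesaro (Suc L) ?g x)
            = cmod ((cesaro (Suc L) (s m) x - cesaro (Suc L) f x)
              + (cesaro (Suc L) (s n) x - cesaro (Suc L) f x)) / 2"
          by (simp only: norm_divide norm_minus_cancel norm_numeral)
        also have "\<dots> \<le> (b / real (Suc L) + b / real (Suc L)) / 2"
          by (intro divide_right_mono order_trans[OF norm_triangle_ineq add_mono] one) auto
        also have "\<dots> = b / real (Suc L)" by (rule field_sum_of_halves[unfolded add_divide_distrib[symmetric]])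
        finally show ?thesis .
      qed
      have "d \<le> energy (cesaro (Suc L) f)" using lower[of L] by (simp add: s_def)
      also have "\<dots> \<le> energy (cesaro (Suc L) ?g) + 2 * c * (b / real (Suc L))"
        using f g gc by (intro energy_perturb close norm_cesaro_le measurable_cesaro) auto
      also have "energy (cesaro (Suc L) ?g) \<le> energy ?g"
        using g gc by (intro energy_cesaro_le) auto
      finally show ?thesis by simp
    qed
    thus ?thesis
      by (intro LIMSEQ_le_const[OF limit[of "energy ?g" b]]) auto
  qed
  have "\<exists>n. energy (s n) < d + e / 8"
    using cINF_less_iff[OF _ bdd, of "d + e / 8"] e by (auto simp: d_def)
  then obtain n1 where n1: "energy (s n1) < d + e / 8" by blast
  define b where "b = 2 * real (Suc n1) * c"
  have "\<forall>\<^sub>F L in sequentially. energy (s n1) + 2 * c * (b / real (Suc L)) < d + e / 8"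
    using limit[of "energy (s n1)" b] n1 by (intro order_tendstoD(2))
  then obtain N0 where N0: "\<And>L. N0 \<le> L \<Longrightarrow> energy (s n1) + 2 * c * (b / real (Suc L)) < d + e / 8"
    by (auto simp: eventually_sequentially)
  have upper: "energy (s L) \<le> d + e / 8" if "N0 \<le> L" for L
  proof -
    have "energy (s L) \<le> energy (cesaro (Suc L) (s n1)) + 2 * c * (b / real (Suc L))"
    proof (rule energy_perturb)
      fix x assume x: "x \<in> space M"
      show "cmod (s L x - cesaro (Suc L) (s n1) x) \<le> b / real (Suc L)"
        using cesaro_cesaro[OF f(2) x, where N = "Suc n1" and L = "Suc L"]
        by (simp add: s_def b_def norm_minus_commute)
      show "cmod (cesaro (Suc L) (s n1) x) \<le> c"
        using sm x by (intro norm_cesaro_le) auto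
    qed (use sm in auto)
    also have "energy (cesaro (Suc L) (s n1)) \<le> energy (s n1)"
      using sm by (intro energy_cesaro_le[where c = c]) auto
    finally show ?thesis using N0[OF that] by linarith
  qed
  show thesis
  proof (rule that)
    fix m n assume mn: "N0 \<le> m" "N0 \<le> n"
    let ?g = "\<lambda>x. (s m x + s n x) / 2"
    have g: "?g \<in> borel_measurable M" using sm by measurable
    have gc: "cmod (?g x) \<le> c" if "x \<in> space M" for x
      using norm_triangle_ineq[of "s m x" "s n x"] sm(2)[OF that, of m] sm(2)[OF that, of n]
      by (simp add: norm_divide)
    have par: "(cmod (s m x - s n x))\<^sup>2 = 2 * (cmod (s m x))\<^sup>2 + 2 * (cmod (s n x))\<^sup>2 - 4 * (cmod (?g x))\<^sup>2" for x
      unfolding cmod_power2 by (simp add: power2_eq_square field_simps)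
    have "energy (\<lambda>x. s m x - s n x) = 2 * energy (s m) + 2 * energy (s n) - 4 * energy ?g"
      unfolding energy_def par
      using integrable_energy[OF sm] integrable_energy[OF g gc]
      by simp
    thus "energy (\<lambda>x. cesaro (Suc m) f x - cesaro (Suc n) f x) \<le> e"
      using upper[OF mn(1)] upper[OF mn(2)] mid[of m n] e unfolding s_def[symmetric] by linarith
  qed
qed

text \<open>
  The limit is taken along an almost everywhere convergent subsequence.  The averages at \<open>T x\<close> and at \<open>x\<close> have
  difference tending to 0 at every point, so the value chosen by \<open>lim\<close> is the same at both, also where
  the sequence diverges; the limit is therefore invariant everywhere and not merely almost everywhere.
\<close>

theorem mean_ergodic_bounded:
  assumes f: "f \<in> borel_measurable M" "\<And>x. x \<in> space M \<Longrightarrow> cmod (f x) \<le> c"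
  obtains h where "h \<in> borel_measurable M" "\<And>x. x \<in> space M \<Longrightarrow> h (T x) = h x"
    "\<And>e. 0 < e \<Longrightarrow> \<exists>N>0. integrable M (\<lambda>x. cesaro N f x - h x) \<and> (\<integral>x. cmod (cesaro N f x - h x) \<partial>M) < e"
proof -
  define s where "s n = cesaro (Suc n) f" for n
  have sm [measurable]: "s n \<in> borel_measurable M" and sb: "\<And>x. x \<in> space M \<Longrightarrow> cmod (s n x) \<le> c" for n
    unfolding s_def using f norm_cesaro_le[OF f(2)] by auto
  have si: "integrable M (s n)" for n
    using sm sb by (rule integrable_bounded)
  obtain r where r: "strict_mono r" "AE x in M. Cauchy (\<lambda>i. s (r i) x)"
  proof (rule cauchy_L1_AE_cauchy_subseq[of M s])
    show "integrable M (s n)" for n by (rule si)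
    fix e :: real assume e: "0 < e"
    obtain N0 where N0: "\<And>m n. N0 \<le> m \<Longrightarrow> N0 \<le> n \<Longrightarrow> energy (\<lambda>x. s m x - s n x) \<le> e\<^sup>2 / 4"
      using cesaro_energy_cauchy[OF f, of "e\<^sup>2 / 4"] e unfolding s_def by auto
    have "(\<integral>x. cmod (s m x - s n x) \<partial>M) < e" if mn: "N0 \<le> m" "N0 \<le> n" for m n
    proof -
      have meas: "(\<lambda>x. s m x - s n x) \<in> borel_measurable M" by measurable
      have bnd: "cmod (s m x - s n x) \<le> 2 * c" if "x \<in> space M" for x
        using norm_triangle_ineq4[of "s m x" "s n x"] sb[OF that, of m] sb[OF that, of n] by linarith
      have ie: "integrable M (\<lambda>x. (cmod (s m x - s n x))\<^sup>2)"
        by (rule integrable_energy[OF meas bnd])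
      have "(\<integral>x. cmod (s m x - s n x) \<partial>M) \<le> (\<integral>x. e / 4 + (cmod (s m x - s n x))\<^sup>2 / e \<partial>M)"
      proof (rule integral_mono)
        show "integrable M (\<lambda>x. cmod (s m x - s n x))"
          using si by auto
        show "integrable M (\<lambda>x. e / 4 + (cmod (s m x - s n x))\<^sup>2 / e)"
          using ie by auto
        fix x
        define z where "z = cmod (s m x - s n x)"
        \<comment> \<open>Passage from the energy to the \<open>L\<^sup>1\<close> norm: \<open>z \<le> e / 4 + z\<^sup>2 / e\<close>.\<close>
        have "0 \<le> (e / 2 - z)\<^sup>2 / e" using e by simp
        also have "\<dots> = e / 4 + z\<^sup>2 / e - z"
          using e by (simp add: power2_eq_square field_simps)
        finally show "cmod (s m x - s n x) \<le> e / 4 + (cmod (s m x - s n x))\<^sup>2 / e"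
          by (simp add: z_def)
      qed
      also have "\<dots> = e / 4 + energy (\<lambda>x. s m x - s n x) / e"
        unfolding energy_def using ie by (simp add: prob_space)
      also have "energy (\<lambda>x. s m x - s n x) / e \<le> (e\<^sup>2 / 4) / e"
        using N0[OF mn] e by (intro divide_right_mono) auto
      also have "e / 4 + (e\<^sup>2 / 4) / e < e"
        using e by (simp add: power2_eq_square)
      finally show ?thesis by simp
    qed
    thus "\<exists>N. \<forall>i\<ge>N. \<forall>j\<ge>N. (\<integral>x. cmod (s i x - s j x) \<partial>M) < e" by blast
  qed (rule that)
  define h where "h x = lim (\<lambda>i. s (r i) x)" for x
  have hm [measurable]: "h \<in> borel_measurable M" unfolding h_def by measurable
  have conv: "AE x in M. (\<lambda>i. s (r i) x) \<longlonglongrightarrow> h x"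
    using r(2) by eventually_elim (auto simp: h_def Cauchy_convergent_iff convergent_LIMSEQ_iff)
  have hi: "integrable M h"
    by (rule integrable_dominated_convergence[where s = "\<lambda>i. s (r i)" and w = "\<lambda>_. c"])
       (use conv sb in auto)
  show thesis
  proof (rule that[OF hm])
    fix x assume x: "x \<in> space M"
    have diff: "(\<lambda>i. s (r i) (T x) - s (r i) x) \<longlonglongrightarrow> 0"
    proof (rule Lim_null_comparison)
      have "cmod (s n (T x) - s n x) \<le> (2 * c) / real (Suc n)" for n
      proof -
        define a where "a i = f (\<tau> (int i) x)" for i
        have "\<tau> (int i) (T x) = \<tau> (int i + 1) x" for i
          using iterate_add[OF x, of "int i" 1] iterate_Suc[OF x, of 0] by simp
        hence aS: "f (\<tau> (int i) (T x)) = a (i + 1)" for i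
          by (simp add: a_def add.commute)
        have "s n (T x) - s n x = ((\<Sum>i<Suc n. a (i + 1)) - (\<Sum>i<Suc n. a i)) / of_nat (Suc n)"
          unfolding s_def cesaro_def aS a_def[symmetric] by (simp only: diff_divide_distrib)
        also have "cmod \<dots> \<le> 2 * real 1 * c / real (Suc n)"
          unfolding norm_divide norm_of_nat
          by (intro divide_right_mono shifted_sum_le) (auto simp: a_def intro: f(2) iterate_in_space[OF x])
        finally show ?thesis by simp
      qed
      thus "\<forall>\<^sub>F i in sequentially. norm (s (r i) (T x) - s (r i) x) \<le> (2 * c) / real (Suc (r i))"
        by simp
      have "(\<lambda>n. (2 * c) / real (Suc n)) \<longlonglongrightarrow> 0"
        using LIMSEQ_Suc[OF lim_const_over_n[of "2 * c"]] by simp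
      from LIMSEQ_subseq_LIMSEQ[OF this r(1)]
      show "(\<lambda>i. (2 * c) / real (Suc (r i))) \<longlonglongrightarrow> 0" by (simp add: o_def)
    qed
    have "(\<lambda>i. s (r i) (T x)) \<longlonglongrightarrow> l \<longleftrightarrow> (\<lambda>i. s (r i) x) \<longlonglongrightarrow> l" for l
    proof
      assume "(\<lambda>i. s (r i) (T x)) \<longlonglongrightarrow> l"
      from tendsto_diff[OF this diff] show "(\<lambda>i. s (r i) x) \<longlonglongrightarrow> l" by simp
    next
      assume "(\<lambda>i. s (r i) x) \<longlonglongrightarrow> l"
      from tendsto_add[OF this diff] show "(\<lambda>i. s (r i) (T x)) \<longlonglongrightarrow> l" by simp
    qed
    thus "h (T x) = h x" by (simp add: h_def lim_def)
  next
    fix e :: real assume e: "0 < e"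
    have bound_h: "AE x in M. cmod (h x) \<le> c"
      using conv AE_space
    proof eventually_elim
      case (elim x)
      show ?case
        by (rule LIMSEQ_le_const2[OF tendsto_norm[OF elim(1)]]) (use sb elim in auto)
    qed
    have "(\<lambda>i. \<integral>x. cmod (s (r i) x - h x) \<partial>M) \<longlonglongrightarrow> (\<integral>x. 0 \<partial>M)"
    proof (rule integral_dominated_convergence[where w = "\<lambda>_. 2 * c"])
      show "AE x in M. (\<lambda>i. cmod (s (r i) x - h x)) \<longlonglongrightarrow> 0"
        using conv by eventually_elim (simp add: LIM_zero_iff tendsto_norm_zero)
      show "AE x in M. norm (cmod (s (r i) x - h x)) \<le> 2 * c" for i
        using bound_h AE_space
      proof eventually_elim
        case (elim x)
        thus ?case using norm_triangle_ineq4[of "s (r i) x" "h x"] sb[of x "r i"] by simp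
      qed
    qed auto
    hence "\<forall>\<^sub>F i in sequentially. (\<integral>x. cmod (s (r i) x - h x) \<partial>M) < e"
      using e by (intro order_tendstoD(2)) auto
    then obtain i where "(\<integral>x. cmod (s (r i) x - h x) \<partial>M) < e"
      using eventually_happens' sequentially_bot by blast
    moreover have "integrable M (\<lambda>x. s (r i) x - h x)" using si hi by auto
    ultimately show "\<exists>N>0. integrable M (\<lambda>x. cesaro N f x - h x) \<and> (\<integral>x. cmod (cesaro N f x - h x) \<partial>M) < e"
      unfolding s_def by (intro exI[of _ "Suc (r i)"]) auto
  qed
qed

end

section \<open>Transference and almost everywhere convergence\<close>

locale averaging_kernels = hormander_kernels k V A + invertible_system M T
  for k :: "nat \<Rightarrow> int \<Rightarrow> real" and V :: "nat \<Rightarrow> int \<Rightarrow> int \<Rightarrow> real" and A :: real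
    and M :: "'a measure" and T :: "'a \<Rightarrow> 'a" +
  assumes k_has_sum: "(k n has_sum 1) UNIV"
    and asymptotic_invariance: "0 < \<epsilon> \<Longrightarrow>
      \<exists>n0. \<forall>n\<ge>n0. \<forall>X. finite X \<longrightarrow> (\<Sum>x\<in>X. \<bar>k n (x + 1) - k n x\<bar>) \<le> \<epsilon>"
begin

text \<open>
  Both the number of kernels and the window of summation are cut off at \<open>N\<close>, so that only finitely many
  iterates are involved and transference applies; the sets increase to \<open>maximal_set\<close>.
\<close>

definition exceeds :: "('a \<Rightarrow> real) \<Rightarrow> real \<Rightarrow> nat \<Rightarrow> 'a set" where
  "exceeds f \<kappa> N = {x \<in> space M. \<exists>n\<in>{1..N}. 3 * \<kappa> < (\<Sum>j\<in>{- int N..int N}. k n j * f (\<tau> j x))}"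

lemma sets_exceeds [measurable]:
  assumes [measurable]: "f \<in> borel_measurable M"
  shows "exceeds f \<kappa> N \<in> sets M"
proof -
  have [measurable]: "(\<lambda>x. f (\<tau> j x)) \<in> borel_measurable M" for j
    by (rule measurable_compose[OF measurable_iterate assms])
  show ?thesis unfolding exceeds_def by measurable
qed

lemma exceeds_on_orbit:
  assumes f: "\<And>x. 0 \<le> f x" and \<kappa>: "0 < \<kappa>" and x: "x \<in> space M"
  shows "\<kappa> * card {i \<in> {0..<int J}. \<tau> i x \<in> exceeds f \<kappa> N}
    \<le> (10 + A) * (\<Sum>y\<in>{- int N..<int J + int N}. f (\<tau> y x))"
proof -
  let ?S = "{- int N..<int J + int N}"
  have sub: "{i \<in> {0..<int J}. \<tau> i x \<in> exceeds f \<kappa> N}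
      \<subseteq> {i \<in> {0..<int J}. \<exists>n\<in>{1..N}. 3 * \<kappa> < (\<Sum>y\<in>?S. k n (y - i) * f (\<tau> y x))}"
  proof safe
    fix i assume i: "i \<in> {0..<int J}" and e: "\<tau> i x \<in> exceeds f \<kappa> N"
    then obtain n where n: "n \<in> {1..N}"
        "3 * \<kappa> < (\<Sum>j\<in>{- int N..int N}. k n j * f (\<tau> j (\<tau> i x)))"
      by (auto simp: exceeds_def)
    have "(\<Sum>j\<in>{- int N..int N}. k n j * f (\<tau> j (\<tau> i x)))
        = (\<Sum>y\<in>(\<lambda>j. j + i) ` {- int N..int N}. k n (y - i) * f (\<tau> y x))"
      by (subst sum.reindex) (auto simp: inj_on_def iterate_add[OF x])
    also have "\<dots> \<le> (\<Sum>y\<in>?S. k n (y - i) * f (\<tau> y x))"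
      using i by (intro sum_mono2) (auto intro!: mult_nonneg_nonneg f)
    finally show "\<exists>n\<in>{1..N}. 3 * \<kappa> < (\<Sum>y\<in>?S. k n (y - i) * f (\<tau> y x))"
      using n by (intro bexI[of _ n]) auto
  qed
  have "card {i \<in> {0..<int J}. \<tau> i x \<in> exceeds f \<kappa> N}
      \<le> card {i \<in> {0..<int J}. \<exists>n\<in>{1..N}. 3 * \<kappa> < (\<Sum>y\<in>?S. k n (y - i) * f (\<tau> y x))}"
    by (rule card_mono[OF finite_subset[where B = "{0..<int J}"] sub]) auto
  hence "\<kappa> * card {i \<in> {0..<int J}. \<tau> i x \<in> exceeds f \<kappa> N}
      \<le> \<kappa> * card {i \<in> {0..<int J}. \<exists>n\<in>{1..N}. 3 * \<kappa> < (\<Sum>y\<in>?S. k n (y - i) * f (\<tau> y x))}"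
    using \<kappa> by (intro mult_left_mono) auto
  also have "\<dots> \<le> (10 + A) * (\<Sum>y\<in>?S. f (\<tau> y x))"
    by (rule weak_type_integers) (use f \<kappa> in auto)
  finally show ?thesis .
qed

text \<open>
  Transference: integrate the inequality on the orbit segment of length \<open>J\<close>.  The left side counts each point \<open>J\<close>
  times, the right side \<open>J + 2 N\<close> times, and the excess disappears as \<open>J\<close> tends to infinity.
\<close>

lemma measure_exceeds:
  assumes int: "integrable M f" and f: "\<And>x. 0 \<le> f x" and \<kappa>: "0 < \<kappa>"
  shows "\<kappa> * prob (exceeds f \<kappa> N) \<le> (10 + A) * (\<integral>x. f x \<partial>M)"
proof -
  define I where "I = (\<integral>x. f x \<partial>M)"
  define p where "p = prob (exceeds f \<kappa> N)"
  have fm [measurable]: "f \<in> borel_measurable M" using int by auto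
  have bound: "\<kappa> * p \<le> (10 + A) * I + (10 + A) * I * (2 * real N) / real (Suc J)" for J
  proof -
    let ?J = "{0..<int (Suc J)}" and ?S = "{- int N..<int (Suc J) + int N}"
    have ind_int: "integrable M (\<lambda>x. indicator (exceeds f \<kappa> N) (\<tau> i x) :: real)" for i
      by (rule integrable_iterate[of "indicator (exceeds f \<kappa> N)"])
         (use sets_exceeds[OF fm] in \<open>auto intro!: integrable_real_indicator simp: less_top[symmetric]\<close>)
    have ind: "(\<integral>x. indicator (exceeds f \<kappa> N) (\<tau> i x) \<partial>M) = p" for i
      using integral_iterate[of "indicator (exceeds f \<kappa> N) :: 'a \<Rightarrow> real" i] sets_exceeds[OF fm]
      by (simp add: p_def)
    have "real (Suc J) * p = (\<Sum>i\<in>?J. \<integral>x. indicator (exceeds f \<kappa> N) (\<tau> i x) \<partial>M)"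
      by (simp add: ind)
    also have "\<dots> = (\<integral>x. (\<Sum>i\<in>?J. indicator (exceeds f \<kappa> N) (\<tau> i x)) \<partial>M)"
      by (rule Bochner_Integration.integral_sum[symmetric]) (rule ind_int)
    finally have "\<kappa> * (real (Suc J) * p) = (\<integral>x. \<kappa> * (\<Sum>i\<in>?J. indicator (exceeds f \<kappa> N) (\<tau> i x)) \<partial>M)"
      by simp
    also have "\<dots> \<le> (\<integral>x. (10 + A) * (\<Sum>y\<in>?S. f (\<tau> y x)) \<partial>M)"
    proof (rule integral_mono)
      show "integrable M (\<lambda>x. \<kappa> * (\<Sum>i\<in>?J. indicator (exceeds f \<kappa> N) (\<tau> i x)))"
        by (intro integrable_mult_right Bochner_Integration.integrable_sum ind_int)
      show "integrable M (\<lambda>x. (10 + A) * (\<Sum>y\<in>?S. f (\<tau> y x)))"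
        by (intro integrable_mult_right Bochner_Integration.integrable_sum integrable_iterate int)
      fix x assume x: "x \<in> space M"
      have card: "(\<Sum>i\<in>?J. indicator (exceeds f \<kappa> N) (\<tau> i x)) = real (card {i \<in> ?J. \<tau> i x \<in> exceeds f \<kappa> N})"
        by (simp add: indicator_def sum.If_cases Int_def)
      show "\<kappa> * (\<Sum>i\<in>?J. indicator (exceeds f \<kappa> N) (\<tau> i x)) \<le> (10 + A) * (\<Sum>y\<in>?S. f (\<tau> y x))"
        unfolding card by (rule exceeds_on_orbit[OF f \<kappa> x])
    qed
    also have "\<dots> = (10 + A) * (\<Sum>y\<in>?S. \<integral>x. f (\<tau> y x) \<partial>M)"
      using integrable_iterate[OF int] by simp
    also have "\<dots> = (10 + A) * (real (card ?S) * I)"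
      by (simp add: integral_iterate[OF fm] I_def)
    also have "real (card ?S) = real (Suc J) + 2 * real N" by simp
    finally have "\<kappa> * p * real (Suc J) \<le> (10 + A) * I * real (Suc J) + (10 + A) * I * (2 * real N)"
      by (simp add: algebra_simps)
    hence "\<kappa> * p \<le> ((10 + A) * I * real (Suc J) + (10 + A) * I * (2 * real N)) / real (Suc J)"
      by (simp add: pos_le_divide_eq)
    thus ?thesis by (simp add: add_divide_distrib)
  qed
  have "(\<lambda>J. (10 + A) * I + (10 + A) * I * (2 * real N) / real (Suc J)) \<longlonglongrightarrow> (10 + A) * I + 0"
    by (intro tendsto_add tendsto_const LIMSEQ_Suc[OF lim_const_over_n])
  from LIMSEQ_le_const[OF this, of "\<kappa> * p"] bound show ?thesis
    by (auto simp: I_def p_def)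
qed

definition maximal_set :: "('a \<Rightarrow> real) \<Rightarrow> real \<Rightarrow> 'a set" where
  "maximal_set f \<kappa> = (\<Union>N. exceeds f \<kappa> N)"

lemma measure_maximal_set:
  assumes int: "integrable M f" and f: "\<And>x. 0 \<le> f x" and \<kappa>: "0 < \<kappa>"
  shows "maximal_set f \<kappa> \<in> sets M" "prob (maximal_set f \<kappa>) \<le> (10 + A) / \<kappa> * (\<integral>x. f x \<partial>M)"
proof -
  have fm [measurable]: "f \<in> borel_measurable M" using int by auto
  show "maximal_set f \<kappa> \<in> sets M" unfolding maximal_set_def by measurable
  have "incseq (exceeds f \<kappa>)"
  proof (rule incseq_SucI)
    fix N
    have mono: "(\<Sum>j\<in>{- int N..int N}. k n j * f (\<tau> j x)) \<le> (\<Sum>j\<in>{- int (Suc N)..int (Suc N)}. k n j * f (\<tau> j x))" for n x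
      by (intro sum_mono2) (auto intro!: mult_nonneg_nonneg f)
    show "exceeds f \<kappa> N \<subseteq> exceeds f \<kappa> (Suc N)"
    proof
      fix x assume "x \<in> exceeds f \<kappa> N"
      then obtain n where "x \<in> space M" "n \<in> {1..N}"
          "3 * \<kappa> < (\<Sum>j\<in>{- int N..int N}. k n j * f (\<tau> j x))"
        unfolding exceeds_def by blast
      moreover from this(3) have
          "3 * \<kappa> < (\<Sum>j\<in>{- int (Suc N)..int (Suc N)}. k n j * f (\<tau> j x))"
        by (rule order_less_le_trans[OF _ mono])
      moreover have "n \<in> {1..Suc N}" using \<open>n \<in> {1..N}\<close> by simp
      ultimately show "x \<in> exceeds f \<kappa> (Suc N)"
        unfolding exceeds_def by blast
    qed
  qed
  hence "(\<lambda>N. prob (exceeds f \<kappa> N)) \<longlonglongrightarrow> prob (maximal_set f \<kappa>)"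
    unfolding maximal_set_def by (intro finite_Lim_measure_incseq) auto
  moreover have "prob (exceeds f \<kappa> N) \<le> (10 + A) / \<kappa> * (\<integral>x. f x \<partial>M)" for N
    using measure_exceeds[OF int f \<kappa>, of N] \<kappa> by (simp add: field_simps)
  ultimately show "prob (maximal_set f \<kappa>) \<le> (10 + A) / \<kappa> * (\<integral>x. f x \<partial>M)"
    by (intro LIMSEQ_le_const2) auto
qed

definition average :: "nat \<Rightarrow> ('a \<Rightarrow> complex) \<Rightarrow> 'a \<Rightarrow> complex" where
  "average n f x = (\<Sum>\<^sub>\<infinity>j. of_real (k n j) * f (\<tau> j x))"

lemma infsum_le_of_finite_sums:
  fixes a :: "int \<Rightarrow> complex"
  assumes "\<And>F. finite F \<Longrightarrow> (\<Sum>j\<in>F. cmod (a j)) \<le> b"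
  shows "a summable_on UNIV" "cmod (infsum a UNIV) \<le> b"
proof -
  have s: "(\<lambda>j. cmod (a j)) summable_on UNIV"
    by (rule nonneg_bdd_above_summable_on) (use assms in \<open>auto intro!: bdd_aboveI[of _ b]\<close>)
  thus "a summable_on UNIV" by (rule abs_summable_summable)
  have "cmod (infsum a UNIV) \<le> (\<Sum>\<^sub>\<infinity>j. cmod (a j))" by (rule norm_infsum_bound[OF s])
  also have "\<dots> \<le> b" using s assms by (intro infsum_le_finite_sums) auto
  finally show "cmod (infsum a UNIV) \<le> b" .
qed

text \<open>
  Every finite set of indices lies in a window, so outside the maximal set the finite sums of the moduli
  are bounded and the series converges absolutely.
\<close>

lemma average_outside_maximal_set:
  assumes x: "x \<in> space M" "x \<notin> maximal_set (\<lambda>x. cmod (e x)) \<kappa>" and n: "1 \<le> n"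
  shows "(\<lambda>j. of_real (k n j) * e (\<tau> j x)) summable_on UNIV" "cmod (average n e x) \<le> 3 * \<kappa>"
proof -
  have "(\<Sum>j\<in>F. cmod (of_real (k n j) * e (\<tau> j x))) \<le> 3 * \<kappa>" if F: "finite F" for F
  proof -
    define N where "N = nat (\<Sum>j\<in>F. \<bar>j\<bar>) + n"
    have "F \<subseteq> {- int N..int N}"
    proof
      fix j assume "j \<in> F"
      hence "\<bar>j\<bar> \<le> (\<Sum>j\<in>F. \<bar>j\<bar>)" using F by (intro member_le_sum) auto
      thus "j \<in> {- int N..int N}" by (auto simp: N_def)
    qed
    hence "(\<Sum>j\<in>F. cmod (of_real (k n j) * e (\<tau> j x)))
        \<le> (\<Sum>j\<in>{- int N..int N}. cmod (of_real (k n j) * e (\<tau> j x)))"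
      by (intro sum_mono2) auto
    also have "\<dots> = (\<Sum>j\<in>{- int N..int N}. k n j * cmod (e (\<tau> j x)))"
      by (simp add: norm_mult)
    also have "\<dots> \<le> 3 * \<kappa>"
    proof -
      have "x \<notin> exceeds (\<lambda>x. cmod (e x)) \<kappa> N" using x(2) by (auto simp: maximal_set_def)
      moreover have "n \<in> {1..N}" using n by (simp add: N_def)
      ultimately show ?thesis using x(1) by (auto simp: exceeds_def not_less)
    qed
    finally show ?thesis .
  qed
  from infsum_le_of_finite_sums[OF this]
  show "(\<lambda>j. of_real (k n j) * e (\<tau> j x)) summable_on UNIV" "cmod (average n e x) \<le> 3 * \<kappa>"
    unfolding average_def by blast+
qed

lemma summable_bounded:
  fixes a :: "int \<Rightarrow> complex"
  assumes "\<And>j. cmod (a j) \<le> c"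
  shows "(\<lambda>j. of_real (k n j) * a j) summable_on UNIV"
proof (rule infsum_le_of_finite_sums(1))
  fix F :: "int set" assume F: "finite F"
  have c: "0 \<le> c" using assms[of 0] norm_ge_zero order_trans by blast
  have "(\<Sum>j\<in>F. cmod (of_real (k n j) * a j)) \<le> (\<Sum>j\<in>F. k n j * c)"
    by (intro sum_mono) (auto simp: norm_mult intro: mult_left_mono assms)
  also have "\<dots> = (\<Sum>j\<in>F. k n j) * c" by (rule sum_distrib_right[symmetric])
  also have "\<dots> \<le> 1 * c" using F c by (intro mult_right_mono k_mass)
  finally show "(\<Sum>j\<in>F. cmod (of_real (k n j) * a j)) \<le> c" by simp
qed

lemma has_sum_difference:
  fixes f g :: "'b \<Rightarrow> complex"
  assumes "(f has_sum a) X" "(g has_sum b) X"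
  shows "((\<lambda>x. f x - g x) has_sum (a - b)) X"
  using has_sum_add[OF assms(1) has_sum_uminusI[OF assms(2)]] by simp

text \<open>
  Summation by parts moves the difference from \<open>g\<close> to the kernel.
\<close>

lemma average_coboundary:
  assumes x: "x \<in> space M" and g: "\<And>x. x \<in> space M \<Longrightarrow> cmod (g x) \<le> c"
    and small: "\<And>X. finite X \<Longrightarrow> (\<Sum>j\<in>X. \<bar>k n (j + 1) - k n j\<bar>) \<le> \<epsilon>"
  shows "(\<lambda>j. of_real (k n j) * (g (\<tau> j x) - g (T (\<tau> j x)))) summable_on UNIV"
    and "cmod (average n (\<lambda>x. g x - g (T x)) x) \<le> c * \<epsilon>"
proof -
  define a where "a j = g (\<tau> j x)" for j
  have a: "cmod (a j) \<le> c" for j unfolding a_def by (intro g iterate_in_space x)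
  have c0: "0 \<le> c" using a[of 0] norm_ge_zero order_trans by blast
  have Ta: "g (T (\<tau> j x)) = a (j + 1)" for j by (simp add: a_def iterate_Suc[OF x])
  have s1: "(\<lambda>j. of_real (k n j) * a j) summable_on UNIV" by (rule summable_bounded[OF a])
  have s2: "(\<lambda>j. of_real (k n j) * a (j + 1)) summable_on UNIV" by (rule summable_bounded[OF a])
  have eq: "of_real (k n j) * (g (\<tau> j x) - g (T (\<tau> j x)))
      = of_real (k n j) * a j - of_real (k n j) * a (j + 1)" for j
    unfolding Ta a_def[symmetric] by (rule right_diff_distrib)
  show "(\<lambda>j. of_real (k n j) * (g (\<tau> j x) - g (T (\<tau> j x)))) summable_on UNIV"
    unfolding eq using has_sum_difference[OF has_sum_infsum[OF s1] has_sum_infsum[OF s2]]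
    by (rule has_sum_imp_summable)
  have bij: "bij_betw (\<lambda>j. j - 1) UNIV (UNIV :: int set)"
    by (rule bij_betwI[where g = "\<lambda>j. j + 1"]) auto
  have s3: "(\<lambda>j. of_real (k n (j - 1)) * a j) summable_on UNIV"
    using s2 summable_on_reindex_bij_betw[OF bij, of "\<lambda>j. of_real (k n j) * a (j + 1)"] by simp
  have "average n (\<lambda>x. g x - g (T x)) x
      = (\<Sum>\<^sub>\<infinity>j. of_real (k n j) * a j) - (\<Sum>\<^sub>\<infinity>j. of_real (k n j) * a (j + 1))"
    unfolding average_def eq
    by (rule infsumI[OF has_sum_difference[OF has_sum_infsum[OF s1] has_sum_infsum[OF s2]]])
  also have "(\<Sum>\<^sub>\<infinity>j. of_real (k n j) * a (j + 1)) = (\<Sum>\<^sub>\<infinity>j. of_real (k n (j - 1)) * a j)"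
    using infsum_reindex_bij_betw[OF bij, of "\<lambda>j. of_real (k n j) * a (j + 1)"] by simp
  also have "(\<Sum>\<^sub>\<infinity>j. of_real (k n j) * a j) - (\<Sum>\<^sub>\<infinity>j. of_real (k n (j - 1)) * a j)
      = (\<Sum>\<^sub>\<infinity>j. of_real (k n j) * a j - of_real (k n (j - 1)) * a j)"
    by (rule infsumI[OF has_sum_difference[OF has_sum_infsum[OF s1] has_sum_infsum[OF s3]], symmetric])
  also have "cmod \<dots> \<le> c * \<epsilon>"
  proof (rule infsum_le_of_finite_sums(2))
    fix F :: "int set" assume F: "finite F"
    have "(\<Sum>j\<in>F. cmod (of_real (k n j) * a j - of_real (k n (j - 1)) * a j))
        \<le> (\<Sum>j\<in>F. c * \<bar>k n j - k n (j - 1)\<bar>)"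
    proof (intro sum_mono)
      fix j
      have "of_real (k n j) * a j - of_real (k n (j - 1)) * a j = of_real (k n j - k n (j - 1)) * a j"
        by (simp add: left_diff_distrib)
      hence "cmod (of_real (k n j) * a j - of_real (k n (j - 1)) * a j) = \<bar>k n j - k n (j - 1)\<bar> * cmod (a j)"
        by (simp only: norm_mult norm_of_real)
      also have "\<dots> \<le> \<bar>k n j - k n (j - 1)\<bar> * c" by (intro mult_left_mono a) auto
      finally show "cmod (of_real (k n j) * a j - of_real (k n (j - 1)) * a j) \<le> c * \<bar>k n j - k n (j - 1)\<bar>"
        by (simp add: mult.commute)
    qed
    also have "\<dots> = c * (\<Sum>j\<in>(\<lambda>j. j - 1) ` F. \<bar>k n (j + 1) - k n j\<bar>)"
      by (subst sum.reindex) (auto simp: inj_on_def sum_distrib_left)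
    also have "\<dots> \<le> c * \<epsilon>" using F c0 by (intro mult_left_mono small) auto
    finally show "(\<Sum>j\<in>F. cmod (of_real (k n j) * a j - of_real (k n (j - 1)) * a j)) \<le> c * \<epsilon>" .
  qed
  finally show "cmod (average n (\<lambda>x. g x - g (T x)) x) \<le> c * \<epsilon>" .
qed

lemma average_invariant:
  fixes h :: "'a \<Rightarrow> complex"
  assumes x: "x \<in> space M" and h: "\<And>x. x \<in> space M \<Longrightarrow> h (T x) = h x"
  shows "((\<lambda>j. of_real (k n j) * h (\<tau> j x)) has_sum h x) UNIV"
proof -
  have "h (\<tau> j x) = h x" for j
  proof (induction j rule: int_induct[where k = 0])
    case (step1 i)
    thus ?case using h[OF iterate_in_space[OF x]] by (simp add: iterate_Suc[OF x])
  next
    case (step2 i)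
    have "T (\<tau> (i - 1) x) = \<tau> i x" using iterate_Suc[OF x, of "i - 1"] by simp
    thus ?case using step2 h[OF iterate_in_space[OF x], of "i - 1"] by simp
  qed simp
  moreover have "((\<lambda>j. of_real (k n j) * h x) has_sum of_real 1 * h x) UNIV"
    by (intro has_sum_cmult_left has_sum_of_real k_has_sum)
  ultimately show ?thesis by simp
qed

text \<open>
  Truncate \<open>f\<close>, and let \<open>h\<close> be the limit of the averages of the truncation.  The truncation minus one of its
  averages is a coboundary of a bounded function by telescoping, and that average is close to \<open>h\<close>.
\<close>

lemma coboundary_decomposition:
  assumes f: "integrable M f" and \<eta>: "0 < \<eta>"
  shows "\<exists>h g e c. (\<forall>x\<in>space M. f x = h x + (g x - g (T x)) + e x) \<and>
    (\<forall>x\<in>space M. h (T x) = h x) \<and> (\<forall>x\<in>space M. cmod (g x) \<le> c) \<and>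
    integrable M e \<and> (\<integral>x. cmod (e x) \<partial>M) \<le> \<eta>"
proof -
  have fm [measurable]: "f \<in> borel_measurable M" using f by auto
  define trunc where "trunc m x = (if cmod (f x) \<le> real m then f x else 0)" for m x
  have tm [measurable]: "trunc m \<in> borel_measurable M" for m unfolding trunc_def by measurable
  have tb: "cmod (trunc m x) \<le> real m" for m x by (simp add: trunc_def)
  have "(\<lambda>m. \<integral>x. cmod (f x - trunc m x) \<partial>M) \<longlonglongrightarrow> (\<integral>x. 0 \<partial>M)"
  proof (rule integral_dominated_convergence[where w = "\<lambda>x. cmod (f x)"])
    show "AE x in M. (\<lambda>m. cmod (f x - trunc m x)) \<longlonglongrightarrow> 0"
    proof (rule AE_I2)
      fix x
      obtain m0 :: nat where "cmod (f x) \<le> real m0" using real_arch_simple by blast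
      hence "\<forall>\<^sub>F m in sequentially. cmod (f x - trunc m x) = 0"
        by (intro eventually_sequentiallyI[of m0]) (auto simp: trunc_def)
      thus "(\<lambda>m. cmod (f x - trunc m x)) \<longlonglongrightarrow> 0" by (rule tendsto_eventually)
    qed
    show "AE x in M. norm (cmod (f x - trunc m x)) \<le> cmod (f x)" for m
      by (rule AE_I2) (simp add: trunc_def)
  qed (use f in auto)
  hence "\<forall>\<^sub>F m in sequentially. (\<integral>x. cmod (f x - trunc m x) \<partial>M) < \<eta> / 2"
    using \<eta> by (intro order_tendstoD(2)) auto
  then obtain m where m: "(\<integral>x. cmod (f x - trunc m x) \<partial>M) < \<eta> / 2"
    using eventually_happens' sequentially_bot by blast
  obtain h where h: "h \<in> borel_measurable M" "\<And>x. x \<in> space M \<Longrightarrow> h (T x) = h x"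
    "\<And>e. 0 < e \<Longrightarrow> \<exists>N>0. integrable M (\<lambda>x. cesaro N (trunc m) x - h x) \<and>
      (\<integral>x. cmod (cesaro N (trunc m) x - h x) \<partial>M) < e"
    using mean_ergodic_bounded[OF tm tb, of m] by metis
  obtain N where N: "0 < N" "integrable M (\<lambda>x. cesaro N (trunc m) x - h x)"
    "(\<integral>x. cmod (cesaro N (trunc m) x - h x) \<partial>M) < \<eta> / 2"
    using h(3)[of "\<eta> / 2"] \<eta> by auto
  define e where "e x = (f x - trunc m x) + (cesaro N (trunc m) x - h x)" for x
  define g where "g x = (\<Sum>j<N. \<Sum>i<j. trunc m (\<tau> (int i) x)) / of_nat N" for x
  have fi: "integrable M (\<lambda>x. f x - trunc m x)"
    using f integrable_bounded[OF tm tb] by auto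
  have ie: "integrable M e" unfolding e_def using fi N(2) by auto
  have pointwise: "f x = h x + (g x - g (T x)) + e x" "cmod (g x) \<le> (\<Sum>j<N. real j * real m)"
    if x: "x \<in> space M" for x
  proof -
    have tau: "\<tau> (int i) (T x) = \<tau> (int (Suc i)) x" for i
      using iterate_add[OF x, of "int i" 1] iterate_Suc[OF x, of 0] by (simp add: add.commute)
    define a where "a i = trunc m (\<tau> (int i) x)" for i
    have tele: "(\<Sum>i<j. a i) - (\<Sum>i<j. a (Suc i)) = a 0 - a j" for j
      using sum_lessThan_telescope'[of a j] by (simp add: sum_subtractf)
    have "g x - g (T x) = (\<Sum>j<N. (\<Sum>i<j. a i) - (\<Sum>i<j. a (Suc i))) / of_nat N"
      unfolding g_def tau a_def by (simp only: sum_subtractf diff_divide_distrib)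
    also have "\<dots> = (of_nat N * a 0 - (\<Sum>j<N. a j)) / of_nat N"
      unfolding tele by (simp add: sum_subtractf)
    also have "\<dots> = trunc m x - cesaro N (trunc m) x"
      using N(1) by (simp add: diff_divide_distrib a_def cesaro_def)
    finally show "f x = h x + (g x - g (T x)) + e x" by (simp add: e_def)
    have "cmod (g x) \<le> (\<Sum>j<N. \<Sum>i<j. real m) / real N"
      unfolding g_def norm_divide norm_of_nat
      by (intro divide_right_mono order_trans[OF norm_sum sum_mono] order_trans[OF norm_sum sum_mono] tb) auto
    also have "\<dots> \<le> (\<Sum>j<N. \<Sum>i<j. real m) / 1"
      using N(1) by (intro divide_left_mono sum_nonneg) auto
    finally show "cmod (g x) \<le> (\<Sum>j<N. real j * real m)" by simp
  qed
  have "(\<integral>x. cmod (e x) \<partial>M) \<le> \<eta>"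
  proof -
    have "(\<integral>x. cmod (e x) \<partial>M) \<le> (\<integral>x. cmod (f x - trunc m x) + cmod (cesaro N (trunc m) x - h x) \<partial>M)"
      unfolding e_def using fi N(2) ie by (intro integral_mono norm_triangle_ineq) (auto simp: e_def)
    also have "\<dots> = (\<integral>x. cmod (f x - trunc m x) \<partial>M) + (\<integral>x. cmod (cesaro N (trunc m) x - h x) \<partial>M)"
      using fi N(2) by (intro Bochner_Integration.integral_add) auto
    finally show ?thesis using m N(3) by linarith
  qed
  thus ?thesis
    using pointwise h(2) ie
    by (intro exI[of _ h] exI[of _ g] exI[of _ e] exI[of _ "\<Sum>j<N. real j * real m"] conjI ballI)
qed

text \<open>
  Almost every point avoids, for each \<open>\<kappa>\<close>, the maximal set of some error \<open>e l\<close>, since these sets have measure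
  tending to 0.  At such a point the averages are eventually within \<open>4 \<kappa>\<close> of \<open>h l x\<close>.  The function \<open>h l\<close>
  varies with \<open>\<kappa>\<close>, so the conclusion is the Cauchy property rather than an explicit limit.
\<close>

theorem AE_convergent_average:
  assumes f: "integrable M f"
  shows "AE x in M. convergent (\<lambda>n. average (Suc n) f x)"
proof -
  have "\<forall>l. \<exists>h g e c. (\<forall>x\<in>space M. f x = h x + (g x - g (T x)) + e x) \<and>
    (\<forall>x\<in>space M. h (T x) = h x) \<and> (\<forall>x\<in>space M. cmod (g x) \<le> c) \<and>
    integrable M e \<and> (\<integral>x. cmod (e x) \<partial>M) \<le> 1 / real (Suc l)"
    by (intro allI coboundary_decomposition[OF f]) simp
  then obtain h g e c where D: "\<forall>l. (\<forall>x\<in>space M. f x = h l x + (g l x - g l (T x)) + e l x) \<and>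
    (\<forall>x\<in>space M. h l (T x) = h l x) \<and> (\<forall>x\<in>space M. cmod (g l x) \<le> c l) \<and>
    integrable M (e l) \<and> (\<integral>x. cmod (e l x) \<partial>M) \<le> 1 / real (Suc l)"
    unfolding choice_iff by blast
  have dec: "\<And>l x. x \<in> space M \<Longrightarrow> f x = h l x + (g l x - g l (T x)) + e l x"
    and h: "\<And>l x. x \<in> space M \<Longrightarrow> h l (T x) = h l x"
    and g: "\<And>l x. x \<in> space M \<Longrightarrow> cmod (g l x) \<le> c l"
    and e: "\<And>l. integrable M (e l)" "\<And>l. (\<integral>x. cmod (e l x) \<partial>M) \<le> 1 / real (Suc l)"
    using D by blast+
  have null: "AE x in M. \<exists>l. x \<notin> maximal_set (\<lambda>x. cmod (e l x)) \<kappa>" if \<kappa>: "0 < \<kappa>" for \<kappa>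
  proof -
    let ?G = "\<lambda>l. maximal_set (\<lambda>x. cmod (e l x)) \<kappa>"
    have ei: "integrable M (\<lambda>x. cmod (e l x))" for l using e(1) by auto
    have G: "?G l \<in> sets M" for l by (rule measure_maximal_set(1)[OF ei _ \<kappa>]) auto
    have "prob (\<Inter>l. ?G l) \<le> (10 + A) / \<kappa> / real (Suc l)" for l
    proof -
      have "prob (\<Inter>l. ?G l) \<le> prob (?G l)" using G by (intro finite_measure_mono) auto
      also have "\<dots> \<le> (10 + A) / \<kappa> * (\<integral>x. cmod (e l x) \<partial>M)"
        by (rule measure_maximal_set(2)[OF ei _ \<kappa>]) auto
      also have "\<dots> \<le> (10 + A) / \<kappa> * (1 / real (Suc l))"
        using A_nonneg \<kappa> by (intro mult_left_mono e) auto
      finally show ?thesis by simp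
    qed
    hence "prob (\<Inter>l. ?G l) \<le> 0"
      by (intro LIMSEQ_le_const[OF LIMSEQ_Suc[OF lim_const_over_n[of "(10 + A) / \<kappa>"]]]) auto
    hence "prob (\<Inter>l. ?G l) = 0" using measure_nonneg[of M "\<Inter>l. ?G l"] by linarith
    hence "(\<Inter>l. ?G l) \<in> null_sets M"
      using G by (intro null_setsI) (auto simp: emeasure_eq_measure)
    from AE_not_in[OF this] show ?thesis by eventually_elim auto
  qed
  have "AE x in M. \<forall>m::nat. \<exists>l. x \<notin> maximal_set (\<lambda>x. cmod (e l x)) (1 / real (Suc m))"
    unfolding AE_all_countable by (intro allI null) simp
  with AE_space show ?thesis
  proof eventually_elim
    case (elim x)
    hence x: "x \<in> space M" by simp
    have "Cauchy (\<lambda>n. average (Suc n) f x)"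
    proof (rule CauchyI')
      fix \<epsilon> :: real assume \<epsilon>: "0 < \<epsilon>"
      obtain m where m: "8 / \<epsilon> < real m" using reals_Archimedean2 by blast
      define \<kappa> where "\<kappa> = 1 / real (Suc m)"
      have "8 < \<epsilon> * real (Suc m)" using m \<epsilon> by (simp add: field_simps)
      hence \<kappa>: "0 < \<kappa>" "8 * \<kappa> < \<epsilon>" unfolding \<kappa>_def by (auto simp: pos_divide_less_eq)
      obtain l where l: "x \<notin> maximal_set (\<lambda>x. cmod (e l x)) \<kappa>"
        using elim unfolding \<kappa>_def by blast
      have c0: "0 \<le> c l" using g[OF x] norm_ge_zero order_trans by blast
      have "0 < \<kappa> / (c l + 1)" using \<kappa> c0 by simp
      from asymptotic_invariance[OF this] obtain n0 where
        n0: "\<And>n X. n0 \<le> n \<Longrightarrow> finite X \<Longrightarrow> (\<Sum>x\<in>X. \<bar>k n (x + 1) - k n x\<bar>) \<le> \<kappa> / (c l + 1)"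
        by blast
      have close: "cmod (average (Suc n) f x - h l x) \<le> 4 * \<kappa>" if "n0 \<le> n" for n
      proof -
        let ?k = "\<lambda>j. complex_of_real (k (Suc n) j)"
        have hs: "((\<lambda>j. ?k j * h l (\<tau> j x)) has_sum h l x) UNIV"
          by (rule average_invariant[where h = "h l", OF x h])
        have small: "(\<Sum>j\<in>X. \<bar>k (Suc n) (j + 1) - k (Suc n) j\<bar>) \<le> \<kappa> / (c l + 1)" if "finite X" for X
          using n0[of "Suc n" X] that \<open>n0 \<le> n\<close> by simp
        note cob = average_coboundary[where g = "g l" and c = "c l", OF x g small]
        have n1: "1 \<le> Suc n" by simp
        note err = average_outside_maximal_set[OF x l n1]
        have "?k j * f (\<tau> j x) = ?k j * h l (\<tau> j x)
            + ?k j * (g l (\<tau> j x) - g l (T (\<tau> j x))) + ?k j * e l (\<tau> j x)" for j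
          unfolding dec[OF iterate_in_space[OF x], of j l] by (simp only: distrib_left)
        hence "average (Suc n) f x = (\<Sum>\<^sub>\<infinity>j. ?k j * h l (\<tau> j x)
            + ?k j * (g l (\<tau> j x) - g l (T (\<tau> j x))) + ?k j * e l (\<tau> j x))"
          unfolding average_def by (simp only:)
        also have "\<dots> = h l x + average (Suc n) (\<lambda>x. g l x - g l (T x)) x + average (Suc n) (e l) x"
          unfolding average_def
          by (intro infsumI has_sum_add hs has_sum_infsum cob(1) err(1))
        finally have "average (Suc n) f x - h l x
            = average (Suc n) (\<lambda>x. g l x - g l (T x)) x + average (Suc n) (e l) x" by simp
        also have "cmod \<dots> \<le> c l * (\<kappa> / (c l + 1)) + 3 * \<kappa>"
          by (rule order_trans[OF norm_triangle_ineq add_mono[OF cob(2) err(2)]])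
        also have "c l * (\<kappa> / (c l + 1)) \<le> \<kappa>"
          using c0 \<kappa> by (simp add: divide_le_eq algebra_simps)
        finally show ?thesis by simp
      qed
      show "\<exists>M0. \<forall>n\<ge>M0. \<forall>n'>n. dist (average (Suc n) f x) (average (Suc n') f x) < \<epsilon>"
      proof (intro exI allI impI)
        fix n n' assume "n0 \<le> n" "n < n'"
        hence le: "cmod (average (Suc n) f x - h l x) \<le> 4 * \<kappa>" "cmod (average (Suc n') f x - h l x) \<le> 4 * \<kappa>"
          using close by auto
        have "average (Suc n) f x - average (Suc n') f x
            = (average (Suc n) f x - h l x) - (average (Suc n') f x - h l x)" by simp
        also have "cmod \<dots> \<le> 4 * \<kappa> + 4 * \<kappa>"
          by (rule order_trans[OF norm_triangle_ineq4 add_mono[OF le]])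
        finally have "cmod (average (Suc n) f x - average (Suc n') f x) \<le> 4 * \<kappa> + 4 * \<kappa>" .
        thus "dist (average (Suc n) f x) (average (Suc n') f x) < \<epsilon>"
          using \<kappa> by (simp add: dist_norm)
      qed
    qed
    thus ?case by (simp add: Cauchy_convergent_iff)
  qed
qed

end

section \<open>Verification of the hypotheses\<close>

lemma chi_1_eq_1_iff:
  assumes "\<bar>t\<bar> \<le> 1/2"
  shows "chi 1 t = 1 \<longleftrightarrow> t = 0"
proof
  assume "chi 1 t = 1"
  hence "cos (2 * (pi * t)) = 1"
    using cmod_chi_diff_1[of 1 t] by (simp add: mult.assoc)
  hence "sin (pi * t) = 0"
    using cos_double_sin[of "pi * t"] by simp
  hence "sin (pi * \<bar>t\<bar>) = 0" by (auto simp: abs_if)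
  moreover have "pi * \<bar>t\<bar> \<le> pi * (1/2)"
    using assms by (intro mult_left_mono) auto
  hence "pi * \<bar>t\<bar> < pi" using pi_gt_zero by linarith
  ultimately have "\<not> 0 < pi * \<bar>t\<bar>"
    using sin_gt_zero[of "pi * \<bar>t\<bar>"] by force
  thus "t = 0" by (simp add: zero_less_mult_iff)
qed simp

text \<open>
  The case of equality in the triangle inequality for the average of the characters.
\<close>

lemma chi_eq_fourier:
  assumes "cmod (fourier \<mu> t) = 1" "k \<in> set_pmf \<mu>"
  shows "chi k t = fourier \<mu> t"
proof -
  define z where "z = fourier \<mu> t"
  have zz: "cnj z * z = 1"
    using assms(1) complex_norm_square[of z] by (simp add: z_def mult.commute)
  have le: "Re (cnj z * chi k t) \<le> 1" for k
    using complex_Re_le_cmod[of "cnj z * chi k t"] assms(1) by (simp add: norm_mult z_def)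
  have int: "integrable (measure_pmf \<mu>) (\<lambda>k. cnj z * chi k t)" by simp
  have "measure_pmf.expectation \<mu> (\<lambda>k. Re (cnj z * chi k t)) = Re (cnj z * z)"
    using Re_expectation[OF int] by (simp add: z_def fourier_expectation)
  moreover have intR: "integrable (measure_pmf \<mu>) (\<lambda>k. Re (cnj z * chi k t))"
    using int by (rule integrable_Re)
  ultimately have "measure_pmf.expectation \<mu> (\<lambda>k. 1 - Re (cnj z * chi k t)) = 0"
    using zz by simp
  hence "AE k in measure_pmf \<mu>. 1 - Re (cnj z * chi k t) = 0"
    using le intR by (subst (asm) integral_nonneg_eq_0_iff_AE) auto
  hence re: "Re (cnj z * chi k t) = 1"
    using assms(2) by (auto simp: AE_measure_pmf_iff)
  have "cmod (cnj z * chi k t) = 1"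
    using assms(1) by (simp add: norm_mult z_def)
  hence "1 = 1\<^sup>2 + (Im (cnj z * chi k t))\<^sup>2"
    using cmod_power2[of "cnj z * chi k t"] unfolding re by (simp only: power_one)
  hence im: "Im (cnj z * chi k t) = 0" by simp
  have "cnj z * chi k t = 1"
    by (rule complex_eqI) (simp_all only: re im one_complex.sel)
  moreover have "chi k t = z * (cnj z * chi k t)"
    using zz by (simp only: mult.assoc[symmetric] mult.commute[of z] mult_1)
  ultimately have "chi k t = z" by (simp only: mult_1_right)
  thus ?thesis by (simp only: z_def)
qed

text \<open>
  If \<open>\<bar>\<theta>(t)\<bar> = 1\<close>, the character at \<open>t\<close> is constant on the support, which then lies in a coset of its kernel.
\<close>

lemma strictly_aperiodic_fourier:
  assumes "strictly_aperiodic \<mu>" "\<bar>t\<bar> \<le> 1/2" "t \<noteq> 0"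
  shows "cmod (fourier \<mu> t) < 1"
proof (rule ccontr)
  assume "\<not> cmod (fourier \<mu> t) < 1"
  hence 1: "cmod (fourier \<mu> t) = 1"
    using norm_fourier_le_1[of \<mu> t] by simp
  define H where "H = {k. chi k t = 1}"
  obtain k0 where k0: "k0 \<in> set_pmf \<mu>"
    using set_pmf_not_empty[of \<mu>] by blast
  have "subgroup H integer_group"
    by (rule subgroup.intro)
       (auto simp: H_def integer_group_def chi_add_freq chi_uminus
          simp flip: integer_group_def)
  moreover have "1 \<notin> H"
    using chi_1_eq_1_iff[OF assms(2)] assms(3) by (simp add: H_def)
  hence "H \<noteq> carrier integer_group" by auto
  moreover have "H #>\<^bsub>integer_group\<^esub> k0 \<in> rcosets\<^bsub>integer_group\<^esub> H"
    by (auto simp: RCOSETS_def)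
  moreover have "set_pmf \<mu> \<subseteq> H #>\<^bsub>integer_group\<^esub> k0"
  proof
    fix k assume "k \<in> set_pmf \<mu>"
    hence "chi k t = chi k0 t"
      using chi_eq_fourier[OF 1] k0 by simp
    hence "chi (k - k0) t * chi k0 t = 1 * chi k0 t"
      using chi_add_freq[of "k - k0" k0 t] by simp
    moreover have "chi k0 t \<noteq> 0" using norm_chi[of k0 t] by force
    ultimately have "chi (k - k0) t = 1" by simp
    hence "k - k0 \<in> H" by (simp only: H_def mem_Collect_eq)
    thus "k \<in> H #>\<^bsub>integer_group\<^esub> k0"
      unfolding r_coset_def by (rule UN_I) simp
  qed
  ultimately show False
    using assms(1) unfolding strictly_aperiodic_def by blast
qed

lemma bounded_angular_ratio_bound:
  assumes "bounded_angular_ratio \<mu>"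
  obtains B where "1 \<le> B" "\<And>t. cmod (fourier \<mu> t - 1) \<le> B * (1 - cmod (fourier \<mu> t))"
proof -
  have ap: "strictly_aperiodic \<mu>" and fin: "1 \<le> angular_ratio_sup \<mu>" "angular_ratio_sup \<mu> < \<infinity>"
    using assms by (auto simp: bounded_angular_ratio_def)
  then obtain b where b: "angular_ratio_sup \<mu> = ereal b"
    by (cases "angular_ratio_sup \<mu>") auto
  have base: "cmod (fourier \<mu> t - 1) \<le> max 1 b * (1 - cmod (fourier \<mu> t))" if t: "t \<in> {- 1/2..<1/2}" for t
  proof (cases "t = 0")
    case False
    have pos: "0 < 1 - cmod (fourier \<mu> t)"
      using strictly_aperiodic_fourier[OF ap _ False] t by (auto simp: abs_le_iff)
    have "ereal (cmod (fourier \<mu> t - 1) / (1 - cmod (fourier \<mu> t))) \<le> angular_ratio_sup \<mu>"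
      unfolding angular_ratio_sup_def using t False by (intro SUP_upper) auto
    hence "cmod (fourier \<mu> t - 1) / (1 - cmod (fourier \<mu> t)) \<le> b"
      by (simp add: b)
    hence "cmod (fourier \<mu> t - 1) \<le> b * (1 - cmod (fourier \<mu> t))"
      using pos by (simp add: pos_divide_le_eq)
    also have "\<dots> \<le> max 1 b * (1 - cmod (fourier \<mu> t))"
      using pos by (intro mult_right_mono) auto
    finally show ?thesis .
  qed simp
  show thesis
  proof (rule that[of "max 1 b"])
    fix t :: real
    define m where "m = \<lfloor>t + 1/2\<rfloor>"
    have "t - of_int m \<in> {- 1/2..<1/2}"
      unfolding m_def atLeastLessThan_iff by linarith
    from base[OF this] show "cmod (fourier \<mu> t - 1) \<le> max 1 b * (1 - cmod (fourier \<mu> t))"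
      using fourier_periodic[of \<mu> "t - of_int m" m] by simp
  qed simp
qed

text \<open>
  The defect is convex on \<open>(0, \<delta>)\<close> and vanishes at 0, so the chord over \<open>[0, s]\<close> is less steep than the chord over
  \<open>[s, t]\<close>.  At 0 itself, where the derivatives may fail to exist, the mean value theorem uses the continuity of the
  defect.
\<close>

lemma defect_convex_at_0:
  assumes d1: "\<And>t. 0 < t \<Longrightarrow> t < \<delta> \<Longrightarrow> (fourier \<mu> has_vector_derivative \<theta>' t) (at t)"
    and d2: "\<And>t. 0 < t \<Longrightarrow> t < \<delta> \<Longrightarrow> (\<theta>' has_vector_derivative \<theta>'' t) (at t)"
    and concave: "\<And>t. 0 < t \<Longrightarrow> t < \<delta> \<Longrightarrow> Re (\<theta>'' t) < 0"
    and st: "0 < s" "s \<le> t" "t < \<delta>"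
  shows "t * defect \<mu> s \<le> s * defect \<mu> t"
proof (cases "s = t")
  case False
  have re: "((\<lambda>t. Re (g t)) has_real_derivative Re g') (at t)"
    if "(g has_vector_derivative g') (at t)" for g g' t
    using bounded_linear.has_vector_derivative[OF bounded_linear_Re that]
    by (simp add: has_real_derivative_iff_has_vector_derivative)
  have u1: "(defect \<mu> has_real_derivative - Re (\<theta>' r)) (at r)" if "0 < r" "r < \<delta>" for r
    unfolding defect_def[abs_def] using DERIV_diff[OF DERIV_const re[OF d1[OF that]], of 1] by simp
  have diff: "defect \<mu> differentiable (at r)" if "0 < r" "r < \<delta>" for r
    using u1[OF that] real_differentiable_def by blast
  have cont: "continuous_on X (defect \<mu>)" for X
    unfolding defect_def[abs_def] by (intro continuous_intros)
  have "\<exists>l z. 0 < z \<and> z < s \<and> DERIV (defect \<mu>) z :> l \<and> defect \<mu> s - defect \<mu> 0 = (s - 0) * l"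
    using st by (intro MVT cont diff) auto
  then obtain l1 z1 where z1: "0 < z1" "z1 < s" "DERIV (defect \<mu>) z1 :> l1" "defect \<mu> s = s * l1"
    by auto
  have "\<exists>l z. s < z \<and> z < t \<and> DERIV (defect \<mu>) z :> l \<and> defect \<mu> t - defect \<mu> s = (t - s) * l"
    using st False by (intro MVT cont diff) auto
  then obtain l2 z2 where z2: "s < z2" "z2 < t" "DERIV (defect \<mu>) z2 :> l2"
      "defect \<mu> t - defect \<mu> s = (t - s) * l2"
    by auto
  have l: "l1 = - Re (\<theta>' z1)" "l2 = - Re (\<theta>' z2)"
    using DERIV_unique[OF z1(3) u1] DERIV_unique[OF z2(3) u1] z1 z2 st by auto
  have "Re (\<theta>' z2) \<le> Re (\<theta>' z1)"
  proof (rule DERIV_nonpos_imp_nonincreasing[where f = "\<lambda>r. Re (\<theta>' r)"])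
    fix r assume "z1 \<le> r" "r \<le> z2"
    hence "0 < r" "r < \<delta>" using z1 z2 st by auto
    from re[OF d2[OF this]] concave[OF this]
    show "\<exists>y. ((\<lambda>r. Re (\<theta>' r)) has_real_derivative y) (at r) \<and> y \<le> 0"
      by (intro exI[of _ "Re (\<theta>'' r)"]) auto
  qed (use z1 z2 in auto)
  hence "l1 \<le> l2" using l by simp
  hence "s * ((t - s) * l1) \<le> s * ((t - s) * l2)"
    using st by (intro mult_left_mono) auto
  moreover have "t * defect \<mu> s = s * defect \<mu> s + s * ((t - s) * l1)"
    unfolding z1(4) by (simp add: algebra_simps)
  moreover have "s * defect \<mu> t = s * defect \<mu> s + s * ((t - s) * l2)"
    unfolding z2(4)[symmetric] by (simp add: algebra_simps)
  ultimately show ?thesis by linarith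
qed simp

text \<open>
  Away from 0 the defect lies between a positive minimum, by compactness, and 2.
\<close>

lemma defect_quasiconvex:
  assumes ap: "strictly_aperiodic \<mu>" and \<delta>: "0 < \<delta>"
    and conv: "\<And>s t. 0 < s \<Longrightarrow> s \<le> t \<Longrightarrow> t < \<delta> \<Longrightarrow> t * defect \<mu> s \<le> s * defect \<mu> t"
  obtains C where "1 \<le> C"
    "\<And>s t. 0 < s \<Longrightarrow> s \<le> t \<Longrightarrow> t \<le> 1/2 \<Longrightarrow> t * defect \<mu> s \<le> C * s * defect \<mu> t"
proof -
  define d where "d = min (\<delta> / 2) (1/2)"
  have d: "0 < d" "d \<le> 1/2" "d < \<delta>" unfolding d_def using \<delta> by (auto simp: min_def)
  have "continuous_on {d..1/2} (defect \<mu>)"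
    unfolding defect_def[abs_def] by (intro continuous_intros)
  moreover have "compact {d..1/2}" "{d..1/2} \<noteq> {}" using d by auto
  ultimately obtain r where r: "r \<in> {d..1/2}" "\<And>t. t \<in> {d..1/2} \<Longrightarrow> defect \<mu> r \<le> defect \<mu> t"
    using continuous_attains_inf[of "{d..1/2}" "defect \<mu>"] by blast
  define m where "m = defect \<mu> r"
  have "cmod (fourier \<mu> r) < 1"
    using r d by (intro strictly_aperiodic_fourier[OF ap]) auto
  hence m: "0 < m"
    unfolding m_def defect_def using complex_Re_le_cmod[of "fourier \<mu> r"] by linarith
  define C where "C = max 1 (1 / (d * m))"
  have C: "1 \<le> C" "1 \<le> C * d * m"
  proof -
    show "1 \<le> C" by (simp add: C_def)
    have "1 / (d * m) * (d * m) \<le> C * (d * m)"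
      unfolding C_def using d m by (intro mult_right_mono) auto
    thus "1 \<le> C * d * m" using d m by (simp add: mult.assoc)
  qed
  show thesis
  proof (rule that[OF C(1)])
    fix s t :: real assume st: "0 < s" "s \<le> t" "t \<le> 1/2"
    show "t * defect \<mu> s \<le> C * s * defect \<mu> t"
    proof (cases "t \<le> d")
      case True
      hence "t * defect \<mu> s \<le> 1 * (s * defect \<mu> t)" using conv[of s t] st d by simp
      also have "\<dots> \<le> C * (s * defect \<mu> t)" using C st by (intro mult_right_mono) auto
      finally show ?thesis by (simp add: mult.assoc)
    next
      case False
      hence mt: "m \<le> defect \<mu> t" unfolding m_def using r(2)[of t] st by simp
      have "d * defect \<mu> s \<le> 2 * s"
      proof (cases "s \<le> d")
        case True
        hence "d * defect \<mu> s \<le> s * defect \<mu> d" using conv[of s d] st d by simp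
        also have "\<dots> \<le> s * 2" using st defect_le_2[of \<mu> d] by (intro mult_left_mono) auto
        finally show ?thesis by simp
      next
        case False
        hence "d * defect \<mu> s \<le> s * 2"
          using d defect_le_2[of \<mu> s] by (intro mult_mono) auto
        thus ?thesis by simp
      qed
      moreover have "t * (d * defect \<mu> s) \<le> 1/2 * (d * defect \<mu> s)"
        using st d by (intro mult_right_mono) auto
      ultimately have "d * (t * defect \<mu> s) \<le> 1 * s" by (simp add: mult_ac)
      also have "\<dots> \<le> (C * d * m) * s" using C st by (intro mult_right_mono) auto
      also have "\<dots> = d * (C * s * m)" by simp
      also have "\<dots> \<le> d * (C * s * defect \<mu> t)"
        using C st d mt by (intro mult_left_mono) auto
      finally show ?thesis using d by simp
    qed
  qed
qed

theorem theorem2p1: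
  fixes \<mu> :: "int pmf"
    and \<alpha> \<delta> :: real
    and \<theta>' \<theta>'' :: "real \<Rightarrow> complex"
    and p :: "real \<Rightarrow> real"
    and M :: "'a measure"
    and T :: "'a \<Rightarrow> 'a"
    and f :: "'a \<Rightarrow> complex"
  assumes "finite_first_moment \<mu>"
    and "bounded_angular_ratio \<mu>"
    and "0 < \<alpha>" and "\<alpha> \<le> 1"
    and "(\<lambda>n::nat. \<Sum>k\<in>{k::int. \<bar>k\<bar> \<le> int n}. (real_of_int k)\<^sup>2 * pmf \<mu> k)
           \<in> O(\<lambda>n. real n powr (1 - \<alpha>))"
    and "0 < \<delta>"
    and "\<And>t. 0 < \<bar>t\<bar> \<Longrightarrow> \<bar>t\<bar> < \<delta> \<Longrightarrow> (fourier \<mu> has_vector_derivative \<theta>' t) (at t)"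
    and "\<And>t. 0 < \<bar>t\<bar> \<Longrightarrow> \<bar>t\<bar> < \<delta> \<Longrightarrow> (\<theta>' has_vector_derivative \<theta>'' t) (at t)"
    and "\<And>t. 0 < \<bar>t\<bar> \<Longrightarrow> \<bar>t\<bar> < \<delta> \<Longrightarrow> Re (\<theta>'' t) < 0"
    and "\<exists>B. \<forall>t. 0 < \<bar>t\<bar> \<and> \<bar>t\<bar> < \<delta> \<longrightarrow> \<bar>Re (\<theta>'' t) - p t\<bar> \<le> B"
    and "\<And>t s. sgn t = sgn s \<Longrightarrow> 0 < \<bar>t\<bar> \<Longrightarrow> \<bar>t\<bar> \<le> \<bar>s\<bar> \<Longrightarrow> \<bar>s\<bar> < \<delta> \<Longrightarrow> p t \<le> p s"
    and "prob_space M"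
    and "invertible_measure_preserving M T"
    and "integrable M f"
  shows "AE x in M. convergent (\<lambda>n. conv_average M T \<mu> (Suc n) f x)"
proof -
  obtain B where B: "1 \<le> B" "\<And>t. cmod (fourier \<mu> t - 1) \<le> B * (1 - cmod (fourier \<mu> t))"
    using bounded_angular_ratio_bound[OF assms(2)] by metis
  have ap: "strictly_aperiodic \<mu>"
    using assms(2) by (simp add: bounded_angular_ratio_def)
  have "t * defect \<mu> s \<le> s * defect \<mu> t" if "0 < s" "s \<le> t" "t < \<delta>" for s t
    using that assms(7-9) by (intro defect_convex_at_0[of \<delta> \<mu> \<theta>' \<theta>'']) auto
  then obtain C where C: "1 \<le> C"
      "\<And>s t. 0 < s \<Longrightarrow> s \<le> t \<Longrightarrow> t \<le> 1/2 \<Longrightarrow> t * defect \<mu> s \<le> C * s * defect \<mu> t"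
    using defect_quasiconvex[OF ap assms(6)] by metis
  interpret q: quasiconvex_symbol \<mu> B C
  proof
    fix t :: real assume t: "0 < t" "t \<le> 1/2"
    hence "cmod (fourier \<mu> t) < 1"
      by (intro strictly_aperiodic_fourier[OF ap]) auto
    thus "0 < defect \<mu> t"
      unfolding defect_def using complex_Re_le_cmod[of "fourier \<mu> t"] by linarith
  qed (use B C in auto)
  interpret prob_space M by (rule assms(12))
  interpret a: averaging_kernels q.K q.kernel_modulus "386 * q.shift_const + 2" M T
  proof
    show "invertible_measure_preserving M T" by (rule assms(13))
    show "(q.K n has_sum 1) UNIV" for n
      using pmf_has_sum_1[of "conv_pmf \<mu> n"] by (simp add: q.K_def[abs_def])
    show "\<exists>n0. \<forall>n\<ge>n0. \<forall>X. finite X \<longrightarrow> (\<Sum>x\<in>X. \<bar>q.K n (x + 1) - q.K n x\<bar>) \<le> \<epsilon>"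
      if "0 < \<epsilon>" for \<epsilon>
      using that by (rule q.shift_invariance_l1)
  qed (auto intro: q.sum_K_le q.kernel_modulus_bound q.sum_kernel_modulus)
  have "conv_average M T \<mu> n f x = a.average n f x" for n x
    by (simp add: conv_average_def a.average_def conv_power_eq_pmf q.K_def)
  thus ?thesis
    using a.AE_convergent_average[OF assms(14)] by simp
qed

end
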